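(* Let $G=A\ast_C B$ be a free product of finitely presented groups $A$ and $B$ amalgamated over a finitely generated subgroup $C$. Assume that the following algorithmic problems are decidable: - the Word Problem in $A$ and in $B$; - the Membership Search Problem for the subgroup $C$ in $A$ and in $B$; - the Coset Representative Search Problem for the subgroup $C$ in $A$ and in $B$; - the Cardinality Search Problem for $\Phi(\mathrm{Sub}(C),A)$ in $A$ and for $\Phi(\mathrm{Sub}(C),B)$ in $B$. Then the Conjugacy Search Problem in $G$ is decidable for all pairs from $CR_{>1}\times G$, where $CR_{>1}$ is the set of elements of $G$ that are conjugate in $G$ to cyclically reduced regular elements of length greater than $1$.
   Context: $A=\langle X\mid R_A\rangle$ and $B=\langle Y\mid R_B\rangle$ are finite presentations; $C$ is generated by a finite set $Z$ and embedded in $A$ and in $B$ by monomorphisms $\phi,\psi$; $G=\langle X\cup Y\mid R_A,R_B,\ z^\phi=z^\psi\ (z\in Z)\rangle$. $A,B$ are identified with subgroups of $G$ and $C=A\cap B$. Elements are given as words in the generators, $C$ by the finite tuples of words $z^\phi$, $z^\psi$. Conjugation: $h^g=g^{-1}hg$, $K^g=g^{-1}Kg$. $N^*_G(C)=\{g\in G\mid C\cap C^g\neq1\}$ and $Z_G(C)=\bigcup_{g\in N^*_G(C)\smallsetminus C}\left(C^{g^{-1}}\cap C\right)$. An element of $G$ is singular if it lies in $BH=(N^*_G(C)\smallsetminus C)\cup Z_G(C)$, and regular otherwise. Reduced form: $g=cg_1\cdots g_n$ with $c\in C$, $g_i\in(A\cup B)\smallsetminus C$ and consecutive $g_i$ in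 different factors; the length $n=l(g)$ depends only on $g$. The element $g$ is cyclically reduced if $n=0$; or $n=1$ and $g$ is not conjugate in $G$ to an element of $C$; or $n\ge2$ and $g_1,g_n$ lie in different factors. Algorithmic problems for $H=A$ or $B$. Membership Search Problem for $C$: given a word $w$, decide whether $w\in C$ and, if so, write $w$ as a product of the given generators of $C$. Coset Representative Search Problem for $C$: there are a recursive set of representatives of the right cosets of $C$ in $H$ and an algorithm which for a given word $w$ finds the representative of $Cw$. Conjugacy Search Problem in $G$: given $u,v$, decide whether they are conjugate in $G$ and, if so, find a conjugator. A problem is decidable on a set $\Phi$ of inputs if there is a partial algorithm which halts at least on all inputs in $\Phi$ and solves the problem correctly on every input on which it halts. Cardinality Search Problem. $\mathrm{Sub}(C)$ is the set of all subgroups of $C$. For a collection $\mathcal M$ of subgroups of $H$, $\Phi(\mathcal M,H)$ is the least collection of subsets of $H$ containing $\mathcal M$ and closed under shifts $M\mapsto uMv$ ($u,v\in H$) and under (pairwise) intersections. The Cardinality Search Problem for $\Phi(\mathrm{Sub}(C),H)$: given a set $D\in\Phi(\mathrm{Sub}(C),H)$, decide whether $D$ is empty, finite, or infinite, and if $D$ is finite and non-empty, list all elements of $D$. Sets are given by effective descriptions: $D$ is given by a formal expression built from described subgroups of $C$ by shifts by words of $H$ and intersections; a subgroup of $C$ is described either by a finite generating tuple, or, recursively, as $Dh^{-1}$, where $D\subseteq C$ is a non-empty set in $\Phi(\mathrm{Sub}(C),A)$ or $\Phi(\mathrm{Sub}(C),B)$ given by such an expression and $h\in D$. *)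

theory Defs
  imports "HOL-Algebra.Coset" "HOL-Algebra.Generated_Groups" "HOL-Library.Nat_Bijection"
begin

section \<open>Computability\<close>

text \<open>
  Unary partial recursive functions (\<^term>\<open>None\<close> means divergence); arguments are tupled with
  the Cantor pairing \<^term>\<open>prod_encode\<close>. In \<open>prec\<close> the argument codes \<open>(a, k)\<close>, with \<open>k\<close> the
  recursion variable.
\<close>

inductive partrec :: "(nat \<Rightarrow> nat option) \<Rightarrow> bool" where
  zero: "partrec (\<lambda>_. Some 0)"
| succ: "partrec (\<lambda>n. Some (Suc n))"
| left: "partrec (\<lambda>n. Some (fst (prod_decode n)))"
| right: "partrec (\<lambda>n. Some (snd (prod_decode n)))"
| pair: "partrec f \<Longrightarrow> partrec g \<Longrightarrow>
    partrec (\<lambda>n. Option.bind (f n) (\<lambda>a. Option.bind (g n) (\<lambda>b. Some (prod_encode (a, b)))))"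
| comp: "partrec f \<Longrightarrow> partrec g \<Longrightarrow> partrec (\<lambda>n. Option.bind (g n) f)"
| prec: "partrec f \<Longrightarrow> partrec g \<Longrightarrow>
    partrec (\<lambda>n. case prod_decode n of (a, k) \<Rightarrow>
      rec_nat (f a) (\<lambda>i r. Option.bind r (\<lambda>y. g (prod_encode (a, prod_encode (i, y))))) k)"
| minim: "partrec f \<Longrightarrow>
    partrec (\<lambda>a. if \<exists>m. f (prod_encode (a, m)) = Some 0 \<and>
                         (\<forall>k<m. \<exists>y. f (prod_encode (a, k)) = Some (Suc y))
                  then Some (LEAST m. f (prod_encode (a, m)) = Some 0) else None)"

class encodable =
  fixes encode :: "'a \<Rightarrow> nat"
  assumes inj_encode: "inj encode"

lemma encode_eq_iff [simp]: "encode x = encode y \<longleftrightarrow> x = y"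
  using inj_encode by (auto dest: injD)

instantiation nat :: encodable
begin
definition encode_nat :: "nat \<Rightarrow> nat" where "encode_nat n = n"
instance by standard (auto simp: inj_def encode_nat_def)
end

instantiation bool :: encodable
begin
definition encode_bool :: "bool \<Rightarrow> nat" where "encode_bool b = (if b then 1 else 0)"
instance by standard (auto simp: inj_def encode_bool_def)
end

instantiation prod :: (encodable, encodable) encodable
begin
definition encode_prod :: "'a \<times> 'b \<Rightarrow> nat"
  where "encode_prod p = prod_encode (encode (fst p), encode (snd p))"
instance by standard (auto simp: inj_def encode_prod_def prod_eq_iff)
end

instantiation list :: (encodable) encodable
begin
definition encode_list :: "'a list \<Rightarrow> nat" where "encode_list xs = list_encode (map encode xs)"
instance by standard (auto simp: encode_list_def inj_map_eq_map[OF inj_encode] intro!: injI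
  dest!: arg_cong[where f = list_decode])
end

instantiation option :: (encodable) encodable
begin
definition encode_option :: "'a option \<Rightarrow> nat"
  where "encode_option x = (case x of None \<Rightarrow> 0 | Some y \<Rightarrow> Suc (encode y))"
instance by standard (auto simp: inj_def encode_option_def split: option.splits)
end

text \<open>
  A search problem is given by its inputs \<open>I\<close> and the relation \<open>sol x y\<close> of \<open>y\<close> being a correct
  answer to \<open>x\<close>. A single partial algorithm has to halt on all of \<open>\<Phi>\<close>, and has to be correct on
  every input from \<open>I\<close> on which it halts; its behaviour on codes of non-inputs is irrelevant.
\<close>

definition decidable_on ::
    "'i::encodable set \<Rightarrow> 'i set \<Rightarrow> ('i \<Rightarrow> 'o::encodable \<Rightarrow> bool) \<Rightarrow> bool" where
  "decidable_on \<Phi> I sol \<longleftrightarrow>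
    (\<exists>f. partrec f \<and> (\<forall>x\<in>\<Phi>. f (encode x) \<noteq> None) \<and>
      (\<forall>x\<in>I. \<forall>n. f (encode x) = Some n \<longrightarrow> (\<exists>y. n = encode y \<and> sol x y)))"

definition decidable :: "'i::encodable set \<Rightarrow> ('i \<Rightarrow> 'o::encodable \<Rightarrow> bool) \<Rightarrow> bool" where
  "decidable I sol \<longleftrightarrow> decidable_on I I sol"


section \<open>Presented groups\<close>

text \<open>Generators are natural numbers; \<open>(x, True)\<close> stands for \<open>x\<close> and \<open>(x, False)\<close> for its inverse.\<close>

type_synonym word = "(nat \<times> bool) list"

record presentation =
  gens :: "nat set"
  rels :: "word set"

definition words_over :: "nat set \<Rightarrow> word set" where
  "words_over X = {w. fst ` set w \<subseteq> X}"

abbreviation words :: "presentation \<Rightarrow> word set" where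
  "words P \<equiv> words_over (gens P)"

definition inv_word :: "word \<Rightarrow> word" where
  "inv_word w = rev (map (\<lambda>(x, b). (x, \<not> b)) w)"

definition finite_presentation :: "presentation \<Rightarrow> bool" where
  "finite_presentation P \<longleftrightarrow> finite (gens P) \<and> finite (rels P) \<and> rels P \<subseteq> words P"

inductive_set weq :: "presentation \<Rightarrow> (word \<times> word) set" for P where
  refl: "w \<in> words P \<Longrightarrow> (w, w) \<in> weq P"
| sym: "(u, v) \<in> weq P \<Longrightarrow> (v, u) \<in> weq P"
| trans: "(u, v) \<in> weq P \<Longrightarrow> (v, w) \<in> weq P \<Longrightarrow> (u, w) \<in> weq P"
| cancel: "u \<in> words P \<Longrightarrow> v \<in> words P \<Longrightarrow> x \<in> gens P \<Longrightarrow>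
    (u @ [(x, b), (x, \<not> b)] @ v, u @ v) \<in> weq P"
| rel: "u \<in> words P \<Longrightarrow> v \<in> words P \<Longrightarrow> r \<in> rels P \<Longrightarrow> r \<in> words P \<Longrightarrow>
    (u @ r @ v, u @ v) \<in> weq P"

definition wval :: "presentation \<Rightarrow> word \<Rightarrow> word set" where
  "wval P w = weq P `` {w}"

definition grp :: "presentation \<Rightarrow> word set monoid" where
  "grp P = \<lparr>carrier = words P // weq P,
            mult = (\<lambda>p q. \<Union>u\<in>p. \<Union>v\<in>q. wval P (u @ v)),
            one = wval P []\<rparr>"

lemma words_over_append [simp]: "u @ v \<in> words_over X \<longleftrightarrow> u \<in> words_over X \<and> v \<in> words_over X"
  by (auto simp: words_over_def)

lemma words_over_Nil [simp]: "[] \<in> words_over X"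
  by (simp add: words_over_def)

lemma words_over_Cons [simp]: "a # w \<in> words_over X \<longleftrightarrow> fst a \<in> X \<and> w \<in> words_over X"
  by (auto simp: words_over_def)

lemma inv_word_words [simp]: "inv_word w \<in> words_over X \<longleftrightarrow> w \<in> words_over X"
  by (auto simp: words_over_def inv_word_def image_image case_prod_beta)

lemma weq_words: "(u, v) \<in> weq P \<Longrightarrow> u \<in> words P \<and> v \<in> words P"
  by (induction rule: weq.induct) auto

lemma equiv_weq: "equiv (words P) (weq P)"
  by (rule equivI)
    (auto simp: refl_on_def sym_def trans_def intro: weq.intros dest: weq_words)

lemma weq_append_right: "(u, v) \<in> weq P \<Longrightarrow> w \<in> words P \<Longrightarrow> (u @ w, v @ w) \<in> weq P"
proof (induction rule: weq.induct)
  case (cancel u v x b)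
  then show ?case using weq.cancel[of u P "v @ w" x b] by simp
next
  case (rel u v r)
  then show ?case using weq.rel[of u P "v @ w" r] by simp
qed (auto intro: weq.intros)

lemma weq_append_left: "(u, v) \<in> weq P \<Longrightarrow> w \<in> words P \<Longrightarrow> (w @ u, w @ v) \<in> weq P"
proof (induction rule: weq.induct)
  case (cancel u v x b)
  then show ?case using weq.cancel[of "w @ u" P v x b] by simp
next
  case (rel u v r)
  then show ?case using weq.rel[of "w @ u" P v r] by simp
qed (auto intro: weq.intros)

lemma weq_append: "(u, u') \<in> weq P \<Longrightarrow> (v, v') \<in> weq P \<Longrightarrow> (u @ v, u' @ v') \<in> weq P"
  by (meson weq.trans weq_append_left weq_append_right weq_words)

lemma weq_inv_word: "w \<in> words P \<Longrightarrow> (inv_word w @ w, []) \<in> weq P"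
proof (induction w)
  case Nil
  then show ?case by (auto simp: inv_word_def intro: weq.refl)
next
  case (Cons a w)
  obtain x b where a: "a = (x, b)" by (cases a)
  have "(inv_word w @ [(x, \<not> b), (x, \<not> \<not> b)] @ w, inv_word w @ w) \<in> weq P"
    using Cons.prems by (intro weq.cancel) (auto simp: a)
  then show ?case using Cons by (auto simp: a inv_word_def intro: weq.trans)
qed

lemma wval_eq_iff: "u \<in> words P \<Longrightarrow> v \<in> words P \<Longrightarrow> wval P u = wval P v \<longleftrightarrow> (u, v) \<in> weq P"
  unfolding wval_def by (simp add: eq_equiv_class_iff[OF equiv_weq])

lemma carrier_grp: "carrier (grp P) = wval P ` words P"
  by (auto simp: grp_def wval_def quotient_def)

lemma one_grp: "\<one>\<^bsub>grp P\<^esub> = wval P []"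
  by (simp add: grp_def)

lemma mult_grp:
  assumes "u \<in> words P" "v \<in> words P"
  shows "wval P u \<otimes>\<^bsub>grp P\<^esub> wval P v = wval P (u @ v)"
proof -
  have eq: "wval P (u' @ v') = wval P (u @ v)" if "u' \<in> wval P u" "v' \<in> wval P v" for u' v'
  proof -
    have "(u', u) \<in> weq P" "(v', v) \<in> weq P"
      using that by (auto simp: wval_def intro: weq.sym)
    then have "(u' @ v', u @ v) \<in> weq P" by (rule weq_append)
    then show ?thesis by (simp add: wval_def equiv_class_eq[OF equiv_weq])
  qed
  have "u \<in> wval P u" "v \<in> wval P v"
    using assms by (auto simp: wval_def intro: weq.refl)
  then have "(\<Union>u'\<in>wval P u. \<Union>v'\<in>wval P v. wval P (u' @ v')) = wval P (u @ v)"
    using eq by blast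
  then show ?thesis by (simp add: grp_def)
qed

lemma group_grp: "group (grp P)"
proof (rule groupI)
  fix x assume "x \<in> carrier (grp P)"
  then obtain w where w: "w \<in> words P" "x = wval P w" by (auto simp: carrier_grp)
  show "\<one>\<^bsub>grp P\<^esub> \<otimes>\<^bsub>grp P\<^esub> x = x" using w by (simp add: one_grp mult_grp)
  have "wval P (inv_word w) \<otimes>\<^bsub>grp P\<^esub> x = \<one>\<^bsub>grp P\<^esub>"
    using w weq_inv_word[of w P] by (simp add: one_grp mult_grp wval_eq_iff)
  then show "\<exists>y\<in>carrier (grp P). y \<otimes>\<^bsub>grp P\<^esub> x = \<one>\<^bsub>grp P\<^esub>"
    using w by (auto simp: carrier_grp)
qed (auto simp: carrier_grp mult_grp one_grp)


section \<open>Singular and regular elements, reduced forms\<close>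

definition conj_by :: "('a, 'm) monoid_scheme \<Rightarrow> 'a \<Rightarrow> 'a \<Rightarrow> 'a" where
  "conj_by G h g = inv\<^bsub>G\<^esub> g \<otimes>\<^bsub>G\<^esub> h \<otimes>\<^bsub>G\<^esub> g"

definition conjugate :: "('a, 'm) monoid_scheme \<Rightarrow> 'a \<Rightarrow> 'a \<Rightarrow> bool" where
  "conjugate G u v \<longleftrightarrow> (\<exists>g\<in>carrier G. conj_by G u g = v)"

definition conj_set :: "('a, 'm) monoid_scheme \<Rightarrow> 'a set \<Rightarrow> 'a \<Rightarrow> 'a set" where
  "conj_set G K g = (\<lambda>h. conj_by G h g) ` K"

definition Nstar :: "('a, 'm) monoid_scheme \<Rightarrow> 'a set \<Rightarrow> 'a set" where
  "Nstar G C = {g \<in> carrier G. C \<inter> conj_set G C g \<noteq> {\<one>\<^bsub>G\<^esub>}}"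

definition ZG :: "('a, 'm) monoid_scheme \<Rightarrow> 'a set \<Rightarrow> 'a set" where
  "ZG G C = (\<Union>g\<in>Nstar G C - C. conj_set G C (inv\<^bsub>G\<^esub> g) \<inter> C)"

definition BH :: "('a, 'm) monoid_scheme \<Rightarrow> 'a set \<Rightarrow> 'a set" where
  "BH G C = (Nstar G C - C) \<union> ZG G C"

definition regular :: "('a, 'm) monoid_scheme \<Rightarrow> 'a set \<Rightarrow> 'a \<Rightarrow> bool" where
  "regular G C g \<longleftrightarrow> g \<in> carrier G \<and> g \<notin> BH G C"

definition different_factors :: "'a set \<Rightarrow> 'a set \<Rightarrow> 'a \<Rightarrow> 'a \<Rightarrow> bool" where
  "different_factors A B x y \<longleftrightarrow> (x \<in> A \<and> y \<in> B) \<or> (x \<in> B \<and> y \<in> A)"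

text \<open>
  For elements outside \<open>C = A \<inter> B\<close>, \<^term>\<open>different_factors A B x y\<close> excludes that \<open>x\<close> and \<open>y\<close> lie in
  the same factor.
\<close>

definition reduced_form ::
    "('a, 'm) monoid_scheme \<Rightarrow> 'a set \<Rightarrow> 'a set \<Rightarrow> 'a set \<Rightarrow> 'a \<Rightarrow> 'a list \<Rightarrow> 'a \<Rightarrow> bool" where
  "reduced_form G A B C c gs g \<longleftrightarrow>
     c \<in> C \<and> set gs \<subseteq> (A \<union> B) - C \<and> successively (different_factors A B) gs \<and>
     g = c \<otimes>\<^bsub>G\<^esub> foldr (mult G) gs \<one>\<^bsub>G\<^esub>"

definition form_length :: "('a, 'm) monoid_scheme \<Rightarrow> 'a set \<Rightarrow> 'a set \<Rightarrow> 'a set \<Rightarrow> 'a \<Rightarrow> nat" where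
  "form_length G A B C g = (THE n. \<exists>c gs. reduced_form G A B C c gs g \<and> n = length gs)"

definition cyclically_reduced ::
    "('a, 'm) monoid_scheme \<Rightarrow> 'a set \<Rightarrow> 'a set \<Rightarrow> 'a set \<Rightarrow> 'a \<Rightarrow> bool" where
  "cyclically_reduced G A B C g \<longleftrightarrow>
    (\<exists>c gs. reduced_form G A B C c gs g \<and>
      (length gs = 0 \<or>
       length gs = 1 \<and> (\<forall>h\<in>C. \<not> conjugate G g h) \<or>
       length gs \<ge> 2 \<and> different_factors A B (hd gs) (last gs)))"

definition CR_gt1 :: "('a, 'm) monoid_scheme \<Rightarrow> 'a set \<Rightarrow> 'a set \<Rightarrow> 'a set \<Rightarrow> 'a set" where
  "CR_gt1 G A B C =
    {u \<in> carrier G. \<exists>g. conjugate G u g \<and> cyclically_reduced G A B C g \<and> regular G C g \<and>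
                        form_length G A B C g > 1}"


section \<open>The algorithmic problems\<close>

definition word_problem :: "presentation \<Rightarrow> bool" where
  "word_problem P \<longleftrightarrow> decidable (words P) (\<lambda>w b::bool. b \<longleftrightarrow> wval P w = \<one>\<^bsub>grp P\<^esub>)"

text \<open>The subgroup generated by a tuple of words.\<close>

definition subgrp :: "presentation \<Rightarrow> word list \<Rightarrow> word set set" where
  "subgrp P zs = generate (grp P) (wval P ` set zs)"

text \<open>A product of the given generators is a word \<open>v\<close> in their indices; \<open>subst_word zs v\<close> expands it.\<close>

definition subst_word :: "word list \<Rightarrow> word \<Rightarrow> word" where
  "subst_word zs v = concat (map (\<lambda>(i, b). if b then zs ! i else inv_word (zs ! i)) v)"

definition membership_search_problem :: "presentation \<Rightarrow> word list \<Rightarrow> bool" where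
  "membership_search_problem P zs \<longleftrightarrow>
    decidable (words P) (\<lambda>w ans. case ans of
       None \<Rightarrow> wval P w \<notin> subgrp P zs
     | Some v \<Rightarrow> v \<in> words_over {..<length zs} \<and> wval P (subst_word zs v) = wval P w)"

definition coset_representative_search_problem :: "presentation \<Rightarrow> word list \<Rightarrow> bool" where
  "coset_representative_search_problem P zs \<longleftrightarrow>
    (\<exists>S\<subseteq>words P.
      (\<forall>w\<in>words P. \<exists>!s. s \<in> S \<and> wval P s \<in> subgrp P zs #>\<^bsub>grp P\<^esub> wval P w) \<and>
      decidable (words P) (\<lambda>w b::bool. b \<longleftrightarrow> w \<in> S) \<and>
      decidable (words P) (\<lambda>w s. s \<in> S \<and> wval P s \<in> subgrp P zs #>\<^bsub>grp P\<^esub> wval P w))"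

text \<open>
  The conjugacy search problem, to be solved on the pairs of words in \<open>\<Phi>\<close>. The answer \<^term>\<open>None\<close>
  means ``not conjugate''.
\<close>

definition conjugacy_search_problem_on :: "(word \<times> word) set \<Rightarrow> presentation \<Rightarrow> bool" where
  "conjugacy_search_problem_on \<Phi> P \<longleftrightarrow>
    decidable_on \<Phi> (words P \<times> words P) (\<lambda>(u, v) ans. case ans of
       None \<Rightarrow> \<not> conjugate (grp P) (wval P u) (wval P v)
     | Some g \<Rightarrow> g \<in> words P \<and> conj_by (grp P) (wval P u) (wval P g) = wval P v)"


section \<open>Amalgamated products and the cardinality search problem\<close>

text \<open>
  The generator sets of \<open>A\<close> and \<open>B\<close> are meant to be disjoint, so that a word of \<open>A\<close> or \<open>B\<close> is also
  a word of the amalgamated product. The relation \<open>a = b\<close> is given by the relator \<open>a b\<^sup>-\<^sup>1\<close>.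
\<close>

definition amalgam :: "presentation \<Rightarrow> presentation \<Rightarrow> word list \<Rightarrow> word list \<Rightarrow> presentation" where
  "amalgam A B zA zB =
    \<lparr>gens = gens A \<union> gens B,
     rels = rels A \<union> rels B \<union> {a @ inv_word b | a b. (a, b) \<in> set (zip zA zB)}\<rparr>"

text \<open>The image of \<open>H\<close> in the group presented by \<open>G\<close>, when \<open>gens H \<subseteq> gens G\<close>.\<close>

definition factor_in :: "presentation \<Rightarrow> presentation \<Rightarrow> word set set" where
  "factor_in G H = wval G ` words H"

definition Sub :: "('a, 'm) monoid_scheme \<Rightarrow> 'a set \<Rightarrow> 'a set set" where
  "Sub G C = {K. subgroup K G \<and> K \<subseteq> C}"

inductive_set Phi :: "('a, 'm) monoid_scheme \<Rightarrow> 'a set set \<Rightarrow> 'a set \<Rightarrow> 'a set set"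
  for G M H where
  base: "K \<in> M \<Longrightarrow> K \<in> Phi G M H"
| shift: "D \<in> Phi G M H \<Longrightarrow> u \<in> H \<Longrightarrow> v \<in> H \<Longrightarrow> (u <#\<^bsub>G\<^esub> D) #>\<^bsub>G\<^esub> v \<in> Phi G M H"
| inter: "D \<in> Phi G M H \<Longrightarrow> E \<in> Phi G M H \<Longrightarrow> D \<inter> E \<in> Phi G M H"

datatype factor = FactorA | FactorB

text \<open>
  Effective descriptions of sets. The leaves describe subgroups of \<open>C\<close>: \<open>Gen ws\<close> is the subgroup
  generated by the tuple \<open>ws\<close> of words of the factor in which the expression lives, and \<open>Transl F D h\<close> is \<open>D h\<^sup>-\<^sup>1\<close>, where \<open>D\<close> is an expression over the
  factor \<open>F\<close>, which may be either factor regardless of the one in which the surrounding expression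
  lives.
\<close>

datatype set_expr =
    Gen "word list"
  | Transl factor set_expr word
  | Shift word set_expr word
  | Inter set_expr set_expr

instantiation factor :: encodable
begin
definition encode_factor :: "factor \<Rightarrow> nat"
  where "encode_factor F = (case F of FactorA \<Rightarrow> 0 | FactorB \<Rightarrow> 1)"
instance by standard (auto simp: inj_def encode_factor_def split: factor.splits)
end

instantiation set_expr :: encodable
begin
primrec encode_set_expr :: "set_expr \<Rightarrow> nat" where
  "encode_set_expr (Gen ws) = prod_encode (0, encode ws)"
| "encode_set_expr (Transl F D h) =
     prod_encode (1, prod_encode (encode F, prod_encode (encode_set_expr D, encode h)))"
| "encode_set_expr (Shift u D v) =
     prod_encode (2, prod_encode (encode u, prod_encode (encode_set_expr D, encode v)))"
| "encode_set_expr (Inter D E) =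
     prod_encode (3, prod_encode (encode_set_expr D, encode_set_expr E))"
instance
proof standard
  have "encode D = encode E \<Longrightarrow> D = E" for D E :: set_expr
  proof (induction D arbitrary: E)
    case (Gen ws) then show ?case by (cases E) auto
  next
    case (Transl F D h) then show ?case by (cases E) auto
  next
    case (Shift u D v) then show ?case by (cases E) auto
  next
    case (Inter D1 D2) then show ?case by (cases E) auto
  qed
  then show "inj (encode :: set_expr \<Rightarrow> nat)" by (auto simp: inj_def)
qed
end

text \<open>
  The sets are evaluated in the group presented by \<open>G\<close>, in which both factors are contained.
\<close>

primrec set_val :: "presentation \<Rightarrow> set_expr \<Rightarrow> word set set" where
  "set_val G (Gen ws) = generate (grp G) (wval G ` set ws)"
| "set_val G (Transl F D h) = set_val G D #>\<^bsub>grp G\<^esub> inv\<^bsub>grp G\<^esub> wval G h"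
| "set_val G (Shift u D v) = (wval G u <#\<^bsub>grp G\<^esub> set_val G D) #>\<^bsub>grp G\<^esub> wval G v"
| "set_val G (Inter D E) = set_val G D \<inter> set_val G E"

primrec factor_pres :: "presentation \<Rightarrow> presentation \<Rightarrow> factor \<Rightarrow> presentation" where
  "factor_pres A B FactorA = A"
| "factor_pres A B FactorB = B"

text \<open>
  \<open>describes A B G C F E\<close>: the expression \<open>E\<close> correctly describes a set in \<open>\<Phi>(Sub(C), F)\<close>, where
  \<open>C\<close> is a subgroup of the group presented by \<open>G\<close>.
\<close>

primrec describes ::
    "presentation \<Rightarrow> presentation \<Rightarrow> presentation \<Rightarrow> word set set \<Rightarrow> factor \<Rightarrow> set_expr \<Rightarrow> bool" where
  "describes A B G C F (Gen ws) \<longleftrightarrow>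
     set ws \<subseteq> words (factor_pres A B F) \<and> wval G ` set ws \<subseteq> C"
| "describes A B G C F (Transl F' D h) \<longleftrightarrow>
     describes A B G C F' D \<and> set_val G D \<subseteq> C \<and>
     h \<in> words (factor_pres A B F') \<and> wval G h \<in> set_val G D"
| "describes A B G C F (Shift u D v) \<longleftrightarrow>
     describes A B G C F D \<and> u \<in> words (factor_pres A B F) \<and> v \<in> words (factor_pres A B F)"
| "describes A B G C F (Inter D E) \<longleftrightarrow> describes A B G C F D \<and> describes A B G C F E"

text \<open>
  The answer \<^term>\<open>None\<close> means ``infinite'', and \<^term>\<open>Some ws\<close> lists all elements of the set; the
  empty list is the answer ``empty''.
\<close>

definition cardinality_search_problem ::
    "presentation \<Rightarrow> presentation \<Rightarrow> word list \<Rightarrow> word list \<Rightarrow> factor \<Rightarrow> bool" where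
  "cardinality_search_problem A B zA zB F \<longleftrightarrow>
    (let G = amalgam A B zA zB in
     decidable {D. describes A B G (subgrp G zA) F D} (\<lambda>D ans. case ans of
        None \<Rightarrow> infinite (set_val G D)
      | Some ws \<Rightarrow> set ws \<subseteq> words (factor_pres A B F) \<and> wval G ` set ws = set_val G D))"


subsection \<open>Expressions denote sets in the collection\<close>

lemma Phi_heap:
  assumes "group G" "D \<in> Phi G (Sub G C) H" "H \<subseteq> carrier G"
  shows "D \<subseteq> carrier G \<and> (\<forall>x\<in>D. \<forall>y\<in>D. \<forall>z\<in>D. x \<otimes>\<^bsub>G\<^esub> inv\<^bsub>G\<^esub> y \<otimes>\<^bsub>G\<^esub> z \<in> D)"
  using assms(2)
proof (induction rule: Phi.induct)
  case (base K)
  then have "subgroup K G" by (simp add: Sub_def)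
  then show ?case
    by (meson subgroup.m_closed subgroup.m_inv_closed subgroup.subset)
next
  case (shift D u v)
  interpret group G by fact
  have u: "u \<in> carrier G" and v: "v \<in> carrier G" using shift assms(3) by auto
  have D: "D \<subseteq> carrier G" using shift by simp
  have eq: "(u <#\<^bsub>G\<^esub> D) #>\<^bsub>G\<^esub> v = (\<lambda>x. u \<otimes>\<^bsub>G\<^esub> x \<otimes>\<^bsub>G\<^esub> v) ` D"
    by (auto simp: l_coset_def r_coset_def)
  have heap: "(u \<otimes>\<^bsub>G\<^esub> x \<otimes>\<^bsub>G\<^esub> v) \<otimes>\<^bsub>G\<^esub> inv\<^bsub>G\<^esub> (u \<otimes>\<^bsub>G\<^esub> y \<otimes>\<^bsub>G\<^esub> v) \<otimes>\<^bsub>G\<^esub> (u \<otimes>\<^bsub>G\<^esub> z \<otimes>\<^bsub>G\<^esub> v)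
        = u \<otimes>\<^bsub>G\<^esub> (x \<otimes>\<^bsub>G\<^esub> inv\<^bsub>G\<^esub> y \<otimes>\<^bsub>G\<^esub> z) \<otimes>\<^bsub>G\<^esub> v"
    if "x \<in> carrier G" "y \<in> carrier G" "z \<in> carrier G" for x y z
  proof -
    have c: "a \<otimes>\<^bsub>G\<^esub> (inv\<^bsub>G\<^esub> a \<otimes>\<^bsub>G\<^esub> b) = b" "inv\<^bsub>G\<^esub> a \<otimes>\<^bsub>G\<^esub> (a \<otimes>\<^bsub>G\<^esub> b) = b"
      if "a \<in> carrier G" "b \<in> carrier G" for a b
      using that by (simp_all add: m_assoc[symmetric])
    show ?thesis using that u v by (simp add: m_assoc inv_mult_group c)
  qed
  have "x' \<otimes>\<^bsub>G\<^esub> inv\<^bsub>G\<^esub> y' \<otimes>\<^bsub>G\<^esub> z' \<in> (\<lambda>x. u \<otimes>\<^bsub>G\<^esub> x \<otimes>\<^bsub>G\<^esub> v) ` D"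
    if "x' \<in> (\<lambda>x. u \<otimes>\<^bsub>G\<^esub> x \<otimes>\<^bsub>G\<^esub> v) ` D" "y' \<in> (\<lambda>x. u \<otimes>\<^bsub>G\<^esub> x \<otimes>\<^bsub>G\<^esub> v) ` D"
      "z' \<in> (\<lambda>x. u \<otimes>\<^bsub>G\<^esub> x \<otimes>\<^bsub>G\<^esub> v) ` D" for x' y' z'
  proof -
    from that obtain x y z where xyz: "x \<in> D" "y \<in> D" "z \<in> D"
      "x' = u \<otimes>\<^bsub>G\<^esub> x \<otimes>\<^bsub>G\<^esub> v" "y' = u \<otimes>\<^bsub>G\<^esub> y \<otimes>\<^bsub>G\<^esub> v" "z' = u \<otimes>\<^bsub>G\<^esub> z \<otimes>\<^bsub>G\<^esub> v"
      by blast
    moreover from xyz shift have "x \<otimes>\<^bsub>G\<^esub> inv\<^bsub>G\<^esub> y \<otimes>\<^bsub>G\<^esub> z \<in> D" by blast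
    moreover have "x' \<otimes>\<^bsub>G\<^esub> inv\<^bsub>G\<^esub> y' \<otimes>\<^bsub>G\<^esub> z' = u \<otimes>\<^bsub>G\<^esub> (x \<otimes>\<^bsub>G\<^esub> inv\<^bsub>G\<^esub> y \<otimes>\<^bsub>G\<^esub> z) \<otimes>\<^bsub>G\<^esub> v"
      unfolding xyz(4-6) using xyz(1-3) D by (intro heap) auto
    ultimately show ?thesis by (metis imageI)
  qed
  moreover have "(\<lambda>x. u \<otimes>\<^bsub>G\<^esub> x \<otimes>\<^bsub>G\<^esub> v) ` D \<subseteq> carrier G" using D u v by auto
  ultimately show ?case unfolding eq by blast
qed auto

lemma describes_in_Phi:
  assumes C: "subgroup C (grp G)"
    and sub: "gens A \<subseteq> gens G" "gens B \<subseteq> gens G"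
    and "describes A B G C F E"
  shows "set_val G E \<in> Phi (grp G) (Sub (grp G) C) (factor_in G (factor_pres A B F))"
  using assms(4)
proof (induction E arbitrary: F)
  interpret group "grp G" by (rule group_grp)
  have fac: "factor_in G (factor_pres A B F) \<subseteq> carrier (grp G)" for F
  proof -
    have "words (factor_pres A B F) \<subseteq> words G"
      using sub by (cases F) (simp_all add: words_over_def Collect_mono subset_trans)
    then show ?thesis by (simp add: factor_in_def carrier_grp image_mono)
  qed
  {
    case (Gen ws)
    then have "subgroup (generate (grp G) (wval G ` set ws)) (grp G)"
      using subgroup.subset[OF C] by (intro generate_is_subgroup) auto
    moreover have "generate (grp G) (wval G ` set ws) \<subseteq> C"
      using Gen C by (intro generate_subgroup_incl) auto
    ultimately show ?case by (auto simp: Sub_def intro: Phi.base)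
  next
    case (Transl F' D h)
    define S where "S = set_val G D"
    define k where "k = wval G h"
    have S: "S \<in> Phi (grp G) (Sub (grp G) C) (factor_in G (factor_pres A B F'))"
      and SC: "S \<subseteq> C" and kS: "k \<in> S"
      using Transl by (auto simp: S_def k_def)
    have heap: "S \<subseteq> carrier (grp G)"
      "\<And>x y z. x \<in> S \<Longrightarrow> y \<in> S \<Longrightarrow> z \<in> S \<Longrightarrow> x \<otimes>\<^bsub>grp G\<^esub> inv\<^bsub>grp G\<^esub> y \<otimes>\<^bsub>grp G\<^esub> z \<in> S"
      using Phi_heap[OF group_grp S fac] by auto
    let ?K = "S #>\<^bsub>grp G\<^esub> inv\<^bsub>grp G\<^esub> k"
    have kc: "k \<in> carrier (grp G)" using kS heap by auto
    have KI: "x \<otimes>\<^bsub>grp G\<^esub> inv\<^bsub>grp G\<^esub> k \<in> ?K" if "x \<in> S" for x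
      using that by (auto simp: r_coset_def)
    have "subgroup ?K (grp G)"
    proof (rule subgroupI)
      show "?K \<subseteq> carrier (grp G)" using heap kc by (auto simp: r_coset_def)
      show "?K \<noteq> {}" using kS by (auto simp: r_coset_def)
    next
      fix a assume "a \<in> ?K"
      then obtain x where x: "x \<in> S" "a = x \<otimes>\<^bsub>grp G\<^esub> inv\<^bsub>grp G\<^esub> k" by (auto simp: r_coset_def)
      have "inv\<^bsub>grp G\<^esub> a = (k \<otimes>\<^bsub>grp G\<^esub> inv\<^bsub>grp G\<^esub> x \<otimes>\<^bsub>grp G\<^esub> k) \<otimes>\<^bsub>grp G\<^esub> inv\<^bsub>grp G\<^esub> k"
        using x kc heap(1) by (auto simp: subset_iff inv_mult_group m_assoc)
      then show "inv\<^bsub>grp G\<^esub> a \<in> ?K" using KI heap(2)[OF kS x(1) kS] by simp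
      fix b assume "b \<in> ?K"
      then obtain y where y: "y \<in> S" "b = y \<otimes>\<^bsub>grp G\<^esub> inv\<^bsub>grp G\<^esub> k" by (auto simp: r_coset_def)
      have "a \<otimes>\<^bsub>grp G\<^esub> b = (x \<otimes>\<^bsub>grp G\<^esub> inv\<^bsub>grp G\<^esub> k \<otimes>\<^bsub>grp G\<^esub> y) \<otimes>\<^bsub>grp G\<^esub> inv\<^bsub>grp G\<^esub> k"
        using x y kc heap(1) by (auto simp: subset_iff m_assoc)
      then show "a \<otimes>\<^bsub>grp G\<^esub> b \<in> ?K" using KI heap(2)[OF x(1) kS y(1)] by simp
    qed
    moreover have "?K \<subseteq> C"
      using SC kS C by (auto simp: r_coset_def intro!: subgroup.m_closed subgroup.m_inv_closed)
    ultimately show ?case by (auto simp: Sub_def S_def k_def intro: Phi.base)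
  next
    case (Shift u D v)
    then show ?case by (auto simp: factor_in_def intro!: Phi.shift)
  next
    case (Inter D E)
    then show ?case by (auto intro: Phi.inter)
  }
qed

end

theory Submission
  imports Defs
begin

text \<open>
  Equality in a finitely presented group is semidecidable, so a conjugator can always be found by
  search if there is one, and it suffices to have certificates of non-conjugacy that are sound for all
  pairs and exist for all non-conjugate pairs \<open>(u, v)\<close> in question; the two searches are dovetailed.

  The element \<open>u\<close> is conjugate to a cyclically reduced regular \<open>g = g\<^sub>1 \<cdots> g\<^sub>n\<close> with \<open>n \<ge> 2\<close>, and \<open>v\<close> either
  to an element of a factor, and then it is not conjugate to \<open>g\<close>, or to a cyclically reduced
  \<open>v\<^sub>1 \<cdots> v\<^sub>m\<close> with \<open>m \<ge> 2\<close>. In the second case \<open>u\<close> and \<open>v\<close> are conjugate iff \<open>c\<^sup>-\<^sup>1 g c = w\<close> for some \<open>c \<in> C\<close>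
  and some cyclic rotation \<open>w = w\<^sub>1 \<cdots> w\<^sub>n\<close> of \<open>v\<^sub>1 \<cdots> v\<^sub>m\<close> whose letters lie in the same factors as those
  of \<open>g\<close>. Then the successive elements \<open>c\<^sub>0 = c\<close>, \<open>c\<^sub>i = g\<^sub>i\<^sup>-\<^sup>1 c\<^sub>i\<^sub>-\<^sub>1 w\<^sub>i\<close> all lie in \<open>C\<close>, so that \<open>c\<^sub>i\<close> belongs to
  \<open>E\<^sub>i\<close>, where \<open>E\<^sub>0 = C\<close> and \<open>E\<^sub>i = g\<^sub>i\<^sup>-\<^sup>1 E\<^sub>i\<^sub>-\<^sub>1 w\<^sub>i \<inter> C\<close>, and \<open>c = c\<^sub>n \<in> E\<^sub>n\<close>. Each \<open>E\<^sub>i\<close> has an effective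
  description as long as its predecessors are non-empty, and \<open>E\<^sub>n\<close> has at most one element because
  \<open>C \<inter> C\<^sup>g = 1\<close> by regularity. Hence \<open>w\<close> is excluded either by the answer that some \<open>E\<^sub>i\<close> is empty, or
  by the list of the elements of \<open>E\<^sub>n\<close>, none of which conjugates \<open>g\<close> to \<open>w\<close>. Only \<open>v\<close> is rotated, since a
  rotation of \<open>g\<close> need not be regular.
\<close>

section \<open>Recursive functions\<close>

text \<open>An explicit algorithm would have to be assembled from the combinators of
  \<open>partrec\<close>. Instead, each oracle is replaced by its graph, a semidecidable relation; a
  certificate is a formula built from such relations with conjunction, disjunction, existential and
  bounded universal quantifiers, and a generic search turns it back into a \<open>partrec\<close>
  function. Since only positive facts can be certified, a negative one about group elements needs a
  positive witness: that a word lies outside C, or that two elements differ, is expressed by an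
  empty answer of the cardinality search. That A and B embed in G and that the length of a reduced
  form is unique has to be proved for groups given by words. This is van der Waerden's method, an
  action on normal forms; the later argument keeps of it only one invariant, the sequence of factors
  of a reduced form. Certificates do not record regularity, so they must be sound without it.
  Regularity bears on their existence alone: it makes the last set of the chain finite, so that the
  search lists its elements instead of answering "infinite".\<close>

definition recf :: "(nat \<Rightarrow> nat) \<Rightarrow> bool" where
  "recf f \<longleftrightarrow> partrec (\<lambda>n. Some (f n))"

abbreviation pr1 :: "nat \<Rightarrow> nat" where "pr1 n \<equiv> fst (prod_decode n)"
abbreviation pr2 :: "nat \<Rightarrow> nat" where "pr2 n \<equiv> snd (prod_decode n)"

lemma recf_comp: "recf f \<Longrightarrow> recf g \<Longrightarrow> recf (\<lambda>n. f (g n))"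
  unfolding recf_def by (drule (1) partrec.comp) simp

lemma recf_pair: "recf f \<Longrightarrow> recf g \<Longrightarrow> recf (\<lambda>n. prod_encode (f n, g n))"
  unfolding recf_def by (drule (1) partrec.pair) simp

lemma recf_pr1: "recf f \<Longrightarrow> recf (\<lambda>n. pr1 (f n))"
  by (rule recf_comp[of pr1]) (auto simp: recf_def intro: partrec.intros)

lemma recf_pr2: "recf f \<Longrightarrow> recf (\<lambda>n. pr2 (f n))"
  by (rule recf_comp[of pr2]) (auto simp: recf_def intro: partrec.intros)

lemma recf_Suc: "recf f \<Longrightarrow> recf (\<lambda>n. Suc (f n))"
  by (rule recf_comp[of Suc]) (auto simp: recf_def intro: partrec.intros)

text \<open>The identity is not a generator of \<open>partrec\<close>; it is the pair of the two
  projections.\<close>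

lemma recf_id: "recf (\<lambda>n. n)"
proof -
  have "recf (\<lambda>n. prod_encode (pr1 n, pr2 n))"
    using partrec.pair[OF partrec.left partrec.right] by (simp add: recf_def)
  then show ?thesis by simp
qed

lemma recf_const: "recf (\<lambda>n. k)"
proof (induction k)
  case 0
  then show ?case by (simp add: recf_def partrec.zero)
next
  case (Suc k)
  then show ?case by (rule recf_Suc)
qed

text \<open>The argument \<open>n\<close> is the parameter and also determines the recursion depth,
  so \<open>prec\<close> is applied to the pair \<open>(n, k n)\<close>.\<close>

lemma recf_rec_nat:
  assumes "recf f" "recf k" "recf (\<lambda>p. g (pr1 p) (pr1 (pr2 p)) (pr2 (pr2 p)))"
  shows "recf (\<lambda>n. rec_nat (f n) (g n) (k n))"
proof -
  let ?g = "\<lambda>p. g (pr1 p) (pr1 (pr2 p)) (pr2 (pr2 p))"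
  have *: "rec_nat (Some (f a)) (\<lambda>i r. Option.bind r (\<lambda>y. Some (?g (prod_encode (a, prod_encode (i, y)))))) m
      = Some (rec_nat (f a) (g a) m)" for a m
    by (induction m) auto
  have "partrec (\<lambda>n. Some (f n))" "partrec (\<lambda>n. Some (?g n))" using assms by (auto simp: recf_def)
  from partrec.prec[OF this]
  have "recf (\<lambda>n. rec_nat (f (pr1 n)) (g (pr1 n)) (pr2 n))"
    unfolding * recf_def by (simp add: case_prod_beta)
  from recf_comp[OF this recf_pair[OF recf_id assms(2)]] show ?thesis by simp
qed

lemma recf_comp2:
  assumes "recf (\<lambda>p. f (pr1 p) (pr2 p))" "recf g" "recf h"
  shows "recf (\<lambda>n. f (g n) (h n))"
  using recf_comp[OF assms(1) recf_pair[OF assms(2,3)]] by simp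

text \<open>Primitive recursion with a step that ignores its arguments distinguishes zero from
  non-zero.\<close>

lemma recf_if0:
  assumes "recf c" "recf f" "recf g"
  shows "recf (\<lambda>n. if c n = 0 then f n else g n)"
proof -
  have "recf (\<lambda>n. rec_nat (f n) (\<lambda>i r. g n) (c n))"
    by (intro recf_rec_nat recf_comp[OF assms(3)] recf_pr1 recf_id assms)
  moreover have "rec_nat (f n) (\<lambda>i r. g n) (c n) = (if c n = 0 then f n else g n)" for n
    by (cases "c n") auto
  ultimately show ?thesis by simp
qed

lemma recf_pred: assumes "recf f" shows "recf (\<lambda>n. f n - Suc 0)"
proof -
  have "recf (\<lambda>n. rec_nat 0 (\<lambda>i r. i) (f n))"
    by (intro recf_rec_nat recf_const recf_pr1 recf_pr2 recf_id assms)
  moreover have "rec_nat 0 (\<lambda>i r. i) m = m - Suc 0" for m by (cases m) auto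
  ultimately show ?thesis by simp
qed

lemmas recf_intros = recf_const recf_id recf_pair recf_pr1 recf_pr2 recf_Suc recf_pred recf_if0

lemma recf_minus: assumes "recf f" "recf g" shows "recf (\<lambda>n. f n - g n)"
proof -
  have "recf (\<lambda>n. rec_nat (f n) (\<lambda>i r. r - Suc 0) (g n))"
    by (intro recf_rec_nat recf_intros assms)
  moreover have "rec_nat a (\<lambda>i r. r - Suc 0) m = a - m" for a m by (induction m) auto
  ultimately show ?thesis by simp
qed

lemma recf_if:
  assumes "recf a" "recf b" "recf f" "recf g"
  shows "recf (\<lambda>n. if a n = b n then f n else g n)"
proof -
  have "recf (\<lambda>n. if a n - b n = 0 then (if b n - a n = 0 then f n else g n) else g n)"
    by (intro recf_if0 recf_minus assms)
  moreover have "(if a n - b n = 0 then (if b n - a n = 0 then f n else g n) else g n) =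
      (if a n = b n then f n else g n)" for n
    by auto
  ultimately show ?thesis by simp
qed

text \<open>Truth is coded by 0 here and below, because \<open>minim\<close> searches for
  zeros.\<close>

lemma recf_bounded_ex:
  assumes "recf (\<lambda>p. f (pr1 p) (pr2 p))" "recf b"
  shows "recf (\<lambda>n. if \<exists>t<b n. f n t = 0 then 0 else Suc 0)"
proof -
  have "recf (\<lambda>n. rec_nat (Suc 0) (\<lambda>i r. if f n i = 0 then 0 else r) (b n))"
    by (intro recf_rec_nat recf_if0 recf_comp2[OF assms(1)] recf_intros assms(2))
  moreover have "rec_nat (Suc 0) (\<lambda>i r. if f n i = 0 then 0 else r) m =
      (if \<exists>t<m. f n t = 0 then 0 else Suc 0)" for n m
    by (induction m) (auto simp: less_Suc_eq)
  ultimately show ?thesis by simp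
qed

lemma recf_bounded_all:
  assumes "recf (\<lambda>p. f (pr1 p) (pr2 p))" "recf b"
  shows "recf (\<lambda>n. if \<forall>t<b n. f n t = 0 then 0 else Suc 0)"
proof -
  have "recf (\<lambda>n. rec_nat 0 (\<lambda>i r. if f n i = 0 then r else Suc 0) (b n))"
    by (intro recf_rec_nat recf_if0 recf_comp2[OF assms(1)] recf_intros assms(2))
  moreover have "rec_nat 0 (\<lambda>i r. if f n i = 0 then r else Suc 0) m =
      (if \<forall>t<m. f n t = 0 then 0 else Suc 0)" for n m
    by (induction m) (auto simp: less_Suc_eq)
  ultimately show ?thesis by simp
qed

lemma length_le_list_encode: "length xs \<le> list_encode xs"
  by (induction xs) (auto intro: le_trans[OF _ le_prod_encode_2])

lemma recf_foldl:
  assumes "recf f" "recf k" "recf (\<lambda>p. g (pr1 p) (pr1 (pr2 p)) (pr2 (pr2 p)))"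
  shows "recf (\<lambda>n. foldl (g n) (f n) (list_decode (k n)))"
proof -
  \<comment> \<open>The state is a pair of the code of the remaining list and the accumulator. A
    non-empty list has code \<open>Suc (prod_encode (x, code of the rest))\<close>, so the
    predecessor exposes head and tail. Running \<open>k n\<close> steps is enough, since the length
    of a list is at most its code, and surplus steps are idle.\<close>
  define step where "step n s = (if pr1 s = 0 then s
    else prod_encode (pr2 (pr1 s - Suc 0), g n (pr2 s) (pr1 (pr1 s - Suc 0))))" for n s
  have fix0: "rec_nat (prod_encode (0, a)) (\<lambda>i. step n) m = prod_encode (0, a)" for n m a
    by (induction m) (auto simp: step_def)
  have shift: "rec_nat s (\<lambda>i. step n) (Suc m) = rec_nat (step n s) (\<lambda>i. step n) m" for n m s
    by (induction m) auto
  have it: "rec_nat (prod_encode (list_encode xs, a)) (\<lambda>i. step n) m =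
      prod_encode (0, foldl (g n) a xs)" if "length xs \<le> m" for n m xs a
    using that
  proof (induction xs arbitrary: m a)
    case (Cons x xs)
    then obtain m' where m: "m = Suc m'" "length xs \<le> m'" by (cases m) auto
    have "step n (prod_encode (list_encode (x # xs), a)) = prod_encode (list_encode xs, g n a x)"
      by (simp add: step_def)
    then show ?case unfolding m(1) shift using Cons.IH[OF m(2)] by simp
  qed (simp add: fix0)
  have 3: "recf (\<lambda>n. g (h1 n) (h2 n) (h3 n))" if "recf h1" "recf h2" "recf h3" for h1 h2 h3
    using recf_comp[OF assms(3) recf_pair[OF that(1) recf_pair[OF that(2,3)]]] by simp
  have "recf (\<lambda>n. pr2 (rec_nat (prod_encode (k n, f n)) (\<lambda>i. step n) (k n)))"
    unfolding step_def
    by (intro recf_pr2 recf_rec_nat recf_pair assms(1,2) recf_intros 3 recf_intros)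
  moreover have "pr2 (rec_nat (prod_encode (k n, f n)) (\<lambda>i. step n) (k n)) =
      foldl (g n) (f n) (list_decode (k n))" for n
    using it[of "list_decode (k n)" "k n" "f n" n] length_le_list_encode[of "list_decode (k n)"]
    by simp
  ultimately show ?thesis by simp
qed

text \<open>
  A stage function computes \<open>f\<close> with a bound \<open>t\<close> on all unbounded searches; its value is \<open>0\<close> if the
  bound does not suffice and \<open>Suc y\<close> if the result is \<open>y\<close>.
\<close>

definition stages :: "(nat \<Rightarrow> nat option) \<Rightarrow> (nat \<Rightarrow> nat \<Rightarrow> nat) \<Rightarrow> bool" where
  "stages f F \<longleftrightarrow> recf (\<lambda>p. F (pr1 p) (pr2 p)) \<and>
     (\<forall>n y. f n = Some y \<longleftrightarrow> (\<exists>t. F n t = Suc y)) \<and>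
     (\<forall>n t t' y. F n t = Suc y \<longrightarrow> t \<le> t' \<longrightarrow> F n t' = Suc y)"

lemma stagesI:
  assumes "recf (\<lambda>p. F (pr1 p) (pr2 p))"
    "\<And>n y t. F n t = Suc y \<Longrightarrow> f n = Some y"
    "\<And>n y. f n = Some y \<Longrightarrow> \<exists>t0. \<forall>t\<ge>t0. F n t = Suc y"
    "\<And>n t t' y. F n t = Suc y \<Longrightarrow> t \<le> t' \<Longrightarrow> F n t' = Suc y"
  shows "stages f F"
  using assms unfolding stages_def by blast

lemma stagesD:
  assumes "stages f F"
  shows "recf a \<Longrightarrow> recf b \<Longrightarrow> recf (\<lambda>n. F (a n) (b n))"
    "F n t = Suc y \<Longrightarrow> f n = Some y"
    "f n = Some y \<Longrightarrow> \<exists>t0. \<forall>t\<ge>t0. F n t = Suc y"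
    "F n t = Suc y \<Longrightarrow> t \<le> t' \<Longrightarrow> F n t' = Suc y"
  using assms unfolding stages_def by (blast intro: recf_comp2[of F])+

lemma stages_total: assumes "recf f" shows "stages (\<lambda>n. Some (f n)) (\<lambda>n t. Suc (f n))"
  by (rule stagesI) (auto intro!: recf_Suc recf_comp[OF assms] recf_intros)

text \<open>Both computations get the same bound; by monotonicity the larger of two sufficient
  bounds serves both. The pair \<open>(n, a)\<close> hands the original argument on, which is what
  pairing two functions requires.\<close>

lemma stages_bind:
  assumes F: "stages f F" and G: "stages g G"
  shows "stages (\<lambda>n. Option.bind (f n) (\<lambda>a. g (prod_encode (n, a))))
    (\<lambda>n t. if F n t = 0 then 0 else G (prod_encode (n, F n t - Suc 0)) t)" (is "stages ?f ?P")
proof (rule stagesI)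
  show "recf (\<lambda>p. ?P (pr1 p) (pr2 p))"
    by (intro recf_intros stagesD(1)[OF F] stagesD(1)[OF G])
next
  fix n y t assume "?P n t = Suc y"
  then obtain a where "F n t = Suc a" "G (prod_encode (n, a)) t = Suc y"
    by (auto split: if_splits simp: gr0_conv_Suc)
  then show "?f n = Some y"
    using stagesD(2)[OF F] stagesD(2)[OF G] by simp
next
  fix n y assume "?f n = Some y"
  then obtain a where a: "f n = Some a" "g (prod_encode (n, a)) = Some y"
    by (auto simp: Option.bind_eq_Some_conv)
  obtain t0 t1 where "\<forall>t\<ge>t0. F n t = Suc a" "\<forall>t\<ge>t1. G (prod_encode (n, a)) t = Suc y"
    using stagesD(3)[OF F a(1)] stagesD(3)[OF G a(2)] by blast
  then have "\<forall>t\<ge>max t0 t1. ?P n t = Suc y" by simp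
  then show "\<exists>t0. \<forall>t\<ge>t0. ?P n t = Suc y" by blast
next
  fix n t t' y assume P: "?P n t = Suc y" and t: "t \<le> t'"
  obtain a where "F n t = Suc a" "G (prod_encode (n, a)) t = Suc y"
    using P by (auto split: if_splits simp: gr0_conv_Suc)
  then show "?P n t' = Suc y" using stagesD(4)[OF F _ t] stagesD(4)[OF G _ t] by simp
qed

text \<open>A weak form of Kleene's normal form theorem: having the value \<open>y\<close> becomes
  the existence of a stage \<open>t\<close> with a recursive property, which makes graphs of partial
  recursive functions semidecidable.\<close>

lemma ex_stages: "partrec f \<Longrightarrow> \<exists>F. stages f F"
proof (induction rule: partrec.induct)
  case zero
  show ?case using stages_total[OF recf_const] by blast
next
  case succ
  show ?case using stages_total[OF recf_Suc[OF recf_id]] by blast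
next
  case left
  show ?case using stages_total[OF recf_pr1[OF recf_id]] by blast
next
  case right
  show ?case using stages_total[OF recf_pr2[OF recf_id]] by blast
next
  case (pair f g)
  then obtain F G where F: "stages f F" and G: "stages g G" by blast
  have "stages (\<lambda>p. g (pr1 p)) (\<lambda>p. G (pr1 p))"
    using G by (intro stagesI) (auto intro!: stagesD(1)[OF G] recf_intros dest: stagesD(2-4)[OF G])
  moreover have "recf (\<lambda>q. prod_encode (pr2 (pr1 q), pr2 q))" by (intro recf_intros)
  ultimately show ?case using stages_bind[OF F stages_bind[OF _ stages_total]] by fastforce
next
  case (comp f g)
  then obtain F G where F: "stages f F" and G: "stages g G" by blast
  have "stages (\<lambda>p. f (pr2 p)) (\<lambda>p. F (pr2 p))"
    using F by (intro stagesI) (auto intro!: stagesD(1)[OF F] recf_intros dest: stagesD(2-4)[OF F])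
  from stages_bind[OF G this] show ?case by auto
next
  case (prec f g)
  then obtain F G where F: "stages f F" and G: "stages g G" by blast
  \<comment> \<open>The recursion is run with one bound for all calls; once a level gives 0, every
    later level does.\<close>
  define Q where "Q a t k = rec_nat (F a t)
    (\<lambda>i r. if r = 0 then 0 else G (prod_encode (a, prod_encode (i, r - Suc 0))) t) k" for a t k
  define q where "q a k = rec_nat (f a) (\<lambda>i r. Option.bind r (\<lambda>y. g (prod_encode (a, prod_encode (i, y))))) k"
    for a k
  have sound: "Q a t k = Suc y \<Longrightarrow> q a k = Some y" for a t k y
  proof (induction k arbitrary: y)
    case 0
    then show ?case using stagesD(2)[OF F] by (simp add: Q_def q_def)
  next
    case (Suc k)
    then obtain z where "Q a t k = Suc z" "G (prod_encode (a, prod_encode (k, z))) t = Suc y"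
      by (cases "Q a t k") (auto simp: Q_def)
    then show ?case using Suc.IH[of z] stagesD(2)[OF G] by (simp add: q_def)
  qed
  have mono: "Q a t k = Suc y \<Longrightarrow> t \<le> t' \<Longrightarrow> Q a t' k = Suc y" for a t t' k y
  proof (induction k arbitrary: y)
    case 0
    then show ?case using stagesD(4)[OF F _ "0.prems"(2)] by (simp add: Q_def)
  next
    case (Suc k)
    then obtain z where "Q a t k = Suc z" "G (prod_encode (a, prod_encode (k, z))) t = Suc y"
      by (cases "Q a t k") (auto simp: Q_def)
    then show ?case using Suc.IH[of z] stagesD(4)[OF G _ Suc.prems(2)] Suc.prems(2) by (simp add: Q_def)
  qed
  have complete: "q a k = Some y \<Longrightarrow> \<exists>t0. \<forall>t\<ge>t0. Q a t k = Suc y" for a k y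
  proof (induction k arbitrary: y)
    case 0
    then show ?case using stagesD(3)[OF F] by (simp add: Q_def q_def)
  next
    case (Suc k)
    then obtain z where z: "q a k = Some z" "g (prod_encode (a, prod_encode (k, z))) = Some y"
      by (auto simp: q_def Option.bind_eq_Some_conv)
    obtain t0 t1 where "\<forall>t\<ge>t0. Q a t k = Suc z" "\<forall>t\<ge>t1. G (prod_encode (a, prod_encode (k, z))) t = Suc y"
      using Suc.IH[OF z(1)] stagesD(3)[OF G z(2)] by blast
    then have "\<forall>t\<ge>max t0 t1. Q a t (Suc k) = Suc y" by (simp add: Q_def)
    then show ?case by blast
  qed
  have "stages (\<lambda>n. q (pr1 n) (pr2 n)) (\<lambda>n t. Q (pr1 n) t (pr2 n))"
  proof (rule stagesI)
    show "recf (\<lambda>p. Q (pr1 (pr1 p)) (pr2 p) (pr2 (pr1 p)))"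
      unfolding Q_def
      by (intro recf_rec_nat recf_intros stagesD(1)[OF F] stagesD(1)[OF G]
          recf_intros)
  qed (fact sound, fact complete, fact mono)
  then show ?case by (auto simp: q_def case_prod_beta)
next
  case (minim f)
  then obtain F where F: "stages f F" by blast
  let ?f = "\<lambda>a. if \<exists>m. f (prod_encode (a, m)) = Some 0 \<and>
                         (\<forall>k<m. \<exists>y. f (prod_encode (a, k)) = Some (Suc y))
                  then Some (LEAST m. f (prod_encode (a, m)) = Some 0) else None"
  define ok where "ok a m \<longleftrightarrow> f (prod_encode (a, m)) = Some 0 \<and>
    (\<forall>k<m. \<exists>y. f (prod_encode (a, k)) = Some (Suc y))" for a m
  have f_eq: "?f a = Some m \<longleftrightarrow> ok a m" for a m
  proof -
    have uniq: "(LEAST m. f (prod_encode (a, m)) = Some 0) = m" if okm: "ok a m" for m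
    proof (rule Least_equality)
      show "f (prod_encode (a, m)) = Some 0" using that by (simp add: ok_def)
      fix y assume y: "f (prod_encode (a, y)) = Some 0"
      show "m \<le> y"
      proof (rule ccontr)
        assume "\<not> m \<le> y"
        then have "y < m" by simp
        then obtain x where "f (prod_encode (a, y)) = Some (Suc x)"
          using okm unfolding ok_def by blast
        with y show False by simp
      qed
    qed
    show ?thesis
    proof (cases "\<exists>m. ok a m")
      case True
      then obtain m' where "ok a m'" by blast
      then show ?thesis using uniq[of m'] uniq[of m] True unfolding ok_def[symmetric] by auto
    next
      case False
      then show ?thesis unfolding ok_def[symmetric] by auto
    qed
  qed
  \<comment> \<open>The search below \<open>m\<close> has three kinds of states: 0 while all values
    so far are known and positive, \<open>Suc 0\<close> once a value is not known at bound
    \<open>t\<close>, and \<open>Suc (Suc i)\<close> once \<open>i\<close> is found to be the first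
    zero. Subtracting 1 turns the first two into "no result" and the third into the result
    \<open>i\<close>.\<close>
  define r where "r a t m = rec_nat 0 (\<lambda>i s. if s = 0 then
      (if F (prod_encode (a, i)) t = 0 then Suc 0 else if F (prod_encode (a, i)) t = Suc 0
       then Suc (Suc i) else 0) else s) m" for a t m
  have r0: "r a t m = 0 \<longleftrightarrow> (\<forall>k<m. \<exists>y. F (prod_encode (a, k)) t = Suc (Suc y))" for a t m
  proof (induction m)
    case (Suc m)
    have "r a t (Suc m) = 0 \<longleftrightarrow> r a t m = 0 \<and> (\<exists>y. F (prod_encode (a, m)) t = Suc (Suc y))"
      by (cases "F (prod_encode (a, m)) t"; cases "F (prod_encode (a, m)) t - 1") (auto simp: r_def)
    then show ?case using Suc by (auto simp: less_Suc_eq)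
  qed (simp add: r_def)
  have rS: "r a t n = Suc (Suc m) \<longleftrightarrow> m < n \<and> F (prod_encode (a, m)) t = Suc 0 \<and> r a t m = 0" for a t n m
  proof (induction n)
    case (Suc n)
    have "r a t (Suc n) = Suc (Suc m) \<longleftrightarrow> r a t n = Suc (Suc m) \<or>
      (n = m \<and> r a t n = 0 \<and> F (prod_encode (a, n)) t = Suc 0)"
      by (auto simp: r_def)
    then show ?case using Suc by (auto simp: less_Suc_eq)
  qed (simp add: r_def)
  have "stages ?f (\<lambda>a t. r a t t - Suc 0)"
  proof (rule stagesI)
    show "recf (\<lambda>p. r (pr1 p) (pr2 p) (pr2 p) - Suc 0)"
      unfolding r_def
      by (intro recf_rec_nat recf_if0 recf_if recf_intros stagesD(1)[OF F]
          recf_intros)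
  next
    fix n y t assume "r n t t - Suc 0 = Suc y"
    then have "r n t t = Suc (Suc y)" by simp
    then have "ok n y" unfolding rS r0 ok_def using stagesD(2)[OF F] by blast
    then show "?f n = Some y" by (simp only: f_eq)
  next
    fix n t t' y assume "r n t t - Suc 0 = Suc y" "t \<le> t'"
    then have "r n t t = Suc (Suc y)" by simp
    then have "r n t' t' = Suc (Suc y)" unfolding rS r0
      using stagesD(4)[OF F _ \<open>t \<le> t'\<close>] \<open>t \<le> t'\<close> by (meson order_less_le_trans)
    then show "r n t' t' - Suc 0 = Suc y" by simp
  next
    fix n y assume "?f n = Some y"
    then have "ok n y" by (simp only: f_eq)
    then obtain z where z0: "f (prod_encode (n, y)) = Some 0"
      and z: "\<And>k. k < y \<Longrightarrow> f (prod_encode (n, k)) = Some (Suc (z k))"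
      unfolding ok_def by metis
    obtain t0 where t0: "\<forall>t\<ge>t0. F (prod_encode (n, y)) t = Suc 0" using stagesD(3)[OF F z0] by blast
    have "\<forall>k<y. \<exists>t0. \<forall>t\<ge>t0. F (prod_encode (n, k)) t = Suc (Suc (z k))"
      using stagesD(3)[OF F z] by blast
    then obtain t1 where t1: "\<And>k t. k < y \<Longrightarrow> t1 k \<le> t \<Longrightarrow> F (prod_encode (n, k)) t = Suc (Suc (z k))"
      by metis
    \<comment> \<open>The sum majorises every \<open>t1 k\<close>, and \<open>Suc y\<close> ensures
      that the search below \<open>T\<close> reaches \<open>y\<close>.\<close>
    define T where "T = t0 + (\<Sum>k<y. t1 k) + Suc y"
    have "t1 k \<le> T" if "k < y" for k
      using member_le_sum[of k "{..<y}" t1] that unfolding T_def by simp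
    then have "\<forall>t\<ge>T. r n t t = Suc (Suc y)" unfolding rS r0
      using t0 t1 by (auto simp: T_def) (meson le_trans)
    then show "\<exists>t0. \<forall>t\<ge>t0. r n t t - Suc 0 = Suc y" by (metis diff_Suc_1 One_nat_def)
  qed
  then show ?case by blast
qed

text \<open>Minimisation over a total function meets no diverging value before the first
  zero.\<close>

lemma recf_dovetail:
  assumes "recf (\<lambda>p. f (pr1 p) (pr2 p))"
  shows "\<exists>F. partrec F \<and> (\<forall>n y. F n = Some y \<longrightarrow> f n y = 0) \<and> (\<forall>n y. f n y = 0 \<longrightarrow> F n \<noteq> None)"
proof -
  let ?f = "\<lambda>n. Some (f (pr1 n) (pr2 n))"
  let ?F = "\<lambda>a. if \<exists>m. ?f (prod_encode (a, m)) = Some 0 \<and>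
                         (\<forall>k<m. \<exists>y. ?f (prod_encode (a, k)) = Some (Suc y))
                  then Some (LEAST m. ?f (prod_encode (a, m)) = Some 0) else None"
  have "partrec ?F" using assms unfolding recf_def by (rule partrec.minim)
  moreover have "f n y = 0" if F: "?F n = Some y" for n y
    using F by (auto split: if_splits intro: LeastI)
  moreover have "?F n \<noteq> None" if "f n y = 0" for n y
  proof -
    have "f n (LEAST m. f n m = 0) = 0" using that by (rule LeastI)
    moreover have "\<forall>k<(LEAST m. f n m = 0). \<exists>y. f n k = Suc y"
      using not_less_Least not0_implies_Suc by blast
    ultimately show ?thesis by auto
  qed
  ultimately show ?thesis by blast
qed

section \<open>Semidecidable predicates\<close>

text \<open>A search for a witness of some type runs through all natural numbers and has to
  recognise those that are codes of the type.\<close>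

class decidable_range = encodable +
  assumes decidable_range: "\<exists>p. recf p \<and> (\<forall>n. p n = 0 \<longleftrightarrow> n \<in> range encode)"

section \<open>Computable functions between encoded types\<close>

definition computable :: "('a::encodable \<Rightarrow> 'b::encodable) \<Rightarrow> bool" where
  "computable f \<longleftrightarrow> (\<exists>p. recf p \<and> (\<forall>x. p (encode x) = encode (f x)))"

lemma computableI: "recf p \<Longrightarrow> (\<And>x. p (encode x) = encode (f x)) \<Longrightarrow> computable f"
  unfolding computable_def by blast

lemma computableE:
  assumes "computable f"
  obtains p where "recf p" "\<And>x. p (encode x) = encode (f x)"
  using assms unfolding computable_def by blast

lemma computable_id: "computable (\<lambda>x. x)"
  by (rule computableI[OF recf_id]) simp

lemma computable_const: "computable (\<lambda>x. c)"
  by (rule computableI[OF recf_const[of "encode c"]]) simp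

lemma computable_comp: "computable f \<Longrightarrow> computable g \<Longrightarrow> computable (\<lambda>x. f (g x))"
proof -
  assume "computable f" "computable g"
  then obtain f' g' where r: "recf f'" "recf g'"
    and e: "\<And>x. f' (encode x) = encode (f x)" "\<And>x. g' (encode x) = encode (g x)"
    unfolding computable_def by metis
  show ?thesis
    by (rule computableI[OF recf_comp[OF r]]) (simp_all add: e)
qed

lemma computable_Pair: "computable f \<Longrightarrow> computable g \<Longrightarrow> computable (\<lambda>x. (f x, g x))"
proof -
  assume "computable f" "computable g"
  then obtain f' g' where r: "recf f'" "recf g'"
    and e: "\<And>x. f' (encode x) = encode (f x)" "\<And>x. g' (encode x) = encode (g x)"
    unfolding computable_def by metis
  show ?thesis
    by (rule computableI[OF recf_pair[OF r]]) (simp_all add: e encode_prod_def)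
qed

lemma computable_fst: "computable f \<Longrightarrow> computable (\<lambda>x. fst (f x))"
  by (elim computableE, rule computableI, erule recf_pr1) (simp add: encode_prod_def)

lemma computable_snd: "computable f \<Longrightarrow> computable (\<lambda>x. snd (f x))"
  by (elim computableE, rule computableI, erule recf_pr2) (simp add: encode_prod_def)

lemma computable_Suc: "computable f \<Longrightarrow> computable (\<lambda>x. Suc (f x))"
  by (elim computableE, rule computableI, erule recf_Suc) (simp add: encode_nat_def)

lemma computable_Cons: "computable f \<Longrightarrow> computable g \<Longrightarrow> computable (\<lambda>x. f x # g x)"
proof -
  assume "computable f" "computable g"
  then obtain f' g' where r: "recf f'" "recf g'"
    and e: "\<And>x. f' (encode x) = encode (f x)" "\<And>x. g' (encode x) = encode (g x)"
    unfolding computable_def by metis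
  show ?thesis
    by (rule computableI[OF recf_Suc[OF recf_pair[OF r]]]) (simp_all add: e encode_list_def)
qed

lemma computable_Some: "computable f \<Longrightarrow> computable (\<lambda>x. Some (f x))"
  by (elim computableE, rule computableI, erule recf_Suc) (simp add: encode_option_def)

lemma computable_if_eq:
  assumes "computable a" "computable b" "computable f" "computable g"
  shows "computable (\<lambda>x. if a x = b x then f x else g x)"
proof -
  obtain a' b' f' g' where r: "recf a'" "recf b'" "recf f'" "recf g'"
    and e: "\<And>x. a' (encode x) = encode (a x)" "\<And>x. b' (encode x) = encode (b x)"
      "\<And>x. f' (encode x) = encode (f x)" "\<And>x. g' (encode x) = encode (g x)"
    using assms unfolding computable_def by metis
  show ?thesis by (rule computableI[OF recf_if[OF r]]) (simp add: e)
qed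

text \<open>The one recursion over lists from which append, length, map and concat are
  derived.\<close>

lemma computable_foldl:
  fixes f :: "'a::encodable \<Rightarrow> 'b::encodable" and k :: "'a \<Rightarrow> 'c::encodable list"
  assumes "computable f" "computable k"
    and "computable (\<lambda>p. g (fst p) (fst (snd p)) (snd (snd p)))"
  shows "computable (\<lambda>x. foldl (g x) (f x) (k x))"
proof -
  obtain f' k' g' where r: "recf f'" "recf k'" "recf g'"
    and e: "\<And>x. f' (encode x) = encode (f x)" "\<And>x. k' (encode x) = encode (k x)"
      "\<And>p. g' (encode p) = encode (g (fst p) (fst (snd p)) (snd (snd p)))"
    using assms unfolding computable_def by metis
  have 1: "foldl (\<lambda>b c. g' (prod_encode (encode x, prod_encode (b, c)))) (encode b) (map encode cs) =
      encode (foldl (g x) b cs)" for x b cs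
  proof (induction cs arbitrary: b)
    case (Cons c cs)
    have "g' (prod_encode (encode x, prod_encode (encode b, encode c))) = encode (g x b c)"
      using e(3)[of "(x, (b, c))"] by (simp add: encode_prod_def)
    then show ?case using Cons by simp
  qed simp
  have "recf (\<lambda>n. foldl (\<lambda>b c. g' (prod_encode (n, prod_encode (b, c)))) (f' n) (list_decode (k' n)))"
    by (intro recf_foldl r recf_comp[OF r(3)] recf_intros)
  then show ?thesis
    by (rule computableI) (simp add: e 1 encode_list_def)
qed

lemma computable_append:
  assumes "computable f" "computable g" shows "computable (\<lambda>x. f x @ g x)"
proof -
  have 1: "foldl (\<lambda>ys x. x # ys) ys xs = rev xs @ ys" for xs ys :: "'b list"
    by (induction xs arbitrary: ys) auto
  have "computable (\<lambda>x. foldl (\<lambda>ys x. x # ys) (g x) (foldl (\<lambda>ys x. x # ys) [] (f x)))"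
    by (intro computable_foldl computable_Cons computable_const computable_fst computable_snd
        computable_id assms)
  then show ?thesis by (simp add: 1)
qed

lemma computable_length:
  assumes "computable f" shows "computable (\<lambda>x. length (f x))"
proof -
  have 1: "foldl (\<lambda>n x. Suc n) m xs = length xs + m" for xs :: "'b list" and m
    by (induction xs arbitrary: m) auto
  have "computable (\<lambda>x. foldl (\<lambda>n x. Suc n) 0 (f x))"
    by (intro computable_foldl computable_Suc computable_const computable_fst computable_snd
        computable_id assms)
  then show ?thesis by (simp add: 1)
qed

lemma computable_map:
  assumes "computable g" "computable (\<lambda>p. f (fst p) (snd p))"
  shows "computable (\<lambda>x. map (f x) (g x))"
proof -
  have 1: "foldl (\<lambda>ys x. ys @ [h x]) ys xs = ys @ map h xs" for h :: "'b \<Rightarrow> 'c" and xs ys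
    by (induction xs arbitrary: ys) auto
  have 2: "computable (\<lambda>p. f (h1 p) (h2 p))" if "computable h1" "computable h2"
    for h1 :: "'d::encodable \<Rightarrow> 'a" and h2
    using computable_comp[OF assms(2) computable_Pair[OF that]] by simp
  have "computable (\<lambda>x. foldl (\<lambda>ys y. ys @ [f x y]) [] (g x))"
    by (intro computable_foldl computable_append computable_Cons 2 computable_const computable_fst
        computable_snd computable_id assms(1))
  then show ?thesis by (simp add: 1)
qed

lemma computable_concat:
  assumes "computable f" shows "computable (\<lambda>x. concat (f x))"
proof -
  have 1: "foldl (@) ys xs = ys @ concat xs" for xs :: "'b list list" and ys
    by (induction xs arbitrary: ys) auto
  have "computable (\<lambda>x. foldl (\<lambda>xs ys. xs @ ys) [] (f x))"
    by (intro computable_foldl computable_append computable_const computable_fst computable_snd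
        computable_id assms)
  then show ?thesis by (simp add: 1)
qed

lemma computable_Gen: "computable f \<Longrightarrow> computable (\<lambda>x. Gen (f x))"
  by (elim computableE, rule computableI, rule recf_pair[OF recf_const[of 0]])
    auto

lemma computable_Transl:
  "computable f \<Longrightarrow> computable g \<Longrightarrow> computable h \<Longrightarrow> computable (\<lambda>x. Transl (f x) (g x) (h x))"
proof -
  assume "computable f" "computable g" "computable h"
  then obtain f' g' h' where r: "recf f'" "recf g'" "recf h'"
    and e: "\<And>x. f' (encode x) = encode (f x)" "\<And>x. g' (encode x) = encode (g x)" "\<And>x. h' (encode x) = encode (h x)"
    unfolding computable_def by metis
  show ?thesis
    by (rule computableI[OF recf_pair[OF recf_const[of 1] recf_pair[OF r(1) recf_pair[OF r(2,3)]]]]) (simp_all add: e)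
qed

lemma computable_Shift:
  "computable f \<Longrightarrow> computable g \<Longrightarrow> computable h \<Longrightarrow> computable (\<lambda>x. Shift (f x) (g x) (h x))"
proof -
  assume "computable f" "computable g" "computable h"
  then obtain f' g' h' where r: "recf f'" "recf g'" "recf h'"
    and e: "\<And>x. f' (encode x) = encode (f x)" "\<And>x. g' (encode x) = encode (g x)" "\<And>x. h' (encode x) = encode (h x)"
    unfolding computable_def by metis
  show ?thesis
    by (rule computableI[OF recf_pair[OF recf_const[of 2] recf_pair[OF r(1) recf_pair[OF r(2,3)]]]]) (simp_all add: e)
qed

lemma computable_Inter:
  "computable f \<Longrightarrow> computable g \<Longrightarrow> computable (\<lambda>x. Inter (f x) (g x))"
proof -
  assume "computable f" "computable g"
  then obtain f' g' where r: "recf f'" "recf g'"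
    and e: "\<And>x. f' (encode x) = encode (f x)" "\<And>x. g' (encode x) = encode (g x)"
    unfolding computable_def by metis
  show ?thesis
    by (rule computableI[OF recf_pair[OF recf_const[of 3] recf_pair[OF r]]]) (simp_all add: e)
qed

lemmas computable_intros = computable_const computable_id computable_Pair computable_Suc
  computable_Cons computable_Some computable_append computable_length computable_concat computable_map
  computable_if_eq computable_Gen computable_Transl computable_Shift computable_Inter
  computable_fst computable_snd

section \<open>Types whose codes can be recognised\<close>

instance nat :: decidable_range
  by standard (rule exI[of _ "\<lambda>_. 0"], auto simp: encode_nat_def recf_const)

instance bool :: decidable_range
proof
  have "n \<in> range (encode :: bool \<Rightarrow> nat) \<longleftrightarrow> n - 1 = 0" for n
    by (auto simp: encode_bool_def UNIV_bool)
  then show "\<exists>p. recf p \<and> (\<forall>n. (p n = 0) = (n \<in> range (encode :: bool \<Rightarrow> nat)))"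
    by (intro exI[of _ "\<lambda>n. n - Suc 0"]) (auto intro: recf_intros)
qed

instance factor :: decidable_range
proof
  have "n \<in> range (encode :: factor \<Rightarrow> nat) \<longleftrightarrow> n - 1 = 0" for n
  proof
    assume "n - 1 = 0"
    then have "n = encode FactorA \<or> n = encode FactorB" by (auto simp: encode_factor_def)
    then show "n \<in> range (encode :: factor \<Rightarrow> nat)" by blast
  qed (auto simp: encode_factor_def split: factor.splits)
  then show "\<exists>p. recf p \<and> (\<forall>n. (p n = 0) = (n \<in> range (encode :: factor \<Rightarrow> nat)))"
    by (intro exI[of _ "\<lambda>n. n - Suc 0"]) (auto intro: recf_intros)
qed

instance option :: (decidable_range) decidable_range
proof
  obtain p where p: "recf p" "\<And>n. p n = 0 \<longleftrightarrow> n \<in> range (encode :: 'a \<Rightarrow> nat)"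
    using decidable_range[where 'a = 'a] by blast
  have 1: "n \<in> range (encode :: 'a option \<Rightarrow> nat) \<longleftrightarrow> (if n = 0 then 0 else p (n - Suc 0)) = 0" for n
  proof (cases n)
    case 0
    then have "n = encode (None :: 'a option)" by (simp add: encode_option_def)
    with 0 show ?thesis by auto
  next
    case (Suc m)
    have "n = encode z \<longleftrightarrow> (\<exists>x. z = Some x \<and> m = encode x)" for z :: "'a option"
      by (cases z) (auto simp: encode_option_def Suc)
    then show ?thesis using Suc by (auto simp: p(2) image_iff)
  qed
  show "\<exists>p. recf p \<and> (\<forall>n. (p n = 0) = (n \<in> range (encode :: 'a option \<Rightarrow> nat)))"
    by (intro exI[of _ "\<lambda>n. if n = 0 then 0 else p (n - Suc 0)"] conjI allI)
      (intro recf_if0 recf_comp[OF p(1)] recf_intros, simp only: 1)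
qed

instance prod :: (decidable_range, decidable_range) decidable_range
proof
  obtain p where p: "recf p" "\<And>n. p n = 0 \<longleftrightarrow> n \<in> range (encode :: 'a \<Rightarrow> nat)"
    using decidable_range[where 'a = 'a] by blast
  obtain q where q: "recf q" "\<And>n. q n = 0 \<longleftrightarrow> n \<in> range (encode :: 'b \<Rightarrow> nat)"
    using decidable_range[where 'a = 'b] by blast
  have 1: "n \<in> range (encode :: 'a \<times> 'b \<Rightarrow> nat) \<longleftrightarrow>
      (if p (pr1 n) = 0 then q (pr2 n) else Suc 0) = 0" for n
  proof -
    have "n \<in> range (encode :: 'a \<times> 'b \<Rightarrow> nat) \<longleftrightarrow> (\<exists>x y. n = prod_encode (encode (x::'a), encode (y::'b)))"
      by (auto simp: encode_prod_def image_iff)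
    also have "\<dots> \<longleftrightarrow> pr1 n \<in> range (encode :: 'a \<Rightarrow> nat) \<and> pr2 n \<in> range (encode :: 'b \<Rightarrow> nat)"
      by (auto simp: image_iff) (metis prod.collapse prod_decode_inverse)
    finally show ?thesis by (simp add: p(2) q(2))
  qed
  show "\<exists>p. recf p \<and> (\<forall>n. (p n = 0) = (n \<in> range (encode :: 'a \<times> 'b \<Rightarrow> nat)))"
    by (intro exI[of _ "\<lambda>n. if p (pr1 n) = 0 then q (pr2 n) else Suc 0"] conjI allI)
      (intro recf_if0 recf_comp[OF p(1)] recf_comp[OF q(1)] recf_intros,
        simp only: 1)
qed

instance list :: (decidable_range) decidable_range
proof
  obtain p where p: "recf p" "\<And>n. p n = 0 \<longleftrightarrow> n \<in> range (encode :: 'a \<Rightarrow> nat)"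
    using decidable_range[where 'a = 'a] by blast
  let ?c = "\<lambda>a x. if p x = 0 then a else Suc 0"
  have fold: "foldl ?c a xs = 0 \<longleftrightarrow> a = 0 \<and> (\<forall>x\<in>set xs. p x = 0)" for a xs
    by (induction xs arbitrary: a) auto
  have "n \<in> range (encode :: 'a list \<Rightarrow> nat) \<longleftrightarrow> (\<forall>x\<in>set (list_decode n). x \<in> range (encode :: 'a \<Rightarrow> nat))" for n
  proof
    assume "\<forall>x\<in>set (list_decode n). x \<in> range (encode :: 'a \<Rightarrow> nat)"
    then have "list_decode n \<in> lists (range (encode :: 'a \<Rightarrow> nat))" by auto
    then obtain xs :: "'a list" where "list_decode n = map encode xs"
      unfolding lists_image by auto
    then have "n = encode xs" unfolding encode_list_def by (metis list_decode_inverse)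
    then show "n \<in> range (encode :: 'a list \<Rightarrow> nat)" by blast
  qed (auto simp: encode_list_def)
  then have 1: "n \<in> range (encode :: 'a list \<Rightarrow> nat) \<longleftrightarrow> foldl ?c 0 (list_decode n) = 0" for n
    unfolding fold unfolding p(2) by simp
  show "\<exists>p. recf p \<and> (\<forall>n. (p n = 0) = (n \<in> range (encode :: 'a list \<Rightarrow> nat)))"
    by (intro exI[of _ "\<lambda>n. foldl ?c 0 (list_decode n)"] conjI allI)
      (intro recf_foldl recf_if0 recf_comp[OF p(1)] recf_intros,
        simp only: 1)
qed

section \<open>Closure properties of semidecidable predicates\<close>

abbreviation accepts :: "(nat \<Rightarrow> nat) \<Rightarrow> 'a::encodable \<Rightarrow> bool" where
  "accepts p x \<equiv> \<exists>t. p (prod_encode (encode x, t)) = 0"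

definition semi :: "('a::encodable \<Rightarrow> bool) \<Rightarrow> bool" where
  "semi P \<longleftrightarrow> (\<exists>p. recf p \<and> (\<forall>x. P x \<longleftrightarrow> accepts p x))"

lemma semiI: "recf p \<Longrightarrow> (\<And>x. P x \<longleftrightarrow> accepts p x) \<Longrightarrow> semi P"
  unfolding semi_def by blast

lemma semi_comp:
  assumes "semi P" "computable f" shows "semi (\<lambda>x. P (f x))"
proof -
  obtain p where p: "recf p" "\<And>x. P x \<longleftrightarrow> accepts p x"
    using assms(1) unfolding semi_def by blast
  obtain q where q: "recf q" "\<And>x. q (encode x) = encode (f x)"
    using assms(2) unfolding computable_def by blast
  have "recf (\<lambda>n. p (prod_encode (q (pr1 n), pr2 n)))"
    by (intro recf_comp[OF p(1)] recf_comp[OF q(1)] recf_intros)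
  then show ?thesis by (rule semiI) (simp add: p(2) q(2))
qed

lemma semi_eq:
  assumes "computable f" "computable g" shows "semi (\<lambda>x. f x = g x)"
proof -
  have "computable (\<lambda>x. if f x = g x then 0 else Suc 0)"
    by (intro computable_intros assms)
  then obtain p where p: "recf p" "\<And>x. p (encode x) = encode (if f x = g x then 0 else Suc 0)"
    unfolding computable_def by blast
  have "recf (\<lambda>n. p (pr1 n))" by (intro recf_comp[OF p(1)] recf_intros)
  then show ?thesis by (rule semiI) (simp add: p(2) encode_nat_def)
qed

lemma semi_neq:
  assumes "computable f" "computable g" shows "semi (\<lambda>x. f x \<noteq> g x)"
proof -
  have "computable (\<lambda>x. if f x = g x then Suc 0 else 0)"
    by (intro computable_intros assms)
  then have "semi (\<lambda>x. (if f x = g x then Suc 0 else 0) = 0)"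
    by (rule semi_eq) (rule computable_const)
  then show ?thesis by (rule back_subst[of semi]) auto
qed

lemma semi_const: "semi (\<lambda>x. P)"
  by (rule semiI[OF recf_const[of "if P then 0 else Suc 0"]]) simp

lemma semi_conj: assumes "semi P" "semi Q" shows "semi (\<lambda>x. P x \<and> Q x)"
proof -
  obtain p where p: "recf p" "\<And>x. P x \<longleftrightarrow> accepts p x"
    using assms(1) unfolding semi_def by blast
  obtain q where q: "recf q" "\<And>x. Q x \<longleftrightarrow> accepts q x"
    using assms(2) unfolding semi_def by blast
  let ?r = "\<lambda>n. if p (prod_encode (pr1 n, pr1 (pr2 n))) = 0
    then q (prod_encode (pr1 n, pr2 (pr2 n))) else Suc 0"
  have "recf ?r"
    by (intro recf_if0 recf_comp[OF p(1)] recf_comp[OF q(1)] recf_intros)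
  then show ?thesis
  proof (rule semiI)
    fix x
    show "P x \<and> Q x \<longleftrightarrow> (\<exists>t. ?r (prod_encode (encode x, t)) = 0)"
    proof
      assume "P x \<and> Q x"
      then obtain s t where "p (prod_encode (encode x, s)) = 0" "q (prod_encode (encode x, t)) = 0"
        using p(2) q(2) by blast
      then have "?r (prod_encode (encode x, prod_encode (s, t))) = 0" by simp
      then show "\<exists>t. ?r (prod_encode (encode x, t)) = 0" by blast
    qed (use p(2) q(2) in \<open>auto split: if_splits\<close>)
  qed
qed

lemma semi_disj: assumes "semi P" "semi Q" shows "semi (\<lambda>x. P x \<or> Q x)"
proof -
  obtain p where p: "recf p" "\<And>x. P x \<longleftrightarrow> accepts p x"
    using assms(1) unfolding semi_def by blast
  obtain q where q: "recf q" "\<And>x. Q x \<longleftrightarrow> accepts q x"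
    using assms(2) unfolding semi_def by blast
  have "recf (\<lambda>n. if p n = 0 then 0 else q n)"
    by (intro recf_if0 p(1) q(1) recf_const)
  moreover have "(if p n = 0 then 0 else q n) = 0 \<longleftrightarrow> p n = 0 \<or> q n = 0" for n by simp
  ultimately show ?thesis by (intro semiI) (assumption, simp only: p(2) q(2), blast)
qed

text \<open>The stage codes a candidate for \<open>y\<close> together with the stage at which
  \<open>P\<close> accepts it; numbers that code no candidate are rejected.\<close>

lemma semi_ex:
  fixes P :: "'a::encodable \<Rightarrow> 'b::decidable_range \<Rightarrow> bool"
  assumes "semi (\<lambda>p. P (fst p) (snd p))" shows "semi (\<lambda>x. \<exists>y. P x y)"
proof -
  obtain p where p: "recf p" "\<And>z. P (fst z) (snd z) \<longleftrightarrow> accepts p z"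
    using assms unfolding semi_def by blast
  obtain r where r: "recf r" "\<And>n. r n = 0 \<longleftrightarrow> n \<in> range (encode :: 'b \<Rightarrow> nat)"
    using decidable_range[where 'a = 'b] by blast
  let ?r = "\<lambda>n. if r (pr1 (pr2 n)) = 0
    then p (prod_encode (prod_encode (pr1 n, pr1 (pr2 n)), pr2 (pr2 n))) else Suc 0"
  have "recf ?r"
    by (intro recf_if0 recf_comp[OF p(1)] recf_comp[OF r(1)] recf_intros)
  then show ?thesis
  proof (rule semiI)
    fix x
    have P: "P x y \<longleftrightarrow> (\<exists>t. p (prod_encode (prod_encode (encode x, encode y), t)) = 0)" for y
      using p(2)[of "(x, y)"] by (simp add: encode_prod_def)
    show "(\<exists>y. P x y) \<longleftrightarrow> (\<exists>t. ?r (prod_encode (encode x, t)) = 0)"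
    proof
      assume "\<exists>y. P x y"
      then obtain y :: 'b and t where "p (prod_encode (prod_encode (encode x, encode y), t)) = 0"
        unfolding P by blast
      then have "?r (prod_encode (encode x, prod_encode (encode y, t))) = 0" using r(2) by simp
      then show "\<exists>t. ?r (prod_encode (encode x, t)) = 0" by blast
    next
      assume "\<exists>t. ?r (prod_encode (encode x, t)) = 0"
      then obtain t where "?r (prod_encode (encode x, t)) = 0" ..
      then have "pr1 t \<in> range (encode :: 'b \<Rightarrow> nat)"
        and t: "p (prod_encode (prod_encode (encode x, pr1 t), pr2 t)) = 0"
        by (simp_all add: r(2) split: if_splits)
      then obtain y :: 'b where "pr1 t = encode y" by blast
      then show "\<exists>y. P x y" using P t by metis
    qed
  qed
qed

lemma semi_all_less:
  fixes P :: "'a::encodable \<Rightarrow> nat \<Rightarrow> bool"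
  assumes "semi (\<lambda>p. P (fst p) (snd p))" "computable b"
  shows "semi (\<lambda>x. \<forall>i<b x. P x i)"
proof -
  obtain p where p: "recf p" "\<And>z. P (fst z) (snd z) \<longleftrightarrow> accepts p z"
    using assms(1) unfolding semi_def by blast
  obtain c where c: "recf c" "\<And>x. c (encode x) = encode (b x)"
    using assms(2) unfolding computable_def by blast
  \<comment> \<open>\<open>e n T i\<close> is 0 when index \<open>i\<close> is accepted at some
    stage below \<open>T\<close>. This is monotone in \<open>T\<close>, so finitely many indices
    share one bound.\<close>
  define e where "e n T i = (if \<exists>t<T. p (prod_encode (prod_encode (n, i), t)) = 0 then 0 else Suc 0)"
    for n T i
  let ?r = "\<lambda>n. if \<forall>i<c (pr1 n). e (pr1 n) (pr2 n) i = 0 then 0 else Suc 0"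
  have "recf ?r" unfolding e_def
    by (intro recf_bounded_all recf_bounded_ex recf_comp[OF p(1)] recf_comp[OF c(1)] recf_intros)
  then show ?thesis
  proof (rule semiI)
    fix x
    have P: "P x i \<longleftrightarrow> (\<exists>t. p (prod_encode (prod_encode (encode x, i), t)) = 0)" for i
      using p(2)[of "(x, i)"] by (simp add: encode_prod_def encode_nat_def)
    show "(\<forall>i<b x. P x i) \<longleftrightarrow> (\<exists>t. ?r (prod_encode (encode x, t)) = 0)"
    proof
      assume "\<forall>i<b x. P x i"
      then obtain t where t: "\<And>i. i < b x \<Longrightarrow> p (prod_encode (prod_encode (encode x, i), t i)) = 0"
        using P by metis
      define T where "T = Suc (\<Sum>i<b x. t i)"
      have "t i < T" if "i < b x" for i
        using member_le_sum[of i "{..<b x}" t] that unfolding T_def by simp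
      then have "e (encode x) T i = 0" if "i < b x" for i
        using t that unfolding e_def by auto
      then have "?r (prod_encode (encode x, T)) = 0"
        by (simp add: c(2) encode_nat_def)
      then show "\<exists>t. ?r (prod_encode (encode x, t)) = 0" by blast
    qed (auto simp: e_def c(2) encode_nat_def P split: if_splits)
  qed
qed

lemma semi_ball_list:
  fixes f :: "'a::encodable \<Rightarrow> 'b::decidable_range list"
  assumes "semi (\<lambda>p. P (fst p) (snd p))" "computable f"
  shows "semi (\<lambda>x. \<forall>y\<in>set (f x). P x y)"
proof -
  \<comment> \<open>Elements are addressed by their position, and \<open>nth\<close> is replaced by
    the existence of a split, so that only length, append and equality have to be
    computable.\<close>
  have 1: "(\<forall>y\<in>set (f x). P x y) \<longleftrightarrow> (\<forall>i<length (f x). \<exists>a y b. length a = i \<and> f x = a @ y # b \<and> P x y)" for x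
  proof (intro iffI allI impI ballI)
    fix i assume "\<forall>y\<in>set (f x). P x y" "i < length (f x)"
    then show "\<exists>a y b. length a = i \<and> f x = a @ y # b \<and> P x y"
      by (intro exI[of _ "take i (f x)"] exI[of _ "f x ! i"] exI[of _ "drop (Suc i) (f x)"])
        (simp add: id_take_nth_drop[symmetric])
  next
    fix y assume *: "\<forall>i<length (f x). \<exists>a y b. length a = i \<and> f x = a @ y # b \<and> P x y" "y \<in> set (f x)"
    then obtain i where i: "i < length (f x)" "f x ! i = y" by (auto simp: in_set_conv_nth)
    with *(1) obtain a z b where "length a = i" "f x = a @ z # b" "P x z" by blast
    with i show "P x y" by (auto simp: nth_append)
  qed
  have 2: "semi (\<lambda>z. P (h1 z) (h2 z))" if "computable h1" "computable h2" for h1 :: "'c::encodable \<Rightarrow> 'a" and h2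
    using semi_comp[OF assms(1) computable_Pair[OF that]] by simp
  have f: "computable (\<lambda>z. f (h z))" if "computable h" for h :: "'c::encodable \<Rightarrow> 'a"
    by (rule computable_comp[OF assms(2) that])
  show ?thesis unfolding 1
    by (intro semi_all_less semi_ex semi_conj semi_eq 2 f computable_intros)
qed

lemma semi_successively:
  fixes f :: "'a::encodable \<Rightarrow> 'b::decidable_range list"
  assumes "semi (\<lambda>p. P (fst p) (snd p))" "computable f"
  shows "semi (\<lambda>x. successively P (f x))"
proof -
  define Q where "Q y b \<longleftrightarrow> b = [] \<or> (\<exists>z c. b = z # c \<and> P y z)" for y b
  have 1: "successively P xs \<longleftrightarrow> (\<forall>i<length xs. \<exists>a y b. length a = i \<and> xs = a @ y # b \<and> Q y b)" for xs
  proof (induction xs)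
    case (Cons x xs)
    have 0: "(\<exists>a y b. length a = 0 \<and> x # xs = a @ y # b \<and> Q y b) \<longleftrightarrow> Q x xs" by auto
    have S: "(\<exists>a y b. length a = Suc i \<and> x # xs = a @ y # b \<and> Q y b) \<longleftrightarrow>
        (\<exists>a y b. length a = i \<and> xs = a @ y # b \<and> Q y b)" for i
    proof
      assume "\<exists>a y b. length a = i \<and> xs = a @ y # b \<and> Q y b"
      then obtain a y b where "length (x # a) = Suc i" "x # xs = (x # a) @ y # b" "Q y b" by auto
      then show "\<exists>a y b. length a = Suc i \<and> x # xs = a @ y # b \<and> Q y b" by blast
    qed (auto simp: length_Suc_conv)
    have "successively P (x # xs) \<longleftrightarrow> Q x xs \<and> successively P xs"
      by (cases xs) (auto simp: Q_def)
    then show ?case unfolding length_Cons All_less_Suc2 0 S Cons.IH .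
  qed simp
  have 2: "semi (\<lambda>z. P (h1 z) (h2 z))" if "computable h1" "computable h2" for h1 :: "'c::encodable \<Rightarrow> 'b" and h2
    using semi_comp[OF assms(1) computable_Pair[OF that]] by simp
  have f: "computable (\<lambda>z. f (h z))" if "computable h" for h :: "'c::encodable \<Rightarrow> 'a"
    by (rule computable_comp[OF assms(2) that])
  show ?thesis unfolding 1 Q_def
    by (intro semi_all_less semi_ex semi_conj semi_disj semi_eq 2 f computable_intros)
qed

text \<open>A derivation becomes a finite list, over which an existential quantifier may range; its
  end points are given by list equations, which \<open>semi_eq\<close> covers.\<close>

lemma rtranclp_iff_successively:
  "R\<^sup>*\<^sup>* x y \<longleftrightarrow> (\<exists>xs. successively R xs \<and> (\<exists>a. xs = x # a) \<and> (\<exists>a. xs = a @ [y]))"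
proof
  show "R\<^sup>*\<^sup>* x y \<Longrightarrow> \<exists>xs. successively R xs \<and> (\<exists>a. xs = x # a) \<and> (\<exists>a. xs = a @ [y])"
  proof (induction rule: rtranclp_induct)
    case base
    then show ?case by (intro exI[of _ "[x]"]) auto
  next
    case (step y z)
    then obtain xs a b where "successively R xs" "xs = x # a" "xs = b @ [y]" by blast
    from \<open>successively R xs\<close> \<open>xs = b @ [y]\<close> have "successively R (xs @ [z])"
      using step(2) by (simp add: successively_append_iff)
    moreover have "xs @ [z] = x # (a @ [z])" using \<open>xs = x # a\<close> by simp
    ultimately show ?case by blast
  qed
  have "successively R (x # a) \<Longrightarrow> x # a = b @ [y] \<Longrightarrow> R\<^sup>*\<^sup>* x y" for a b
  proof (induction a arbitrary: x b)
    case (Cons z a)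
    then obtain b' where "z # a = b' @ [y]" by (cases b) auto
    moreover have "successively R (z # a)" using Cons.prems(1) by simp
    ultimately have "R\<^sup>*\<^sup>* z y" using Cons.IH by blast
    moreover have "R x z" using Cons.prems(1) by simp
    ultimately show ?case by (rule converse_rtranclp_into_rtranclp[rotated])
  qed auto
  then show "\<exists>xs. successively R xs \<and> (\<exists>a. xs = x # a) \<and> (\<exists>a. xs = a @ [y]) \<Longrightarrow> R\<^sup>*\<^sup>* x y" by blast
qed

lemma semi_rtranclp:
  fixes f g :: "'a::encodable \<Rightarrow> 'b::decidable_range"
  assumes "semi (\<lambda>p. R (fst p) (snd p))" "computable f" "computable g"
  shows "semi (\<lambda>x. R\<^sup>*\<^sup>* (f x) (g x))"
proof -
  have fg: "computable (\<lambda>z. f (h z))" "computable (\<lambda>z. g (h z))" if "computable h" for h :: "'c::encodable \<Rightarrow> 'a"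
    by (rule computable_comp[OF assms(2) that] computable_comp[OF assms(3) that])+
  show ?thesis unfolding rtranclp_iff_successively
    by (intro semi_ex semi_conj semi_eq semi_successively assms(1) fg computable_intros)
qed

lemma semi_mem_finite:
  assumes "finite S" "computable f" shows "semi (\<lambda>x. f x \<in> S)"
  using assms(1)
proof (induction S rule: finite_induct)
  case (insert s S)
  have "semi (\<lambda>x. f x = s \<or> f x \<in> S)"
    by (intro semi_disj semi_eq computable_const assms insert)
  then show ?case by simp
qed (simp add: semi_const)

section \<open>From algorithms to semidecidable relations and back\<close>

lemma semi_graph:
  assumes "partrec F" "computable f" "computable g"
  shows "semi (\<lambda>x. F (encode (f x)) = Some (encode (g x)))"
proof -
  obtain S where S: "stages F S" using ex_stages[OF assms(1)] by blast
  obtain f' where f: "recf f'" "\<And>x. f' (encode x) = encode (f x)" using assms(2) unfolding computable_def by blast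
  obtain g' where g: "recf g'" "\<And>x. g' (encode x) = encode (g x)" using assms(3) unfolding computable_def by blast
  have "recf (\<lambda>n. if S (f' (pr1 n)) (pr2 n) = Suc (g' (pr1 n)) then 0 else Suc 0)"
    by (intro recf_if stagesD(1)[OF S] recf_comp[OF f(1)] recf_comp[OF g(1)] recf_intros)
  moreover have "F n = Some y \<longleftrightarrow> (\<exists>t. S n t = Suc y)" for n y
    using S unfolding stages_def by blast
  ultimately show ?thesis
    by (intro semiI) (assumption, simp add: f(2) g(2))
qed

text \<open>The relation \<open>Q\<close> stands for the graph of an algorithm, so that a
  certificate can quote an answer of the algorithm as a fact. It may admit several answers, all of
  them correct.\<close>

definition solves ::
    "'i::encodable set \<Rightarrow> ('i \<Rightarrow> 'o::encodable \<Rightarrow> bool) \<Rightarrow> ('i \<Rightarrow> 'o \<Rightarrow> bool) \<Rightarrow> bool" where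
  "solves I sol Q \<longleftrightarrow> (\<forall>x\<in>I. \<exists>y. Q x y) \<and> (\<forall>x\<in>I. \<forall>y. Q x y \<longrightarrow> sol x y) \<and>
     semi (\<lambda>p. Q (fst p) (snd p))"

lemma solvesD:
  assumes "solves I sol Q"
  shows "x \<in> I \<Longrightarrow> \<exists>y. Q x y" "x \<in> I \<Longrightarrow> Q x y \<Longrightarrow> sol x y" "semi (\<lambda>p. Q (fst p) (snd p))"
  using assms unfolding solves_def by blast+

lemma ex_solves:
  fixes sol :: "'i::encodable \<Rightarrow> 'o::encodable \<Rightarrow> bool"
  assumes "decidable I sol" shows "\<exists>Q. solves I sol Q"
proof -
  obtain F where F: "partrec F \<and> (\<forall>x\<in>I. F (encode x) \<noteq> None) \<and>
      (\<forall>x\<in>I. \<forall>n. F (encode x) = Some n \<longrightarrow> (\<exists>y. n = encode y \<and> sol x y))"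
    using assms unfolding decidable_def decidable_on_def by (elim exE)
  show ?thesis unfolding solves_def
  proof (intro exI[of _ "\<lambda>x y. F (encode x) = Some (encode y)"] conjI ballI allI impI)
    show "semi (\<lambda>p. F (encode (fst p)) = Some (encode (snd p)))"
      by (intro semi_graph conjunct1[OF F] computable_intros)
  next
    fix x :: 'i assume x: "x \<in> I"
    then obtain n where "F (encode x) = Some n" using F by blast
    then show "\<exists>y::'o. F (encode x) = Some (encode y)" using F x by metis
  next
    fix x :: 'i and y :: 'o assume "x \<in> I" "F (encode x) = Some (encode y)"
    then obtain z :: 'o where "encode y = encode z" "sol x z" using F by metis
    then show "sol x y" by simp
  qed
qed

text \<open>This carries out the dovetailing: the search runs over pairs of a possible answer and a
  stage, and the answer in the first accepted pair is returned.\<close>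

lemma decidable_onI:
  fixes Q :: "'i::encodable \<Rightarrow> 'o::decidable_range \<Rightarrow> bool"
  assumes "semi (\<lambda>p. Q (fst p) (snd p))"
    and "\<And>x. x \<in> \<Phi> \<Longrightarrow> \<exists>y. Q x y" and "\<And>x y. x \<in> I \<Longrightarrow> Q x y \<Longrightarrow> sol x y"
  shows "decidable_on \<Phi> I sol"
proof -
  obtain p where p: "recf p" "\<And>z. Q (fst z) (snd z) \<longleftrightarrow> accepts p z"
    using assms(1) unfolding semi_def by blast
  have Q: "Q x y \<longleftrightarrow> (\<exists>t. p (prod_encode (prod_encode (encode x, encode y), t)) = 0)" for x y
    using p(2)[of "(x, y)"] by (simp add: encode_prod_def)
  obtain r where r: "recf r" "\<And>n. r n = 0 \<longleftrightarrow> n \<in> range (encode :: 'o \<Rightarrow> nat)"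
    using decidable_range[where 'a = 'o] by blast
  define q where "q n s = (if r (pr1 s) = 0
    then p (prod_encode (prod_encode (n, pr1 s), pr2 s)) else Suc 0)" for n s
  have "recf (\<lambda>n. q (pr1 n) (pr2 n))" unfolding q_def
    by (intro recf_if0 recf_comp[OF p(1)] recf_comp[OF r(1)] recf_intros)
  from recf_dovetail[OF this] obtain F where F: "partrec F" "\<And>n y. F n = Some y \<Longrightarrow> q n y = 0"
    "\<And>n y. q n y = 0 \<Longrightarrow> F n \<noteq> None" by blast
  have "partrec (\<lambda>n. Option.bind (F n) (\<lambda>s. Some (pr1 s)))"
    by (rule partrec.comp[OF partrec.left F(1)])
  moreover have "Option.bind (F (encode x)) (\<lambda>s. Some (pr1 s)) \<noteq> None" if x: "x \<in> \<Phi>" for x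
  proof -
    obtain y :: 'o and t where "p (prod_encode (prod_encode (encode x, encode y), t)) = 0"
      using assms(2)[OF x] unfolding Q by blast
    then have "q (encode x) (prod_encode (encode y, t)) = 0" using r(2) by (simp add: q_def)
    then show ?thesis using F(3)[of "encode x"] by (auto simp: bind_eq_None_conv)
  qed
  moreover have "\<exists>y. n = encode y \<and> sol x y"
    if x: "x \<in> I" and n: "Option.bind (F (encode x)) (\<lambda>s. Some (pr1 s)) = Some n" for x n
  proof -
    obtain s where "F (encode x) = Some s" "n = pr1 s" using n by (auto simp: Option.bind_eq_Some_conv)
    then have "q (encode x) s = 0" using F(2) by blast
    then have "pr1 s \<in> range (encode :: 'o \<Rightarrow> nat)"
      and t: "p (prod_encode (prod_encode (encode x, pr1 s), pr2 s)) = 0"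
      by (simp_all add: q_def r(2) split: if_splits)
    then obtain y :: 'o where y: "pr1 s = encode y" by blast
    have "Q x y" unfolding Q using t unfolding y by blast
    then show ?thesis using assms(3)[OF x] y \<open>n = pr1 s\<close> by blast
  qed
  ultimately show ?thesis unfolding decidable_on_def
    by (intro exI[of _ "\<lambda>n. Option.bind (F n) (\<lambda>s. Some (pr1 s))"] conjI ballI allI impI)
qed

section \<open>Groups decomposed as amalgamated products\<close>

context group
begin

lemma cancel_left_inv: "a \<in> carrier G \<Longrightarrow> b \<in> carrier G \<Longrightarrow> a \<otimes> (inv a \<otimes> b) = b"
  by (simp add: m_assoc[symmetric])

lemma cancel_inv_left: "a \<in> carrier G \<Longrightarrow> b \<in> carrier G \<Longrightarrow> inv a \<otimes> (a \<otimes> b) = b"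
  by (simp add: m_assoc[symmetric])

lemmas group_simps = m_assoc inv_mult_group cancel_left_inv cancel_inv_left

text \<open>Each letter carries a tag, which the product ignores. Tags record factors, so that
  alternation between factors becomes a condition on tags alone.\<close>

definition gprod :: "('f \<times> 'a) list \<Rightarrow> 'a" where
  "gprod xs = foldr (\<lambda>p y. snd p \<otimes> y) xs \<one>"

lemma gprod_Nil [simp]: "gprod [] = \<one>"
  by (simp add: gprod_def)

lemma gprod_Cons [simp]: "gprod (p # xs) = snd p \<otimes> gprod xs"
  by (simp add: gprod_def)

lemma gprod_closed [simp]: "snd ` set xs \<subseteq> carrier G \<Longrightarrow> gprod xs \<in> carrier G"
  by (induction xs) auto

lemma gprod_append:
  "snd ` set xs \<subseteq> carrier G \<Longrightarrow> snd ` set ys \<subseteq> carrier G \<Longrightarrow> gprod (xs @ ys) = gprod xs \<otimes> gprod ys"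
  by (induction xs) (auto simp: m_assoc)

definition inv_seq :: "('f \<times> 'a) list \<Rightarrow> ('f \<times> 'a) list" where
  "inv_seq xs = rev (map (\<lambda>p. (fst p, inv (snd p))) xs)"

lemma inv_seq_closed: "snd ` set xs \<subseteq> carrier G \<Longrightarrow> snd ` set (inv_seq xs) \<subseteq> carrier G"
  by (auto simp: inv_seq_def)

lemma gprod_inv_seq: "snd ` set xs \<subseteq> carrier G \<Longrightarrow> gprod (inv_seq xs) = inv (gprod xs)"
  unfolding inv_seq_def
  by (induction xs) (simp_all add: gprod_append inv_mult_group image_subset_iff)

end

text \<open>The function \<open>tp\<close> packages the normal form theorem: the sequence of factors
  of a reduced form depends only on the element. The fact that C is the intersection of the factors
  is derived from it, as is the conjugacy theory.\<close>

locale amalgam_decomposition = group G for G (structure) +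
  fixes S :: "factor \<Rightarrow> 'a set" and C :: "'a set" and tp :: "'a \<Rightarrow> factor list"
  assumes subgroup_S: "subgroup (S F) G"
    and subgroup_C: "subgroup C G"
    and C_le: "C \<subseteq> S F"
    and generated: "generate G (\<Union>F. S F) = carrier G"
    and tp_C: "c \<in> C \<Longrightarrow> tp c = []"
    and tp_gprod: "\<lbrakk>xs \<noteq> []; \<forall>p\<in>set xs. snd p \<in> S (fst p) - C;
      successively (\<lambda>p q. fst p \<noteq> fst q) xs\<rbrakk> \<Longrightarrow> tp (gprod xs) = map fst xs"
begin

definition reduced :: "(factor \<times> 'a) list \<Rightarrow> bool" where
  "reduced xs \<longleftrightarrow> (\<forall>p\<in>set xs. snd p \<in> S (fst p) - C) \<and> successively (\<lambda>p q. fst p \<noteq> fst q) xs"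

lemma S_carrier: "x \<in> S F \<Longrightarrow> x \<in> carrier G"
  using subgroup.mem_carrier[OF subgroup_S] .

lemma C_carrier: "x \<in> C \<Longrightarrow> x \<in> carrier G"
  using subgroup.mem_carrier[OF subgroup_C] .

lemma C_S: "x \<in> C \<Longrightarrow> x \<in> S F"
  using C_le by blast

lemmas S_closed = subgroup.m_closed[OF subgroup_S] subgroup.m_inv_closed[OF subgroup_S]
  subgroup.one_closed[OF subgroup_S]
lemmas C_closed = subgroup.m_closed[OF subgroup_C] subgroup.m_inv_closed[OF subgroup_C]
  subgroup.one_closed[OF subgroup_C]

lemma reduced_Nil [simp]: "reduced []"
  by (simp add: reduced_def)

lemma reduced_Cons [simp]:
  "reduced (p # xs) \<longleftrightarrow> snd p \<in> S (fst p) \<and> snd p \<notin> C \<and> reduced xs \<and> (xs = [] \<or> fst p \<noteq> fst (hd xs))"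
  by (auto simp: reduced_def successively_Cons)

lemma reduced_append:
  "reduced (xs @ ys) \<longleftrightarrow> reduced xs \<and> reduced ys \<and> (xs = [] \<or> ys = [] \<or> fst (last xs) \<noteq> fst (hd ys))"
  by (auto simp: reduced_def successively_append_iff)

lemma reduced_carrier: "reduced xs \<Longrightarrow> snd ` set xs \<subseteq> carrier G"
  by (auto simp: reduced_def intro: S_carrier)

lemma gprod_carrier [simp]: "reduced xs \<Longrightarrow> gprod xs \<in> carrier G"
  by (simp add: reduced_carrier)

lemma C_mult_notin:
  assumes "c \<in> C" "x \<in> S F" "x \<notin> C"
  shows "c \<otimes> x \<in> S F" "c \<otimes> x \<notin> C" "x \<otimes> c \<in> S F" "x \<otimes> c \<notin> C"
proof -
  show "c \<otimes> x \<in> S F" "x \<otimes> c \<in> S F" using assms C_S S_closed by auto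
  have c: "c \<in> carrier G" "x \<in> carrier G" using assms S_carrier C_carrier by auto
  have "inv c \<otimes> (c \<otimes> x) = x" "(x \<otimes> c) \<otimes> inv c = x" using c by (simp_all add: group_simps)
  moreover have "inv c \<otimes> (c \<otimes> x) \<in> C" if "c \<otimes> x \<in> C"
    using C_closed(1)[OF C_closed(2)[OF assms(1)] that] .
  moreover have "(x \<otimes> c) \<otimes> inv c \<in> C" if "x \<otimes> c \<in> C"
    using C_closed(1)[OF that C_closed(2)[OF assms(1)]] .
  ultimately show "c \<otimes> x \<notin> C" "x \<otimes> c \<notin> C" using assms(3) by auto
qed

lemma reduced_left:
  assumes "c \<in> C" "reduced xs" "xs \<noteq> []"
  obtains ys where "reduced ys" "map fst ys = map fst xs" "gprod ys = c \<otimes> gprod xs"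
proof -
  obtain F x xs' where xs: "xs = (F, x) # xs'" using assms(3) by (cases xs) auto
  then have "reduced ((F, c \<otimes> x) # xs')" using assms C_mult_notin by auto
  moreover have "gprod ((F, c \<otimes> x) # xs') = c \<otimes> gprod xs"
    using assms xs by (auto simp: m_assoc C_carrier S_carrier)
  ultimately show thesis using that[of "(F, c \<otimes> x) # xs'"] xs by simp
qed

lemma reduced_right:
  assumes "c \<in> C" "reduced xs" "xs \<noteq> []"
  obtains ys where "reduced ys" "map fst ys = map fst xs" "gprod ys = gprod xs \<otimes> c"
proof -
  obtain F x xs' where xs: "xs = xs' @ [(F, x)]" using assms(3) by (cases xs rule: rev_cases) auto
  have x: "x \<in> S F" "x \<notin> C" "reduced xs'" using assms(2) xs by (auto simp: reduced_append)
  have "reduced (xs' @ [(F, x \<otimes> c)])" using assms(2) xs C_mult_notin[OF assms(1) x(1,2)]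
    by (auto simp: reduced_append)
  moreover have "gprod (xs' @ [(F, x \<otimes> c)]) = gprod xs \<otimes> c"
    using assms(1) x xs by (simp add: gprod_append reduced_carrier m_assoc C_carrier S_carrier)
  ultimately show thesis using that[of "xs' @ [(F, x \<otimes> c)]"] xs by simp
qed

lemma tp_reduced:
  assumes "reduced xs" "c \<in> C" "d \<in> C" shows "tp (c \<otimes> gprod xs \<otimes> d) = map fst xs"
proof (cases "xs = []")
  case True
  then show ?thesis using assms tp_C C_closed C_carrier by simp
next
  case False
  obtain ys where ys: "reduced ys" "map fst ys = map fst xs" "gprod ys = c \<otimes> gprod xs"
    using reduced_left[OF assms(2,1) False] by blast
  then have "ys \<noteq> []" using False by auto
  obtain zs where zs: "reduced zs" "map fst zs = map fst ys" "gprod zs = gprod ys \<otimes> d"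
    using reduced_right[OF assms(3) ys(1) \<open>ys \<noteq> []\<close>] by blast
  then have "zs \<noteq> []" using \<open>ys \<noteq> []\<close> by auto
  with zs ys tp_gprod[of zs] show ?thesis by (simp add: reduced_def)
qed

lemma tp_gprod_reduced: "reduced xs \<Longrightarrow> tp (gprod xs) = map fst xs"
  using tp_reduced[of xs \<one> \<one>] C_closed by simp

lemma tp_S: "x \<in> S F \<Longrightarrow> tp x = (if x \<in> C then [] else [F])"
  using tp_C[of x] tp_gprod_reduced[of "[(F, x)]"] S_carrier by simp

lemma C_eq_Int: "F \<noteq> F' \<Longrightarrow> x \<in> S F \<Longrightarrow> x \<in> S F' \<Longrightarrow> x \<in> C"
  using tp_S[of x F] tp_S[of x F'] by (auto split: if_splits)

text \<open>For \<open>p = (g, w)\<close> this is the set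
  \<open>g\<^sup>-\<^sup>1 E w \<inter> C\<close> of the chain, written without the inverse.\<close>

definition Estep :: "'a set \<Rightarrow> 'a \<times> 'a \<Rightarrow> 'a set" where
  "Estep E p = {x \<in> C. \<exists>y\<in>E. fst p \<otimes> x = y \<otimes> snd p}"

text \<open>The element \<open>inv x \<otimes> (c \<otimes> y)\<close> lies in the factor
  \<open>S F\<close>. Were it outside C, it could be put in front of \<open>ys\<close> as a letter,
  and the two sides of the remaining equation would have types of different lengths.\<close>

lemma reduced_chain:
  assumes "reduced ((F, x) # xs)" "reduced ((F, y) # ys)" "map fst xs = map fst ys"
    and cd: "c \<in> C" "d \<in> C" and eq: "gprod ((F, x) # xs) \<otimes> d = c \<otimes> gprod ((F, y) # ys)"
  obtains z where "z \<in> C" "x \<otimes> z = c \<otimes> y" "gprod xs \<otimes> d = z \<otimes> gprod ys"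
proof -
  have x: "x \<in> S F" "y \<in> S F" "c \<in> S F" and red: "reduced xs" "reduced ys"
    using assms C_S by auto
  have car: "x \<in> carrier G" "y \<in> carrier G" "c \<in> carrier G" "d \<in> carrier G"
    using x cd S_carrier C_carrier by auto
  define z where "z = inv x \<otimes> (c \<otimes> y)"
  have z: "z \<in> S F" unfolding z_def using x S_closed by auto
  have xz: "x \<otimes> z = c \<otimes> y" unfolding z_def using car by (simp add: group_simps)
  have "gprod xs \<otimes> d = inv x \<otimes> (gprod ((F, x) # xs) \<otimes> d)"
    using car red by (simp add: group_simps)
  also have "\<dots> = z \<otimes> gprod ys" unfolding eq z_def using car red by (simp add: group_simps)
  finally have eq2: "gprod xs \<otimes> d = z \<otimes> gprod ys" .
  have "z \<in> C"
  proof (rule ccontr)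
    assume "z \<notin> C"
    then have "reduced ((F, z) # ys)" using assms(2) z by simp
    then have "tp (z \<otimes> gprod ys) = F # map fst ys" using tp_gprod_reduced[of "(F, z) # ys"] by simp
    moreover have "tp (gprod xs \<otimes> d) = map fst xs"
      using tp_reduced[OF red(1) _ cd(2), of \<one>] red C_closed by simp
    ultimately show False using eq2 assms(3) by simp
  qed
  then show thesis using that xz eq2 by blast
qed

text \<open>Two elements \<open>c\<close> and \<open>d\<close> are needed for the induction, in
  which the left one moves along the chain and the right one stays. Conjugation is the case
  \<open>c = d\<close>, \<open>E = C\<close>.\<close>

lemma mem_foldl_Estep:
  assumes "reduced gs" "reduced ws" "map fst gs = map fst ws" "c \<in> E" "E \<subseteq> C" "d \<in> C"
    and "gprod gs \<otimes> d = c \<otimes> gprod ws"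
  shows "d \<in> foldl Estep E (zip (map snd gs) (map snd ws))"
  using assms
proof (induction gs arbitrary: ws c E)
  case Nil
  then show ?case using C_carrier by auto
next
  case (Cons p gs)
  obtain F x where p: "p = (F, x)" by (cases p)
  obtain y ws' where ws: "ws = (F, y) # ws'" using Cons.prems(3) p by (cases ws) auto
  obtain z where z: "z \<in> C" "x \<otimes> z = c \<otimes> y" "gprod gs \<otimes> d = z \<otimes> gprod ws'"
    using reduced_chain[of F x gs y ws' c d] Cons.prems p ws by auto
  have "z \<in> Estep E (x, y)" using z Cons.prems(4) by (auto simp: Estep_def)
  moreover have "Estep E (x, y) \<subseteq> C" by (auto simp: Estep_def)
  ultimately show ?case
    using Cons.IH[of ws' z "Estep E (x, y)"] Cons.prems z p ws by simp
qed

lemma foldl_Estep_empty: "foldl Estep {} ps = {}"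
  by (induction ps) (auto simp: Estep_def)

lemma foldl_Estep_subset: "E \<subseteq> C \<Longrightarrow> foldl Estep E ps \<subseteq> C"
  by (induction ps rule: rev_induct) (auto simp: Estep_def)

lemma foldl_Estep_prefix: "d \<in> foldl Estep E (ps @ qs) \<Longrightarrow> foldl Estep E ps \<noteq> {}"
  using foldl_Estep_empty by fastforce

text \<open>Multiplying the defining equations of a chain that ends in \<open>d\<close> gives back
  an equation between the whole products, with the first element of the chain on the left.\<close>

lemma foldl_Estep_closes:
  assumes "d \<in> foldl Estep E (zip (map snd gs) (map snd ws))" "E \<subseteq> C"
    "length gs = length ws" "snd ` set gs \<subseteq> carrier G" "snd ` set ws \<subseteq> carrier G"
  shows "\<exists>c\<in>E. gprod gs \<otimes> d = c \<otimes> gprod ws"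
  using assms
proof (induction gs arbitrary: ws E)
  case Nil
  then have "d \<in> E" "d \<in> carrier G" using C_carrier by auto
  with Nil show ?case by (intro bexI[of _ d]) auto
next
  case (Cons p gs)
  obtain q ws' where ws: "ws = q # ws'" using Cons.prems(3) by (cases ws) auto
  let ?E = "Estep E (snd p, snd q)"
  have E: "?E \<subseteq> C" by (auto simp: Estep_def)
  have d: "d \<in> carrier G"
    using Cons.prems(1,2) foldl_Estep_subset C_carrier by blast
  obtain z where z: "z \<in> ?E" "gprod gs \<otimes> d = z \<otimes> gprod ws'"
    using Cons.IH[of ?E ws'] Cons.prems ws E by auto
  then obtain c where c: "c \<in> E" "snd p \<otimes> z = c \<otimes> snd q" by (auto simp: Estep_def)
  have car: "z \<in> carrier G" "c \<in> carrier G" using z c E Cons.prems(2) C_carrier by auto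
  have "gprod (p # gs) \<otimes> d = snd p \<otimes> (gprod gs \<otimes> d)"
    using Cons.prems d by (simp add: m_assoc)
  also have "\<dots> = (snd p \<otimes> z) \<otimes> gprod ws'" unfolding z(2) using Cons.prems ws car by (simp add: m_assoc)
  also have "\<dots> = c \<otimes> gprod ws" unfolding c(2) using Cons.prems ws car by (simp add: m_assoc)
  finally show ?case using c(1) by blast
qed

section \<open>Cyclically reduced sequences and their conjugates\<close>

definition cyc_reduced :: "(factor \<times> 'a) list \<Rightarrow> bool" where
  "cyc_reduced gs \<longleftrightarrow> reduced gs \<and> length gs \<ge> 2 \<and> fst (hd gs) \<noteq> fst (last gs)"

lemma cyc_reducedE:
  assumes "cyc_reduced gs"
  obtains F x ms F' y where "gs = (F, x) # ms @ [(F', y)]" "F \<noteq> F'"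
proof -
  obtain p gs' where gs: "gs = p # gs'" using assms by (cases gs) (auto simp: cyc_reduced_def)
  then have "gs' \<noteq> []" using assms by (auto simp: cyc_reduced_def)
  then obtain ms q where "gs' = ms @ [q]" by (metis rev_exhaust)
  then show thesis using that[of "fst p" "snd p" ms "fst q" "snd q"] assms gs by (simp add: cyc_reduced_def)
qed

lemma cyc_reduced_iff:
  "cyc_reduced ((F, x) # ms @ [(F', y)]) \<longleftrightarrow> reduced ((F, x) # ms @ [(F', y)]) \<and> F \<noteq> F'"
  by (auto simp: cyc_reduced_def)

lemma inv_seq_Nil_iff [simp]: "inv_seq xs = [] \<longleftrightarrow> xs = []"
  by (simp add: inv_seq_def)

lemma inv_seq_ends:
  assumes "xs \<noteq> []"
  shows "fst (hd (inv_seq xs)) = fst (last xs)" "fst (last (inv_seq xs)) = fst (hd xs)"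
  using assms by (simp_all add: inv_seq_def hd_rev last_rev last_map hd_map)

lemma reduced_inv_seq: assumes "reduced xs" shows "reduced (inv_seq xs)"
proof -
  have "inv x \<in> S F \<and> inv x \<notin> C" if "x \<in> S F" "x \<notin> C" for x F
    using that S_closed C_closed S_carrier by (metis inv_inv)
  moreover have "successively (\<lambda>p q. fst p \<noteq> fst q) (inv_seq xs)"
    using assms unfolding inv_seq_def reduced_def
    by (auto simp: successively_map elim: successively_mono)
  ultimately show ?thesis using assms by (auto simp: reduced_def inv_seq_def)
qed

text \<open>The conjugator is used up letter by letter. Its first letter lies in the factor of the
  first or of the last letter of \<open>gs\<close> and merges with it. If the merged element lies in
  C, the conjugation has only rotated \<open>gs\<close> by one place and the induction continues;
  otherwise nothing cancels any more, and the conjugate is a reduced product that begins and ends in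
  the same factor.\<close>

lemma conj_cyc_reduced:
  assumes "cyc_reduced gs" "reduced ks" "c \<in> C" and k: "k = c \<otimes> gprod ks"
    and v: "v = inv k \<otimes> gprod gs \<otimes> k"
  shows "(\<exists>j. \<exists>d\<in>C. v = inv d \<otimes> gprod (rotate j gs) \<otimes> d) \<or>
    length (tp v) \<ge> 3 \<and> hd (tp v) = last (tp v)"
  using assms
proof (induction ks arbitrary: gs c k)
  case Nil
  then show ?case using C_carrier by (intro disjI1 exI[of _ 0] bexI[of _ c]) auto
next
  case (Cons p ks)
  obtain F x where p: "p = (F, x)" by (cases p)
  obtain F1 g1 ms Fn gn where gs: "gs = (F1, g1) # ms @ [(Fn, gn)]" "F1 \<noteq> Fn"
    using Cons.prems(1) by (rule cyc_reducedE)
  have red: "reduced ((F1, g1) # ms @ [(Fn, gn)])"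
    using Cons.prems(1) gs cyc_reduced_iff by simp
  have red': "reduced ms" "reduced ks" using red Cons.prems(2) by (auto simp: reduced_append)
  define k1 where "k1 = c \<otimes> x"
  have x: "x \<in> S F" "x \<notin> C" using Cons.prems(2) p by auto
  have k1: "k1 \<in> S F" "k1 \<notin> C" unfolding k1_def using C_mult_notin[OF Cons.prems(3) x] by auto
  have g: "g1 \<in> S F1" "g1 \<notin> C" "gn \<in> S Fn" "gn \<notin> C" using red by (auto simp: reduced_append)
  have car: "k1 \<in> carrier G" "g1 \<in> carrier G" "gn \<in> carrier G" "x \<in> carrier G" "c \<in> carrier G"
    using k1 g x Cons.prems(3) S_carrier C_carrier by auto
  note car' = reduced_carrier[OF red'(1)] reduced_carrier[OF red'(2)]
  have k: "k = k1 \<otimes> gprod ks" using Cons.prems(4) p car car' by (simp add: k1_def m_assoc)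
  have pg: "gprod gs = g1 \<otimes> (gprod ms \<otimes> gn)" using gs car car' by (simp add: gprod_append)
  have vk: "v = inv (gprod ks) \<otimes> (inv k1 \<otimes> (g1 \<otimes> (gprod ms \<otimes> (gn \<otimes> (k1 \<otimes> gprod ks)))))"
    unfolding Cons.prems(5) k pg using car car' by (simp add: group_simps)
  have rks: "ks = [] \<or> F \<noteq> fst (hd ks)" using Cons.prems(2) p by simp
  show ?case
  proof (cases "F = F1")
    case True
    define z where "z = inv k1 \<otimes> g1"
    have z: "z \<in> S F" unfolding z_def using k1 g True S_closed by auto
    then have zc: "z \<in> carrier G" by (rule S_carrier)
    show ?thesis
    proof (cases "z \<in> C")
      case zC: True
      \<comment> \<open>Up to an element of C the letter \<open>k1\<close> equals \<open>g1\<close>,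
        and conjugation by \<open>g1\<close> moves the first letter of \<open>gs\<close> to the
        end.\<close>
      have k': "k = g1 \<otimes> (inv z \<otimes> gprod ks)" unfolding k z_def using car car' by (simp add: group_simps)
      let ?gs = "ms @ [(Fn, gn), (F1, g1)]"
      have rot: "?gs = rotate 1 gs" using gs by simp
      have "cyc_reduced ?gs"
        using red gs by (cases ms) (auto simp: cyc_reduced_def reduced_append hd_append)
      moreover have "v = inv (inv z \<otimes> gprod ks) \<otimes> gprod ?gs \<otimes> (inv z \<otimes> gprod ks)"
        unfolding Cons.prems(5) k' pg using car car' zc by (simp add: group_simps gprod_append)
      ultimately show ?thesis
        using Cons.IH[of ?gs "inv z" "inv z \<otimes> gprod ks"] red' C_closed(2)[OF zC]
        unfolding rot rotate_rotate by blast
    next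
      case zC: False
      \<comment> \<open>Here \<open>inv k1\<close> and \<open>g1\<close> have merged into one letter
        \<open>z\<close>. Both ends have the same factor: those of \<open>ks\<close> and its inverse
        match, and if \<open>ks\<close> is empty both ends lie in \<open>F\<close>.\<close>
      let ?L = "inv_seq ks @ (F, z) # ms @ [(Fn, gn), (F, k1)] @ ks"
      have "reduced ?L" using red red' zC z k1 True rks gs(2) reduced_inv_seq[OF red'(2)]
        by (auto simp: reduced_append inv_seq_ends hd_append split: if_splits)
      moreover have "gprod ?L = gprod (inv_seq ks) \<otimes> gprod ((F, z) # ms @ [(Fn, gn), (F, k1)] @ ks)"
        by (intro gprod_append inv_seq_closed) (use car car' zc in auto)
      then have "gprod ?L = v" unfolding vk z_def using car car'
        by (simp add: gprod_append gprod_inv_seq group_simps)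
      ultimately have tp: "tp v = map fst ?L" using tp_gprod_reduced by metis
      have "hd (tp v) = last (tp v)" unfolding tp
        by (cases "ks = []") (auto simp: hd_append last_map inv_seq_ends hd_map)
      then show ?thesis unfolding tp by auto
    qed
  next
    case False
    \<comment> \<open>There are only two factors, so the letter lies in that of the last letter of
      \<open>gs\<close>.\<close>
    then have Fn: "F = Fn" using gs(2) by (cases F; cases F1; cases Fn) auto
    define z where "z = gn \<otimes> k1"
    have z: "z \<in> S F" unfolding z_def using k1 g Fn S_closed by auto
    then have zc: "z \<in> carrier G" by (rule S_carrier)
    show ?thesis
    proof (cases "z \<in> C")
      case zC: True
      have k': "k = inv gn \<otimes> (z \<otimes> gprod ks)" unfolding k z_def using car car' by (simp add: group_simps)
      let ?gs = "(Fn, gn) # (F1, g1) # ms"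
      \<comment> \<open>Now the last letter moves to the front; this backward rotation is expressed
        as a forward one by the length minus 1.\<close>
      have rot: "?gs = rotate (length gs - 1) gs"
      proof -
        have "rotate (length (butlast gs)) (butlast gs @ [last gs]) = [last gs] @ butlast gs"
          by (rule rotate_append)
        then show ?thesis using gs by (simp add: butlast_append)
      qed
      have "cyc_reduced ?gs"
        using red gs by (cases ms rule: rev_cases) (auto simp: cyc_reduced_def reduced_append hd_append)
      moreover have "v = inv (z \<otimes> gprod ks) \<otimes> gprod ?gs \<otimes> (z \<otimes> gprod ks)"
        unfolding Cons.prems(5) k' pg using car car' zc by (simp add: group_simps gprod_append)
      ultimately show ?thesis
        using Cons.IH[of ?gs z "z \<otimes> gprod ks"] red' zC
        unfolding rot rotate_rotate by blast
    next
      case zC: False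
      let ?L = "inv_seq ks @ (F, inv k1) # (F1, g1) # ms @ [(F, z)] @ ks"
      have "inv k1 \<in> S F" "inv k1 \<notin> C" using k1 S_closed C_closed car by (metis inv_inv)+
      then have "reduced ?L" using red red' zC z k1 Fn rks gs(2) reduced_inv_seq[OF red'(2)]
        by (auto simp: reduced_append inv_seq_ends hd_append split: if_splits)
      moreover have "gprod ?L = gprod (inv_seq ks) \<otimes> gprod ((F, inv k1) # (F1, g1) # ms @ [(F, z)] @ ks)"
        by (intro gprod_append inv_seq_closed) (use car car' zc in auto)
      then have "gprod ?L = v" unfolding vk z_def using car car'
        by (simp add: gprod_append gprod_inv_seq group_simps)
      ultimately have tp: "tp v = map fst ?L" using tp_gprod_reduced by metis
      have "hd (tp v) = last (tp v)" unfolding tp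
        by (cases "ks = []") (auto simp: hd_append last_map inv_seq_ends hd_map)
      then show ?thesis unfolding tp by auto
    qed
  qed
qed

lemma reduced_form_mult:
  assumes x: "x \<in> S F" and "c \<in> C" "reduced xs"
  shows "\<exists>d\<in>C. \<exists>ys. reduced ys \<and> x \<otimes> (c \<otimes> gprod xs) = d \<otimes> gprod ys"
proof -
  define y where "y = x \<otimes> c"
  have y: "y \<in> S F" unfolding y_def using assms C_S S_closed by auto
  have car: "x \<in> carrier G" "c \<in> carrier G" "y \<in> carrier G"
    using assms y S_carrier C_carrier by auto
  have eq: "x \<otimes> (c \<otimes> gprod xs) = y \<otimes> gprod xs" using assms(3) car by (simp add: y_def m_assoc)
  show ?thesis
  proof (cases "y \<in> C")
    case True
    then show ?thesis using eq assms(3) by blast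
  next
    case yC: False
    show ?thesis
    proof (cases "xs = [] \<or> F \<noteq> fst (hd xs)")
      case True
      then have "reduced ((F, y) # xs)" using y yC assms(3) by simp
      moreover have "y \<otimes> gprod xs = \<one> \<otimes> gprod ((F, y) # xs)" using car assms(3) by simp
      ultimately show ?thesis using eq C_closed(3) by metis
    next
      case False
      then obtain z zs where xs: "xs = (F, z) # zs" by (cases xs) auto
      have z: "z \<in> S F" "reduced zs" using assms(3) xs by auto
      have eq': "y \<otimes> gprod xs = (y \<otimes> z) \<otimes> gprod zs"
        using xs z car S_carrier[OF z(1)] by (simp add: m_assoc)
      have yz: "y \<otimes> z \<in> S F" using y z S_closed by auto
      show ?thesis
      proof (cases "y \<otimes> z \<in> C")
        case True
        then show ?thesis using eq eq' z by metis
      next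
        case False
        then have "reduced ((F, y \<otimes> z) # zs)" using yz assms(3) xs by simp
        moreover have "(y \<otimes> z) \<otimes> gprod zs = \<one> \<otimes> gprod ((F, y \<otimes> z) # zs)"
          using S_carrier[OF yz] z by simp
        ultimately show ?thesis using eq eq' C_closed(3) by metis
      qed
    qed
  qed
qed

lemma ex_reduced_form:
  assumes "g \<in> carrier G"
  shows "\<exists>c\<in>C. \<exists>xs. reduced xs \<and> g = c \<otimes> gprod xs"
proof -
  define Q where "Q = {g. \<exists>c\<in>C. \<exists>xs. reduced xs \<and> g = c \<otimes> gprod xs}"
  have Q_carrier: "Q \<subseteq> carrier G" unfolding Q_def using C_carrier by auto
  have mult: "x \<otimes> g \<in> Q" if "x \<in> S F" "g \<in> Q" for x F g
    using that reduced_form_mult unfolding Q_def by blast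
  have sub: "(\<Union>F. S F) \<subseteq> carrier G" using S_carrier by auto
  \<comment> \<open>Stating that left multiplication by \<open>h\<close> preserves \<open>Q\<close>,
    rather than that \<open>h\<close> lies in \<open>Q\<close>, makes the case of a product
    immediate.\<close>
  have "\<forall>x\<in>Q. h \<otimes> x \<in> Q" if "h \<in> generate G (\<Union>F. S F)" for h
    using that
  proof (induction rule: generate.induct)
    case one
    then show ?case using Q_carrier by auto
  next
    case (incl h)
    then show ?case using mult by auto
  next
    case (inv h)
    then show ?case using mult[OF S_closed(2)] by blast
  next
    case (eng h1 h2)
    then have "h1 \<in> carrier G" "h2 \<in> carrier G" using generate_in_carrier[OF sub] by auto
    then show ?case using eng Q_carrier by (auto simp: m_assoc)
  qed
  moreover have "\<one> \<otimes> gprod ([] :: (factor \<times> 'a) list) \<in> Q"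
    unfolding Q_def using C_closed(3) reduced_Nil by blast
  moreover have "\<one> \<otimes> gprod ([] :: (factor \<times> 'a) list) = \<one>" by simp
  ultimately have "g \<otimes> \<one> \<in> Q" using assms generated by metis
  then show ?thesis using assms by (simp add: Q_def)
qed

text \<open>If both end letters \<open>x\<close> and \<open>y\<close> lie in one factor, conjugation
  by \<open>x\<close> replaces them by the single letter \<open>y \<otimes> x\<close> at the end, or
  by nothing if that lies in C and is absorbed, so the length drops. Conjugacy is written as an
  equation without inverses.\<close>

lemma reduced_cyc_form:
  assumes "reduced xs"
  shows "(\<exists>k\<in>carrier G. \<exists>F. \<exists>x\<in>S F. gprod xs \<otimes> k = k \<otimes> x) \<or>
    (\<exists>k\<in>carrier G. \<exists>gs. cyc_reduced gs \<and> gprod xs \<otimes> k = k \<otimes> gprod gs)"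
  using assms
proof (induction xs rule: length_induct)
  case (1 xs)
  have red: "reduced xs" by fact
  have triv: ?case if "gprod xs \<in> S F" for F
    using that S_carrier[OF that] by (intro disjI1 bexI[of _ \<one>] exI[of _ F] bexI[of _ "gprod xs"]) auto
  consider "xs = []" | p where "xs = [p]" | "length xs \<ge> 2"
    by (cases xs rule: remdups_adj.cases) auto
  then show ?case
  proof cases
    case 1
    then show ?thesis using S_closed(3) triv by simp
  next
    case (2 p)
    then show ?thesis using red triv[of "fst p"] S_carrier by auto
  next
    case 3
    show ?thesis
    proof (cases "fst (hd xs) = fst (last xs)")
      case False
      then have "cyc_reduced xs" using red 3 by (simp add: cyc_reduced_def)
      then show ?thesis using red by (intro disjI2 bexI[of _ \<one>] exI[of _ xs]) auto
    next
      case True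
      obtain p xs' where "xs = p # xs'" using 3 by (cases xs) auto
      moreover from this have "xs' \<noteq> []" using 3 by auto
      moreover from this obtain ms q where "xs' = ms @ [q]" by (metis rev_exhaust)
      ultimately obtain F x y where xs: "xs = (F, x) # ms @ [(F, y)]"
        using True by (metis last_ConsR last_snoc list.sel(1) surjective_pairing)
      have x: "x \<in> S F" "y \<in> S F" and ms: "reduced ms" "ms \<noteq> []" "fst (last ms) \<noteq> F"
        using red xs by (auto simp: reduced_append)
      have car: "x \<in> carrier G" "y \<in> carrier G" using x S_carrier by auto
      have yx: "y \<otimes> x \<in> S F" using x S_closed by auto
      obtain ys where ys: "reduced ys" "length ys < length xs" "gprod ys = gprod ms \<otimes> (y \<otimes> x)"
      proof (cases "y \<otimes> x \<in> C")
        case True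
        obtain ys where "reduced ys" "map fst ys = map fst ms" "gprod ys = gprod ms \<otimes> (y \<otimes> x)"
          using reduced_right[OF True ms(1,2)] by blast
        moreover from this have "length ys = length ms" by (metis length_map)
        ultimately show thesis using that[of ys] xs by simp
      next
        case False
        then have "reduced (ms @ [(F, y \<otimes> x)])" using ms yx by (auto simp: reduced_append)
        then show thesis using that[of "ms @ [(F, y \<otimes> x)]"] xs ms car
          by (simp add: gprod_append reduced_carrier)
      qed
      have conj: "gprod xs \<otimes> (x \<otimes> k) = (x \<otimes> k) \<otimes> t"
        if "gprod ys \<otimes> k = k \<otimes> t" "k \<in> carrier G" "t \<in> carrier G" for k t
      proof -
        have "gprod xs \<otimes> (x \<otimes> k) = x \<otimes> (gprod ys \<otimes> k)"
          using xs ys ms car that(2) by (simp add: gprod_append reduced_carrier m_assoc)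
        then show ?thesis using that car by (simp add: m_assoc)
      qed
      from "1.IH" ys(1,2) have "(\<exists>k\<in>carrier G. \<exists>F. \<exists>x\<in>S F. gprod ys \<otimes> k = k \<otimes> x) \<or>
        (\<exists>k\<in>carrier G. \<exists>gs. cyc_reduced gs \<and> gprod ys \<otimes> k = k \<otimes> gprod gs)" by blast
      then show ?thesis
      proof
        assume "\<exists>k\<in>carrier G. \<exists>F. \<exists>x\<in>S F. gprod ys \<otimes> k = k \<otimes> x"
        then obtain k F' t where "k \<in> carrier G" "t \<in> S F'" "gprod ys \<otimes> k = k \<otimes> t" by blast
        then show ?thesis using conj[of k t] S_carrier car by (metis m_closed)
      next
        assume "\<exists>k\<in>carrier G. \<exists>gs. cyc_reduced gs \<and> gprod ys \<otimes> k = k \<otimes> gprod gs"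
        then obtain k gs where k: "k \<in> carrier G" "cyc_reduced gs" "gprod ys \<otimes> k = k \<otimes> gprod gs" by blast
        then have "gprod gs \<in> carrier G" by (simp add: cyc_reduced_def)
        then show ?thesis using conj[of k "gprod gs"] k car by (metis m_closed)
      qed
    qed
  qed
qed

lemma ex_cyc_form:
  assumes "g \<in> carrier G"
  shows "(\<exists>k\<in>carrier G. \<exists>F. \<exists>x\<in>S F. g \<otimes> k = k \<otimes> x) \<or>
    (\<exists>k\<in>carrier G. \<exists>gs. cyc_reduced gs \<and> g \<otimes> k = k \<otimes> gprod gs)"
proof -
  obtain c xs where c: "c \<in> C" "reduced xs" "g = c \<otimes> gprod xs" using ex_reduced_form[OF assms] by blast
  show ?thesis
  proof (cases "xs = []")
    case True
    then have "g \<in> S F" for F using c C_S C_carrier by auto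
    then show ?thesis using assms
      by (intro disjI1 bexI[of _ \<one>] exI[of _ FactorA] bexI[of _ g]) auto
  next
    case False
    then obtain ys where "reduced ys" "gprod ys = g" using reduced_left[OF c(1,2)] c(3) by metis
    then show ?thesis using reduced_cyc_form by metis
  qed
qed

lemma cyc_reduced_rotate: "cyc_reduced gs \<Longrightarrow> cyc_reduced (rotate j gs)"
proof (induction j)
  case (Suc j)
  then obtain F x ms F' y where gs: "rotate j gs = (F, x) # ms @ [(F', y)]" "F \<noteq> F'"
    using cyc_reducedE by metis
  have "cyc_reduced (ms @ [(F', y), (F, x)])" using Suc gs
    by (cases ms) (auto simp: cyc_reduced_def reduced_append hd_append)
  then show ?case using gs by simp
qed simp

lemma cyc_reduced_reduced: "cyc_reduced gs \<Longrightarrow> reduced gs"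
  by (simp add: cyc_reduced_def)

lemma tp_conj_rotate:
  assumes "cyc_reduced gs" "d \<in> C"
  shows "tp (inv d \<otimes> gprod (rotate j gs) \<otimes> d) = map fst (rotate j gs)"
  using tp_reduced[OF cyc_reduced_reduced[OF cyc_reduced_rotate[OF assms(1)]] C_closed(2)[OF assms(2)] assms(2)] .

lemma conj_eqI: "g \<in> carrier G \<Longrightarrow> k \<in> carrier G \<Longrightarrow> v \<in> carrier G \<Longrightarrow> g \<otimes> k = k \<otimes> v \<Longrightarrow> v = inv k \<otimes> g \<otimes> k"
  by (simp add: m_assoc cancel_inv_left)

text \<open>Both alternatives of \<open>conj_cyc_reduced\<close> give a type of length at least 2,
  whereas elements of a factor have type of length at most 1.\<close>

lemma cyc_reduced_not_conj_factor:
  assumes "cyc_reduced gs" "x \<in> S F" "k \<in> carrier G" "gprod gs \<otimes> k = k \<otimes> x"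
  shows False
proof -
  obtain c ks where k: "c \<in> C" "reduced ks" "k = c \<otimes> gprod ks" using ex_reduced_form[OF assms(3)] by blast
  have "x = inv k \<otimes> gprod gs \<otimes> k"
    using assms cyc_reduced_reduced S_carrier by (intro conj_eqI) auto
  from conj_cyc_reduced[OF assms(1) k(2,1,3) this]
  have "length (tp x) \<ge> 2"
    using tp_conj_rotate[OF assms(1)] assms(1) by (auto simp: cyc_reduced_def)
  then show False using tp_S[OF assms(2)] by (auto split: if_splits)
qed

text \<open>The second alternative of \<open>conj_cyc_reduced\<close> is ruled out because
  \<open>gs\<close> begins and ends in different factors. It is the conjugated sequence
  \<open>vs\<close> that gets rotated; \<open>gs\<close> stays fixed.\<close>

lemma conj_cyc_reduced_rotate:
  assumes "cyc_reduced gs" "cyc_reduced vs" "k \<in> carrier G" "gprod vs \<otimes> k = k \<otimes> gprod gs"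
  obtains j c where "j < length vs" "c \<in> C" "map fst gs = map fst (rotate j vs)"
    "gprod gs \<otimes> c = c \<otimes> gprod (rotate j vs)"
proof -
  obtain c ks where k: "c \<in> C" "reduced ks" "k = c \<otimes> gprod ks" using ex_reduced_form[OF assms(3)] by blast
  have red: "reduced gs" "reduced vs" using assms cyc_reduced_reduced by auto
  have eq: "gprod gs = inv k \<otimes> gprod vs \<otimes> k"
    using assms red by (intro conj_eqI) auto
  have tp: "tp (gprod gs) = map fst gs" by (rule tp_gprod_reduced[OF red(1)])
  have "gs \<noteq> []" using assms(1) by (auto simp: cyc_reduced_def)
  then have "hd (tp (gprod gs)) \<noteq> last (tp (gprod gs))"
    using assms(1) unfolding tp by (simp add: cyc_reduced_def hd_map last_map)
  with conj_cyc_reduced[OF assms(2) k(2,1,3) eq] obtain j d where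
    j: "d \<in> C" "gprod gs = inv d \<otimes> gprod (rotate j vs) \<otimes> d" by blast
  have "reduced (rotate j vs)" using cyc_reduced_reduced[OF cyc_reduced_rotate[OF assms(2)]] .
  moreover have "d \<in> carrier G" using j(1) by (rule C_carrier)
  ultimately have "gprod gs \<otimes> inv d = inv d \<otimes> gprod (rotate j vs)"
    unfolding j(2) by (simp add: group_simps)
  moreover have "map fst gs = map fst (rotate j vs)" using tp tp_conj_rotate[OF assms(2) j(1), of j] j(2) by simp
  moreover have "rotate j vs = rotate (j mod length vs) vs" by (rule rotate_conv_mod)
  moreover have "j mod length vs < length vs" using assms(2) by (intro mod_less_divisor) (auto simp: cyc_reduced_def)
  ultimately show thesis using that[of "j mod length vs" "inv d"] C_closed(2)[OF j(1)] by simp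
qed

text \<open>From \<open>g d = c w\<close> and \<open>g e = b w\<close> it follows that
  \<open>d e\<^sup>-\<^sup>1\<close> is the conjugate of \<open>c b\<^sup>-\<^sup>1\<close> by
  \<open>g\<close>. It therefore lies in C and in its conjugate by \<open>g\<close>, whose
  intersection is trivial.\<close>

lemma foldl_Estep_unique:
  assumes "gprod gs \<notin> Nstar G C" "reduced gs" "reduced ws" "length gs = length ws"
    and "d \<in> foldl Estep C (zip (map snd gs) (map snd ws))"
    and "e \<in> foldl Estep C (zip (map snd gs) (map snd ws))"
  shows "d = e"
proof -
  let ?g = "gprod gs" and ?w = "gprod ws"
  obtain c where c: "c \<in> C" "?g \<otimes> d = c \<otimes> ?w"
    using foldl_Estep_closes[OF assms(5)] assms reduced_carrier by blast
  obtain b where b: "b \<in> C" "?g \<otimes> e = b \<otimes> ?w"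
    using foldl_Estep_closes[OF assms(6)] assms reduced_carrier by blast
  have de: "d \<in> C" "e \<in> C" using assms(5,6) foldl_Estep_subset by blast+
  have car: "?g \<in> carrier G" "?w \<in> carrier G" "c \<in> carrier G" "b \<in> carrier G"
    "d \<in> carrier G" "e \<in> carrier G"
    using assms b c de C_carrier by auto
  have "d = inv ?g \<otimes> (c \<otimes> ?w)" "e = inv ?g \<otimes> (b \<otimes> ?w)"
    using car unfolding c(2)[symmetric] b(2)[symmetric] by (simp_all add: cancel_inv_left)
  then have "d \<otimes> inv e = conj_by G (c \<otimes> inv b) ?g"
    using car by (simp add: conj_by_def group_simps)
  then have "d \<otimes> inv e \<in> C \<inter> conj_set G C ?g"
    using de c b C_closed unfolding conj_set_def by blast
  then have "d \<otimes> inv e = \<one>" using assms(1) car(1) by (auto simp: Nstar_def)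
  then show ?thesis using car by (metis inv_closed inv_equality inv_inv)
qed

section \<open>From untagged reduced forms to tagged ones\<close>

lemma different_factors_iff:
  assumes "x \<in> S F" "x \<notin> C" "y \<in> S F'" "y \<notin> C"
  shows "different_factors (S FactorA) (S FactorB) x y \<longleftrightarrow> F \<noteq> F'"
proof -
  have "z \<in> S F2 \<longleftrightarrow> F2 = F1" if "z \<in> S F1" "z \<notin> C" for z F1 F2
    using C_eq_Int[of F1 F2 z] that by auto
  from this[OF assms(1,2)] this[OF assms(3,4)] show ?thesis
    by (cases F; cases F') (auto simp: different_factors_def)
qed

lemma reduced_tags:
  assumes "set gs \<subseteq> (S FactorA \<union> S FactorB) - C"
    "successively (different_factors (S FactorA) (S FactorB)) gs"
  shows "\<exists>ts. reduced ts \<and> map snd ts = gs"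
  using assms
proof (induction gs)
  case (Cons x gs)
  then obtain ts where ts: "reduced ts" "map snd ts = gs" by (auto simp: successively_Cons)
  obtain F where x: "x \<in> S F" "x \<notin> C" using Cons.prems by auto
  have "ts = [] \<or> F \<noteq> fst (hd ts)"
  proof (cases ts)
    case (Cons t ts')
    then have "snd t \<in> S (fst t)" "snd t \<notin> C" "different_factors (S FactorA) (S FactorB) x (snd t)"
      using ts Cons.prems by auto
    then show ?thesis using different_factors_iff[OF x] Cons by auto
  qed simp
  then have "reduced ((F, x) # ts)" using ts x by simp
  then show ?case using ts by (intro exI[of _ "(F, x) # ts"]) simp
qed (use reduced_Nil in blast)

lemma gprod_eq_foldr: "gprod ts = foldr (\<otimes>) (map snd ts) \<one>"
  by (simp add: gprod_def foldr_map comp_def)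

lemma reduced_form_tags:
  assumes "reduced_form G (S FactorA) (S FactorB) C c gs g"
  obtains ts where "reduced ts" "map snd ts = gs" "g = c \<otimes> gprod ts" "c \<in> C" "map fst ts = tp g"
proof -
  obtain ts where ts: "reduced ts" "map snd ts = gs"
    using reduced_tags assms unfolding reduced_form_def by blast
  moreover have g: "g = c \<otimes> gprod ts" "c \<in> C"
    using assms unfolding reduced_form_def gprod_eq_foldr ts(2) by blast+
  moreover have "tp g = map fst ts"
    using tp_reduced[OF ts(1) g(2) C_closed(3)] ts C_carrier[OF g(2)] g(1) by simp
  ultimately show thesis using that by metis
qed

lemma cyclically_reduced_tags:
  assumes "cyclically_reduced G (S FactorA) (S FactorB) C g"
    and "form_length G (S FactorA) (S FactorB) C g > 1"
  obtains gs where "cyc_reduced gs" "gprod gs = g"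
proof -
  obtain c xs where xs: "reduced_form G (S FactorA) (S FactorB) C c xs g"
    "length xs = 0 \<or> length xs = 1 \<or> different_factors (S FactorA) (S FactorB) (hd xs) (last xs)"
    using assms(1) unfolding cyclically_reduced_def by blast
  obtain ts where ts: "reduced ts" "map snd ts = xs" "g = c \<otimes> gprod ts" "c \<in> C" "map fst ts = tp g"
    using reduced_form_tags[OF xs(1)] .
  \<comment> \<open>\<open>form_length\<close> is a definite description, so it has a usable value
    only once all reduced forms are known to have the length of the type.\<close>
  have "length ys = length (tp g)" if rf: "reduced_form G (S FactorA) (S FactorB) C d ys g" for d ys
    using reduced_form_tags[OF rf] by (metis length_map)
  then have "form_length G (S FactorA) (S FactorB) C g = length (tp g)"
    unfolding form_length_def using xs(1) by (intro the_equality) metis+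
  then have len: "length ts > 1" using assms(2) ts(5) by (metis length_map)
  have lx: "length xs = length ts" using ts(2) by auto
  have df: "different_factors (S FactorA) (S FactorB) (hd xs) (last xs)" using xs(2) lx len by auto
  have ne: "ts \<noteq> []" using len by auto
  have "hd ts \<in> set ts" "last ts \<in> set ts" using ne by auto
  then have m: "snd (hd ts) \<in> S (fst (hd ts))" "snd (hd ts) \<notin> C"
    "snd (last ts) \<in> S (fst (last ts))" "snd (last ts) \<notin> C" using ts(1) unfolding reduced_def by blast+
  have "hd xs = snd (hd ts)" "last xs = snd (last ts)" using ts(2) ne by (auto simp: hd_map last_map)
  with df have ends: "fst (hd ts) \<noteq> fst (last ts)"
    using different_factors_iff[OF m] by simp
  obtain ys where ys: "reduced ys" "map fst ys = map fst ts" "gprod ys = g"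
    using reduced_left[OF ts(4,1) ne] ts(3) by metis
  have "length ys = length ts" "ys \<noteq> []" using ys(2) ne by (metis length_map, auto)
  moreover have "fst (hd ys) = fst (hd ts)" "fst (last ys) = fst (last ts)"
    using ys(2) ne \<open>ys \<noteq> []\<close> by (metis hd_map, metis last_map)
  ultimately have "cyc_reduced ys" using ys ends len by (simp add: cyc_reduced_def)
  then show thesis using that ys by blast
qed

end

section \<open>The action on normal forms\<close>

text \<open>The setting of van der Waerden's method: both factors act on the set of normal forms and
  agree on the common subgroup, so that words of the amalgam act too; applying a word to a base
  point yields an invariant of the element it represents.\<close>

locale amalgam_data =
  fixes H :: "factor \<Rightarrow> 'a monoid" and K :: "('c, 'm) monoid_scheme" and f :: "factor \<Rightarrow> 'c \<Rightarrow> 'a"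
  assumes group_H: "group (H F)" and group_K: "group K"
    and f_hom: "f F \<in> hom K (H F)" and f_inj: "inj_on (f F) (carrier K)"
begin

abbreviation im :: "factor \<Rightarrow> 'a set" where "im F \<equiv> f F ` carrier K"

lemma group_hom_f: "group_hom K (H F) (f F)"
  using group_H group_K f_hom by (simp add: group_hom_def group_hom_axioms_def)

lemma f_closed: "c \<in> carrier K \<Longrightarrow> f F c \<in> carrier (H F)"
  using group_hom.hom_closed[OF group_hom_f] .

lemma f_mult: "c \<in> carrier K \<Longrightarrow> d \<in> carrier K \<Longrightarrow> f F (c \<otimes>\<^bsub>K\<^esub> d) = f F c \<otimes>\<^bsub>H F\<^esub> f F d"
  using group_hom.hom_mult[OF group_hom_f] .

lemma f_one: "f F \<one>\<^bsub>K\<^esub> = \<one>\<^bsub>H F\<^esub>"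
  using group_hom.hom_one[OF group_hom_f] .

lemma f_inv: "c \<in> carrier K \<Longrightarrow> f F (inv\<^bsub>K\<^esub> c) = inv\<^bsub>H F\<^esub> f F c"
  using group_hom.hom_inv[OF group_hom_f] .

lemma subgroup_im: "subgroup (im F) (H F)"
  using group_hom.img_is_subgroup[OF group_hom_f] .

definition finv :: "factor \<Rightarrow> 'a \<Rightarrow> 'c" where
  "finv F = inv_into (carrier K) (f F)"

lemma finv_f [simp]: "c \<in> carrier K \<Longrightarrow> finv F (f F c) = c"
  unfolding finv_def by (rule inv_into_f_f[OF f_inj])

lemma f_finv: "x \<in> im F \<Longrightarrow> f F (finv F x) = x" "x \<in> im F \<Longrightarrow> finv F x \<in> carrier K"
  unfolding finv_def by (auto simp: f_inv_into_f inv_into_into)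

text \<open>An arbitrary choice that depends only on the right coset. It serves the normal form
  theorem and makes no claim of computability. The coset \<open>im F\<close> is treated separately
  by \<open>push\<close>, so its representative need not be the identity.\<close>

definition rep :: "factor \<Rightarrow> 'a \<Rightarrow> 'a" where
  "rep F x = (SOME y. y \<in> im F #>\<^bsub>H F\<^esub> x)"

definition cof :: "factor \<Rightarrow> 'a \<Rightarrow> 'c" where
  "cof F x = finv F (x \<otimes>\<^bsub>H F\<^esub> inv\<^bsub>H F\<^esub> rep F x)"

lemma rep_mem: assumes "x \<in> carrier (H F)" shows "rep F x \<in> im F #>\<^bsub>H F\<^esub> x"
proof -
  interpret group "H F" by (rule group_H)
  show ?thesis unfolding rep_def using rcos_self[OF assms subgroup_im] by (rule someI)
qed

lemma rep_cof:
  assumes "x \<in> carrier (H F)"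
  shows "rep F x \<in> carrier (H F)" "cof F x \<in> carrier K" "f F (cof F x) \<otimes>\<^bsub>H F\<^esub> rep F x = x"
proof -
  interpret group "H F" by (rule group_H)
  obtain d where d: "d \<in> im F" "rep F x = d \<otimes>\<^bsub>H F\<^esub> x"
    using rep_mem[OF assms] by (auto simp: r_coset_def)
  have dc: "d \<in> carrier (H F)" using d f_closed by auto
  then show r: "rep F x \<in> carrier (H F)" using d assms by simp
  have "x \<otimes>\<^bsub>H F\<^esub> inv\<^bsub>H F\<^esub> rep F x = inv\<^bsub>H F\<^esub> d"
    using dc assms unfolding d(2) by (simp add: group_simps)
  then have "x \<otimes>\<^bsub>H F\<^esub> inv\<^bsub>H F\<^esub> rep F x \<in> im F" using d subgroup.m_inv_closed[OF subgroup_im] by simp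
  from f_finv[OF this] show "cof F x \<in> carrier K" "f F (cof F x) \<otimes>\<^bsub>H F\<^esub> rep F x = x"
    unfolding cof_def using r assms by (simp_all add: m_assoc)
qed

lemma rep_mult:
  assumes "x \<in> carrier (H F)" "c \<in> carrier K"
  shows "rep F (f F c \<otimes>\<^bsub>H F\<^esub> x) = rep F x"
proof -
  interpret group "H F" by (rule group_H)
  have "im F #>\<^bsub>H F\<^esub> (f F c \<otimes>\<^bsub>H F\<^esub> x) = im F #>\<^bsub>H F\<^esub> f F c #>\<^bsub>H F\<^esub> x"
    using assms f_closed subgroup.subset[OF subgroup_im] by (intro coset_mult_assoc[symmetric]) auto
  also have "im F #>\<^bsub>H F\<^esub> f F c = im F"
    using assms f_closed by (intro coset_join2 subgroup_im) auto
  finally show ?thesis by (simp add: rep_def)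
qed

lemma rep_rep: assumes "x \<in> carrier (H F)" shows "rep F (rep F x) = rep F x"
  using rep_mult[OF rep_cof(1,2)[OF assms]] rep_cof(3)[OF assms] by simp

lemma im_mult_iff:
  assumes "x \<in> carrier (H F)" "c \<in> carrier K"
  shows "f F c \<otimes>\<^bsub>H F\<^esub> x \<in> im F \<longleftrightarrow> x \<in> im F"
proof -
  interpret group "H F" by (rule group_H)
  have "x \<in> im F" if "f F c \<otimes>\<^bsub>H F\<^esub> x \<in> im F"
  proof -
    have "inv\<^bsub>H F\<^esub> f F c \<in> im F"
      using assms subgroup.m_inv_closed[OF subgroup_im] by blast
    then have "inv\<^bsub>H F\<^esub> f F c \<otimes>\<^bsub>H F\<^esub> (f F c \<otimes>\<^bsub>H F\<^esub> x) \<in> im F"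
      using that subgroup.m_closed[OF subgroup_im] by blast
    then show ?thesis using assms f_closed by (simp add: cancel_inv_left)
  qed
  then show ?thesis using assms subgroup.m_closed[OF subgroup_im] by blast
qed

lemma cof_rep:
  assumes "s \<in> carrier (H F)" "c \<in> carrier K" "rep F s = s"
  shows "rep F (f F c \<otimes>\<^bsub>H F\<^esub> s) = s" "cof F (f F c \<otimes>\<^bsub>H F\<^esub> s) = c"
proof -
  interpret group "H F" by (rule group_H)
  show r: "rep F (f F c \<otimes>\<^bsub>H F\<^esub> s) = s" using rep_mult[OF assms(1,2)] assms(3) by simp
  show "cof F (f F c \<otimes>\<^bsub>H F\<^esub> s) = c"
    unfolding cof_def r using assms f_closed by (simp add: m_assoc)
qed

section \<open>Normal forms and the action of a factor\<close>

definition tail :: "(factor \<times> 'a) list \<Rightarrow> bool" where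
  "tail ss \<longleftrightarrow> (\<forall>(F, s)\<in>set ss. s \<in> carrier (H F) \<and> s \<notin> im F \<and> rep F s = s) \<and>
     successively (\<lambda>p q. fst p \<noteq> fst q) ss"

definition normal_forms :: "('c \<times> (factor \<times> 'a) list) set" where
  "normal_forms = {(c, ss). c \<in> carrier K \<and> tail ss}"

text \<open>The part of a normal form that lies in factor \<open>F\<close>, namely its coefficient
  and a leading syllable from \<open>F\<close>, is gathered into one element of \<open>F\<close>;
  \<open>push\<close> splits it again. These are inverse bijections, and \<open>act\<close> is left
  multiplication in \<open>F\<close> transported along them.\<close>

definition pull :: "factor \<Rightarrow> 'c \<times> (factor \<times> 'a) list \<Rightarrow> 'a \<times> (factor \<times> 'a) list" where
  "pull F w = (case w of (c, ss) \<Rightarrow> if ss \<noteq> [] \<and> fst (hd ss) = F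
     then (f F c \<otimes>\<^bsub>H F\<^esub> snd (hd ss), tl ss) else (f F c, ss))"

definition push :: "factor \<Rightarrow> 'a \<times> (factor \<times> 'a) list \<Rightarrow> 'c \<times> (factor \<times> 'a) list" where
  "push F w = (case w of (y, ss) \<Rightarrow> if y \<in> im F then (finv F y, ss) else (cof F y, (F, rep F y) # ss))"

definition pulled :: "factor \<Rightarrow> ('a \<times> (factor \<times> 'a) list) set" where
  "pulled F = {(y, ss). y \<in> carrier (H F) \<and> tail ss \<and> (ss = [] \<or> fst (hd ss) \<noteq> F)}"

lemma tail_Cons: "tail ((F, s) # ss) \<longleftrightarrow> s \<in> carrier (H F) \<and> s \<notin> im F \<and> rep F s = s \<and> tail ss \<and>
    (ss = [] \<or> F \<noteq> fst (hd ss))"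
  by (auto simp: tail_def successively_Cons)

lemma pull_pulled: "w \<in> normal_forms \<Longrightarrow> pull F w \<in> pulled F"
  using monoid.m_closed[OF group.is_monoid[OF group_H]] f_closed
  by (cases "snd w") (auto simp: normal_forms_def pull_def pulled_def tail_Cons)

lemma push_normal: assumes "w \<in> pulled F" shows "push F w \<in> normal_forms"
proof -
  obtain y ss where w: "w = (y, ss)" "y \<in> carrier (H F)" "tail ss" "ss = [] \<or> fst (hd ss) \<noteq> F"
    using assms by (auto simp: pulled_def)
  have "rep F y \<notin> im F" if "y \<notin> im F"
    using im_mult_iff[OF rep_cof(1,2)[OF w(2)]] rep_cof(3)[OF w(2)] that by simp
  then show ?thesis using w rep_cof[OF w(2)] rep_rep[OF w(2)] f_finv(2)
    by (auto simp: push_def normal_forms_def tail_Cons)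
qed

lemma pull_push: assumes "w \<in> pulled F" shows "pull F (push F w) = w"
  using assms f_finv(1) rep_cof(3) by (auto simp: pulled_def pull_def push_def)

lemma push_pull: assumes "w \<in> normal_forms" shows "push F (pull F w) = w"
proof -
  obtain c ss where w: "w = (c, ss)" "c \<in> carrier K" "tail ss" using assms by (auto simp: normal_forms_def)
  show ?thesis
  proof (cases "ss \<noteq> [] \<and> fst (hd ss) = F")
    case True
    then obtain s ss' where ss: "ss = (F, s) # ss'" by (cases ss) auto
    then have s: "s \<in> carrier (H F)" "s \<notin> im F" "rep F s = s" using w by (auto simp: tail_Cons)
    then have "f F c \<otimes>\<^bsub>H F\<^esub> s \<notin> im F" using im_mult_iff w by blast
    then show ?thesis using w ss s cof_rep[OF s(1) w(2) s(3)] by (simp add: pull_def push_def)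
  next
    case False
    then have "pull F w = (f F c, ss)" by (auto simp: pull_def w(1))
    then show ?thesis using w by (simp add: push_def)
  qed
qed

definition act :: "factor \<Rightarrow> 'a \<Rightarrow> 'c \<times> (factor \<times> 'a) list \<Rightarrow> 'c \<times> (factor \<times> 'a) list" where
  "act F x w = push F (x \<otimes>\<^bsub>H F\<^esub> fst (pull F w), snd (pull F w))"

lemma pulled_mult: "x \<in> carrier (H F) \<Longrightarrow> w \<in> pulled F \<Longrightarrow> (x \<otimes>\<^bsub>H F\<^esub> fst w, snd w) \<in> pulled F"
  using monoid.m_closed[OF group.is_monoid[OF group_H]] by (auto simp: pulled_def)

lemma act_normal: "x \<in> carrier (H F) \<Longrightarrow> w \<in> normal_forms \<Longrightarrow> act F x w \<in> normal_forms"
  unfolding act_def by (intro push_normal pulled_mult pull_pulled)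

lemma act_mult:
  assumes "x \<in> carrier (H F)" "y \<in> carrier (H F)" "w \<in> normal_forms"
  shows "act F x (act F y w) = act F (x \<otimes>\<^bsub>H F\<^esub> y) w"
proof -
  interpret group "H F" by (rule group_H)
  have "fst (pull F w) \<in> carrier (H F)" using pull_pulled[OF assms(3), of F] by (auto simp: pulled_def mem_Times_iff)
  then show ?thesis unfolding act_def
    using assms pull_push[OF pulled_mult[OF assms(2) pull_pulled[OF assms(3)]]] by (simp add: m_assoc)
qed

lemma act_one: assumes "w \<in> normal_forms" shows "act F \<one>\<^bsub>H F\<^esub> w = w"
proof -
  interpret group "H F" by (rule group_H)
  have "fst (pull F w) \<in> carrier (H F)" using pull_pulled[OF assms, of F] by (auto simp: pulled_def mem_Times_iff)
  then show ?thesis unfolding act_def using push_pull[OF assms] by simp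
qed

text \<open>The result does not depend on \<open>F\<close>; hence the relators that glue the two
  copies of the common subgroup act trivially.\<close>

lemma act_im:
  assumes "c \<in> carrier K" "(d, ss) \<in> normal_forms"
  shows "act F (f F c) (d, ss) = (c \<otimes>\<^bsub>K\<^esub> d, ss)"
proof -
  interpret group "H F" by (rule group_H)
  interpret K: group K by (rule group_K)
  have d: "d \<in> carrier K" "tail ss" using assms(2) by (auto simp: normal_forms_def)
  have "pull F (c \<otimes>\<^bsub>K\<^esub> d, ss) = (f F c \<otimes>\<^bsub>H F\<^esub> fst (pull F (d, ss)), snd (pull F (d, ss)))"
    using assms(1) d f_closed by (cases ss) (auto simp: pull_def f_mult tail_Cons m_assoc)
  moreover have "(c \<otimes>\<^bsub>K\<^esub> d, ss) \<in> normal_forms" using assms(1) d by (simp add: normal_forms_def)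
  ultimately show ?thesis unfolding act_def using push_pull by metis
qed

lemma act_extend:
  assumes "x \<in> carrier (H F)" "x \<notin> im F" "(c, ss) \<in> normal_forms" "ss = [] \<or> F \<noteq> fst (hd ss)"
  shows "map fst (snd (act F x (c, ss))) = F # map fst ss"
proof -
  interpret group "H F" by (rule group_H)
  have c: "c \<in> carrier K" using assms(3) by (simp add: normal_forms_def)
  have p: "pull F (c, ss) = (f F c, ss)" using assms(4) by (auto simp: pull_def)
  have "x \<otimes>\<^bsub>H F\<^esub> f F c \<notin> im F"
  proof
    assume *: "x \<otimes>\<^bsub>H F\<^esub> f F c \<in> im F"
    have "inv\<^bsub>H F\<^esub> f F c \<in> im F" using c subgroup.m_inv_closed[OF subgroup_im] by blast
    then have "(x \<otimes>\<^bsub>H F\<^esub> f F c) \<otimes>\<^bsub>H F\<^esub> inv\<^bsub>H F\<^esub> f F c \<in> im F"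
      using * subgroup.m_closed[OF subgroup_im] by blast
    then show False using assms(1,2) c f_closed by (simp add: m_assoc)
  qed
  then show ?thesis by (simp add: act_def p push_def)
qed

end

section \<open>The amalgam of two presentations\<close>

lemma wval_eqI: "(u, v) \<in> weq P \<Longrightarrow> wval P u = wval P v"
  using wval_eq_iff weq_words by blast

lemma mem_wval: "w \<in> words P \<Longrightarrow> w \<in> wval P w"
  by (simp add: wval_def weq.refl)

lemma wval_in_carrier: "w \<in> words P \<Longrightarrow> wval P w \<in> carrier (grp P)"
  by (simp add: carrier_grp)

lemma inv_wval: assumes "w \<in> words P" shows "inv\<^bsub>grp P\<^esub> wval P w = wval P (inv_word w)"
proof -
  interpret group "grp P" by (rule group_grp)
  have "wval P (inv_word w) \<otimes>\<^bsub>grp P\<^esub> wval P w = \<one>\<^bsub>grp P\<^esub>"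
    using assms weq_inv_word[OF assms] by (simp add: mult_grp one_grp wval_eqI)
  then show ?thesis using assms by (intro inv_equality) (simp_all add: wval_in_carrier)
qed

lemma wval_rel: "r \<in> rels P \<Longrightarrow> r \<in> words P \<Longrightarrow> wval P r = wval P []"
  using weq.rel[of "[]" P "[]" r] by (intro wval_eqI) simp

lemma wval_cancel: "x \<in> gens P \<Longrightarrow> wval P [(x, b), (x, \<not> b)] = wval P []"
  using weq.cancel[of "[]" P "[]" x b] by (intro wval_eqI) simp

locale amalgam_presentation =
  fixes A B :: presentation
    and K :: "('c, 'm) monoid_scheme"
    and zs :: "'c list"
    and \<phi> \<psi> :: "'c \<Rightarrow> word set"
    and zA zB :: "word list"
  assumes finite_A: "finite_presentation A" and finite_B: "finite_presentation B"
    and disjoint: "gens A \<inter> gens B = {}"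
    and group_K: "group K"
    and gen_K: "set zs \<subseteq> carrier K" "generate K (set zs) = carrier K"
    and phi: "\<phi> \<in> hom K (grp A)" "inj_on \<phi> (carrier K)"
    and psi: "\<psi> \<in> hom K (grp B)" "inj_on \<psi> (carrier K)"
    and zA: "set zA \<subseteq> words A" "map (wval A) zA = map \<phi> zs"
    and zB: "set zB \<subseteq> words B" "map (wval B) zB = map \<psi> zs"
begin

abbreviation P :: "factor \<Rightarrow> presentation" where "P \<equiv> factor_pres A B"

definition G :: presentation where "G = amalgam A B zA zB"

abbreviation times_G :: "word set \<Rightarrow> word set \<Rightarrow> word set" (infixl "\<cdot>" 70) where
  "x \<cdot> y \<equiv> x \<otimes>\<^bsub>grp G\<^esub> y"

abbreviation ginv :: "word set \<Rightarrow> word set" where "ginv x \<equiv> inv\<^bsub>grp G\<^esub> x"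

definition f :: "factor \<Rightarrow> 'c \<Rightarrow> word set" where
  "f F = (case F of FactorA \<Rightarrow> \<phi> | FactorB \<Rightarrow> \<psi>)"

definition zz :: "factor \<Rightarrow> word list" where
  "zz F = (case F of FactorA \<Rightarrow> zA | FactorB \<Rightarrow> zB)"

definition CG :: "word set set" where "CG = subgrp G zA"

definition S :: "factor \<Rightarrow> word set set" where "S F = factor_in G (P F)"

lemma factor_simps [simp]: "f FactorA = \<phi>" "f FactorB = \<psi>" "zz FactorA = zA" "zz FactorB = zB"
  by (simp_all add: f_def zz_def)

lemma f_hom: "f F \<in> hom K (grp (P F))" "inj_on (f F) (carrier K)"
  using phi psi by (cases F; simp)+

lemma zz: "set (zz F) \<subseteq> words (P F)" "map (wval (P F)) (zz F) = map (f F) zs"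
  using zA zB by (cases F; simp)+

lemma gens_G: "gens G = gens A \<union> gens B"
  by (simp add: G_def amalgam_def)

lemma words_G: "w \<in> words (P F) \<Longrightarrow> w \<in> words G"
  by (cases F) (auto simp: words_over_def gens_G)

lemma rels_G: "rels G = rels A \<union> rels B \<union> {a @ inv_word b | a b. (a, b) \<in> set (zip zA zB)}"
  by (simp add: G_def amalgam_def)

lemma weq_G: "(u, v) \<in> weq (P F) \<Longrightarrow> (u, v) \<in> weq G"
proof (induction rule: weq.induct)
  case (refl w)
  then show ?case by (rule weq.refl[OF words_G])
next
  case (cancel u v x b)
  have "x \<in> gens G" using cancel(3) by (cases F) (auto simp: gens_G)
  then show ?case using weq.cancel[OF words_G words_G] cancel by blast
next
  case (rel u v r)
  have "r \<in> rels G" using rel(3) by (cases F) (auto simp: rels_G)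
  then show ?case using weq.rel[OF words_G words_G _ words_G] rel by blast
qed (blast intro: weq.sym weq.trans)+

lemma length_z: "length zA = length zs" "length zB = length zs"
  using zA(2) zB(2) by (metis length_map)+

sublocale act: amalgam_data "\<lambda>F. grp (P F)" K f
  by (intro amalgam_data.intro) (rule group_grp group_K f_hom)+

section \<open>Words of the amalgam acting on normal forms\<close>

definition fac :: "nat \<Rightarrow> factor" where
  "fac x = (if x \<in> gens A then FactorA else FactorB)"

definition letter_act :: "nat \<times> bool \<Rightarrow> 'c \<times> (factor \<times> word set) list \<Rightarrow> 'c \<times> (factor \<times> word set) list" where
  "letter_act l = act.act (fac (fst l)) (wval (P (fac (fst l))) [l])"

definition wact :: "word \<Rightarrow> 'c \<times> (factor \<times> word set) list \<Rightarrow> 'c \<times> (factor \<times> word set) list" where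
  "wact w nf = foldr letter_act w nf"

lemma wact_simps [simp]: "wact [] nf = nf" "wact (l # w) nf = letter_act l (wact w nf)"
  "wact (u @ v) nf = wact u (wact v nf)"
  by (simp_all add: wact_def)

lemma fac_gens: "x \<in> gens G \<Longrightarrow> x \<in> gens (P (fac x))"
  by (auto simp: fac_def gens_G)

lemma fac_eq: "x \<in> gens (P F) \<Longrightarrow> fac x = F"
  using disjoint by (cases F) (auto simp: fac_def)

lemma wact_normal: "w \<in> words G \<Longrightarrow> nf \<in> act.normal_forms \<Longrightarrow> wact w nf \<in> act.normal_forms"
  by (induction w) (auto simp: letter_act_def intro!: act.act_normal wval_in_carrier dest: fac_gens)

lemma wact_factor:
  "w \<in> words (P F) \<Longrightarrow> nf \<in> act.normal_forms \<Longrightarrow> wact w nf = act.act F (wval (P F) w) nf"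
proof (induction w)
  case Nil
  then show ?case using act.act_one[of nf F] by (simp add: one_grp)
next
  case (Cons l w)
  then have l: "fst l \<in> gens (P F)" "w \<in> words (P F)" by auto
  then show ?case using Cons fac_eq[OF l(1)]
    by (simp add: letter_act_def act.act_mult wval_in_carrier mult_grp)
qed

lemma wact_one:
  assumes "w \<in> words (P F)" "wval (P F) w = wval (P F) []" "nf \<in> act.normal_forms"
  shows "wact w nf = nf"
  using assms act.act_one[of nf F] by (simp add: wact_factor one_grp)

lemma wact_glue:
  assumes "(a, b) \<in> set (zip zA zB)" "nf \<in> act.normal_forms"
  shows "wact (a @ inv_word b) nf = nf"
proof -
  obtain i where i: "i < length zs" "a = zA ! i" "b = zB ! i"
    using assms(1) length_z by (auto simp: in_set_zip)
  define c where "c = zs ! i"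
  have c: "c \<in> carrier K" using i gen_K(1) by (auto simp: c_def)
  have ab: "a \<in> words A" "b \<in> words B" using i length_z zA(1) zB(1) by (auto simp: subset_iff)
  have "wval A a = map (wval A) zA ! i" "wval B b = map (wval B) zB ! i"
    using i length_z by simp_all
  then have v: "wval A a = \<phi> c" "wval B b = \<psi> c" unfolding zA(2) zB(2) using i by (simp_all add: c_def)
  obtain d ss where nf: "nf = (d, ss)" by (cases nf)
  have d: "d \<in> carrier K" using assms(2) nf by (simp add: act.normal_forms_def)
  interpret K: group K by (rule group_K)
  have "wact (inv_word b) nf = act.act FactorB (f FactorB (inv\<^bsub>K\<^esub> c)) nf"
    using wact_factor[of "inv_word b" FactorB nf] ab assms(2) v act.f_inv[OF c, of FactorB] inv_wval[of b B]
    by simp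
  also have "\<dots> = (inv\<^bsub>K\<^esub> c \<otimes>\<^bsub>K\<^esub> d, ss)"
    using act.act_im[of "inv\<^bsub>K\<^esub> c" d ss FactorB] c assms(2) nf by simp
  finally have 1: "wact (inv_word b) nf = (inv\<^bsub>K\<^esub> c \<otimes>\<^bsub>K\<^esub> d, ss)" .
  have n: "(inv\<^bsub>K\<^esub> c \<otimes>\<^bsub>K\<^esub> d, ss) \<in> act.normal_forms"
    using assms(2) nf c by (simp add: act.normal_forms_def)
  have "wact a (inv\<^bsub>K\<^esub> c \<otimes>\<^bsub>K\<^esub> d, ss) = act.act FactorA (f FactorA c) (inv\<^bsub>K\<^esub> c \<otimes>\<^bsub>K\<^esub> d, ss)"
    using wact_factor[of a FactorA, OF _ n] ab v by simp
  also have "\<dots> = nf" using act.act_im[OF c n, of FactorA] c d nf by (simp add: K.cancel_left_inv)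
  finally show ?thesis by (simp add: 1)
qed

lemma wact_weq: "(u, v) \<in> weq G \<Longrightarrow> nf \<in> act.normal_forms \<Longrightarrow> wact u nf = wact v nf"
proof (induction arbitrary: nf rule: weq.induct)
  case (cancel u v x b)
  have n: "wact v nf \<in> act.normal_forms" using cancel by (intro wact_normal)
  have x: "x \<in> gens (P (fac x))" by (rule fac_gens) fact
  have "wact [(x, b), (x, \<not> b)] (wact v nf) = wact v nf"
    using x by (intro wact_one[of _ "fac x"] wval_cancel n) auto
  then show ?case by simp
next
  case (rel u v r)
  have n: "wact v nf \<in> act.normal_forms" using rel by (intro wact_normal)
  have "wact r (wact v nf) = wact v nf"
  proof -
    have "r \<in> rels (P FactorA) \<or> r \<in> rels (P FactorB) \<or>
        (\<exists>a b. r = a @ inv_word b \<and> (a, b) \<in> set (zip zA zB))"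
      using rel.hyps(3) unfolding rels_G by auto
    then consider F where "r \<in> rels (P F)" | a b where "r = a @ inv_word b" "(a, b) \<in> set (zip zA zB)"
      by blast
    then show ?thesis
    proof cases
      case 1
      then have "r \<in> words (P F)"
        using finite_A finite_B by (cases F) (auto simp: finite_presentation_def)
      then show ?thesis using 1 n by (intro wact_one wval_rel)
    next
      case 2
      then show ?thesis using wact_glue n by blast
    qed
  qed
  then show ?case by simp
qed auto

definition nf0 :: "'c \<times> (factor \<times> word set) list" where "nf0 = (\<one>\<^bsub>K\<^esub>, [])"

lemma nf0_normal: "nf0 \<in> act.normal_forms"
  using monoid.one_closed[OF group.is_monoid[OF group_K]]
  by (simp add: nf0_def act.normal_forms_def act.tail_def)

lemma pull_nf0: "act.pull F nf0 = (\<one>\<^bsub>grp (P F)\<^esub>, [])"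
  by (simp add: act.pull_def nf0_def act.f_one)

text \<open>The base point of the action has trivial stabiliser in each factor.\<close>

lemma wval_factor_iff:
  assumes "u \<in> words (P F)" "v \<in> words (P F)"
  shows "wval G u = wval G v \<longleftrightarrow> wval (P F) u = wval (P F) v"
proof
  assume "wval (P F) u = wval (P F) v"
  then show "wval G u = wval G v" using assms by (simp add: wval_eq_iff wval_eqI weq_G words_G)
next
  interpret group "grp (P F)" by (rule group_grp)
  assume "wval G u = wval G v"
  then have "(u, v) \<in> weq G" using assms words_G wval_eq_iff by blast
  then have "wact u nf0 = wact v nf0" using nf0_normal by (rule wact_weq)
  then have eq: "act.act F (wval (P F) u) nf0 = act.act F (wval (P F) v) nf0"
    using assms by (simp add: wact_factor nf0_normal)
  have pull: "act.pull F (act.act F x nf0) = (x, [])" if "x \<in> carrier (grp (P F))" for x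
  proof -
    have "(x, []) \<in> act.pulled F" using that by (simp add: act.pulled_def act.tail_def)
    from act.pull_push[OF this] show ?thesis unfolding act.act_def pull_nf0 using that by simp
  qed
  have "(wval (P F) u, []) = act.pull F (act.act F (wval (P F) u) nf0)"
    by (rule pull[symmetric]) (rule wval_in_carrier[OF assms(1)])
  also have "\<dots> = (wval (P F) v, [])"
    unfolding eq by (rule pull) (rule wval_in_carrier[OF assms(2)])
  finally show "wval (P F) u = wval (P F) v" by simp
qed

text \<open>The words in a class of \<open>P F\<close> all have the same class in \<open>G\<close>,
  so the union is that class and no representative has to be chosen.\<close>

definition emb :: "factor \<Rightarrow> word set \<Rightarrow> word set" where
  "emb F X = (\<Union>w\<in>X. wval G w)"

lemma emb_wval: assumes "w \<in> words (P F)" shows "emb F (wval (P F) w) = wval G w"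
proof -
  have "wval G v = wval G w" if "v \<in> wval (P F) w" for v
  proof -
    have "(w, v) \<in> weq (P F)" using that by (simp add: wval_def)
    then show ?thesis by (rule wval_eqI[OF weq_G, symmetric])
  qed
  then show ?thesis using mem_wval[OF assms] unfolding emb_def by blast
qed

lemma emb_hom: "group_hom (grp (P F)) (grp G) (emb F)"
proof -
  have "emb F \<in> hom (grp (P F)) (grp G)"
    by (auto simp: hom_def carrier_grp mult_grp emb_wval words_G)
  then show ?thesis by (simp add: group_hom_def group_hom_axioms_def group_grp)
qed

lemma emb_carrier: "emb F ` carrier (grp (P F)) = S F"
  by (auto simp: carrier_grp S_def factor_in_def emb_wval image_iff)

lemma subgrp_factor: "subgrp (P F) (zz F) = f F ` carrier K"
proof -
  have "wval (P F) ` set (zz F) = f F ` set zs" using zz(2) by (metis set_map)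
  then show ?thesis unfolding subgrp_def
    using group_hom.generate_img[OF act.group_hom_f gen_K(1)] gen_K(2) by simp
qed

lemma subgrp_emb: "subgrp G (zz F) = emb F ` f F ` carrier K"
proof -
  have "wval G ` set (zz F) = emb F ` (wval (P F) ` set (zz F))"
    using zz(1) by (force simp: emb_wval image_image)
  moreover have "wval (P F) ` set (zz F) \<subseteq> carrier (grp (P F))"
    using zz(1) wval_in_carrier by blast
  ultimately have "subgrp G (zz F) = emb F ` subgrp (P F) (zz F)"
    unfolding subgrp_def using group_hom.generate_img[OF emb_hom] by simp
  then show ?thesis by (simp add: subgrp_factor)
qed

lemma zA_zB: "(a, b) \<in> set (zip zA zB) \<Longrightarrow> wval G a = wval G b"
proof -
  assume ab: "(a, b) \<in> set (zip zA zB)"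
  interpret group "grp G" by (rule group_grp)
  have w: "a \<in> words G" "b \<in> words G"
    using set_zip_leftD[OF ab] set_zip_rightD[OF ab] zz(1)[of FactorA] zz(1)[of FactorB]
      words_G[of a FactorA] words_G[of b FactorB] by auto
  have "a @ inv_word b \<in> rels G" using ab unfolding rels_G by blast
  then have "wval G (a @ inv_word b) = \<one>\<^bsub>grp G\<^esub>" using w by (simp add: wval_rel one_grp)
  then have "wval G a \<cdot> ginv (wval G b) = \<one>\<^bsub>grp G\<^esub>" using w by (simp add: inv_wval mult_grp)
  then show ?thesis using w wval_in_carrier inv_equality[of "wval G a" "ginv (wval G b)"] by simp
qed

lemma CG_eq: "CG = subgrp G (zz F)"
proof -
  have "wval G ` set zA = wval G ` set zB"
  proof -
    have "map (wval G) zA = map (wval G) zB"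
      using length_z zA_zB by (intro nth_equalityI) (auto simp: in_set_zip)
    then show ?thesis by (metis set_map)
  qed
  then show ?thesis by (cases F) (simp_all add: CG_def subgrp_def)
qed

lemma wval_CG_iff:
  assumes "w \<in> words (P F)"
  shows "wval G w \<in> CG \<longleftrightarrow> wval (P F) w \<in> f F ` carrier K"
proof
  assume "wval G w \<in> CG"
  then obtain c where c: "c \<in> carrier K" "wval G w = emb F (f F c)" unfolding CG_eq[of F] subgrp_emb by auto
  then obtain v where v: "v \<in> words (P F)" "f F c = wval (P F) v"
    using act.f_closed[OF c(1), of F] by (auto simp: carrier_grp)
  then have "wval G w = wval G v" using c by (simp add: emb_wval)
  then have "wval (P F) w = f F c" using wval_factor_iff[OF assms v(1)] v(2) by simp
  then show "wval (P F) w \<in> f F ` carrier K" using c(1) by simp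
next
  assume "wval (P F) w \<in> f F ` carrier K"
  then show "wval G w \<in> CG" unfolding CG_eq[of F] subgrp_emb using emb_wval[OF assms] by (metis imageI)
qed

lemma CG_word: assumes "x \<in> CG" obtains w where "w \<in> words (P F)" "wval G w = x"
proof -
  obtain c where c: "c \<in> carrier K" "x = emb F (f F c)" using assms unfolding CG_eq[of F] subgrp_emb by auto
  then obtain v where "v \<in> words (P F)" "f F c = wval (P F) v"
    using act.f_closed[OF c(1), of F] by (auto simp: carrier_grp)
  then show thesis using that[of v] c by (simp add: emb_wval)
qed

section \<open>The sequence of factors of an element\<close>

definition tpw :: "word \<Rightarrow> factor list" where
  "tpw w = map fst (snd (wact w nf0))"

text \<open>Words with the same value act alike by \<open>wact_weq\<close>, so the chosen word does
  not influence the result.\<close>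

definition tp :: "word set \<Rightarrow> factor list" where
  "tp g = tpw (SOME w. w \<in> words G \<and> wval G w = g)"

lemma tp_wval: assumes "w \<in> words G" shows "tp (wval G w) = tpw w"
proof -
  define v where "v = (SOME v. v \<in> words G \<and> wval G v = wval G w)"
  have "v \<in> words G \<and> wval G v = wval G w" unfolding v_def
    by (rule someI[where P = "\<lambda>v. v \<in> words G \<and> wval G v = wval G w" and x = w]) (simp add: assms)
  then have "(v, w) \<in> weq G" using assms wval_eq_iff by blast
  from wact_weq[OF this nf0_normal] have "tpw v = tpw w" by (simp add: tpw_def)
  then show ?thesis by (simp add: tp_def v_def)
qed

abbreviation cat :: "(factor \<times> word) list \<Rightarrow> word" where
  "cat ts \<equiv> concat (map snd ts)"

abbreviation letters :: "(factor \<times> word) list \<Rightarrow> bool" where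
  "letters ts \<equiv> \<forall>p\<in>set ts. snd p \<in> words (P (fst p))"

abbreviation vals :: "(factor \<times> word) list \<Rightarrow> (factor \<times> word set) list" where
  "vals ts \<equiv> map (\<lambda>p. (fst p, wval G (snd p))) ts"

lemma cat_words: "letters ts \<Longrightarrow> cat ts \<in> words G"
  by (induction ts) (auto intro: words_G)

text \<open>The letters act from right to left, and each one, being outside C and in a factor other
  than that of the leading syllable, adds one syllable by \<open>act_extend\<close>.\<close>

lemma tpw_cat:
  assumes "\<forall>p\<in>set ts. snd p \<in> words (P (fst p)) \<and> wval G (snd p) \<notin> CG"
    "successively (\<lambda>p q. fst p \<noteq> fst q) ts"
  shows "tpw (cat ts) = map fst ts"
  using assms
proof (induction ts)
  case Nil
  then show ?case by (simp add: tpw_def nf0_def)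
next
  case (Cons p ts)
  obtain c ss where n: "wact (cat ts) nf0 = (c, ss)" by (cases "wact (cat ts) nf0")
  have IH: "map fst ss = map fst ts" using Cons n by (auto simp: tpw_def successively_Cons)
  have nn: "(c, ss) \<in> act.normal_forms"
    using n wact_normal[OF _ nf0_normal] cat_words[of ts] Cons.prems by (metis list.set_intros(2))
  have p: "snd p \<in> words (P (fst p))" "wval (P (fst p)) (snd p) \<notin> act.im (fst p)"
    using Cons.prems wval_CG_iff by auto
  have "ss = [] \<or> fst p \<noteq> fst (hd ss)"
  proof (cases ss)
    case (Cons s ss')
    then show ?thesis using IH Cons.prems(2) by (cases ts) auto
  qed simp
  then have "map fst (snd (act.act (fst p) (wval (P (fst p)) (snd p)) (c, ss))) = fst p # map fst ss"
    using p nn by (intro act.act_extend wval_in_carrier)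
  then show ?case using p nn IH n by (simp add: tpw_def wact_factor)
qed

lemma gprod_vals:
  "letters ts \<Longrightarrow> group.gprod (grp G) (vals ts) = wval G (cat ts)"
proof (induction ts)
  case Nil
  then show ?case by (simp add: one_grp group.gprod_Nil[OF group_grp])
next
  case (Cons p ts)
  then show ?case using cat_words[of ts] words_G[of "snd p" "fst p"]
    by (simp add: mult_grp group.gprod_Cons[OF group_grp])
qed

lemma ex_vals:
  assumes "\<forall>p\<in>set xs. snd p \<in> S (fst p)"
  obtains ts where "xs = vals ts" "letters ts"
proof -
  have "\<exists>ts. xs = vals ts \<and> letters ts"
    using assms
  proof (induction xs)
    case (Cons x xs)
    then obtain ts where ts: "xs = vals ts" "letters ts" by auto
    obtain w where "w \<in> words (P (fst x))" "snd x = wval G w"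
      using Cons.prems by (auto simp: S_def factor_in_def)
    then show ?case using ts by (intro exI[of _ "(fst x, w) # ts"]) (simp add: prod_eq_iff)
  qed simp
  then show thesis using that by blast
qed

lemma wval_generated: "w \<in> words G \<Longrightarrow> wval G w \<in> generate (grp G) (\<Union>F. S F)"
proof (induction w)
  case Nil
  then show ?case using generate.one[of "grp G"] by (simp add: one_grp)
next
  case (Cons l w)
  have "[l] \<in> words (P (fac (fst l)))" using Cons.prems fac_gens by simp
  then have "wval G [l] \<in> S (fac (fst l))" unfolding S_def factor_in_def by (rule imageI)
  then have "wval G [l] \<in> (\<Union>F. S F)" by blast
  from generate.eng[OF generate.incl[OF this] Cons.IH]
  have "wval G [l] \<cdot> wval G w \<in> generate (grp G) (\<Union>F. S F)"
    using Cons.prems by simp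
  then show ?case using Cons.prems by (simp add: mult_grp)
qed

lemma S_subgroup: "subgroup (S F) (grp G)"
  unfolding emb_carrier[symmetric] by (rule group_hom.img_is_subgroup[OF emb_hom])

lemma CG_subgroup: "subgroup CG (grp G)"
  unfolding CG_eq[of FactorA] subgrp_def using zz(1)[of FactorA] words_G[of _ FactorA]
  by (intro group.generate_is_subgroup[OF group_grp]) (auto intro!: wval_in_carrier)

text \<open>The normal form theorem for the presented amalgam, after which the abstract conjugacy
  theory applies to it.\<close>

sublocale amalgam_decomposition "grp G" S CG tp
proof (intro amalgam_decomposition.intro amalgam_decomposition_axioms.intro)
  show "group (grp G)" by (rule group_grp)
  show "subgroup (S F) (grp G)" for F by (rule S_subgroup)
  show "subgroup CG (grp G)" by (rule CG_subgroup)
  show "CG \<subseteq> S F" for F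
    using act.f_closed emb_carrier[of F] unfolding CG_eq[of F] subgrp_emb by blast
  interpret group "grp G" by (rule group_grp)
  show "generate (grp G) (\<Union>F. S F) = carrier (grp G)"
  proof
    show "generate (grp G) (\<Union>F. S F) \<subseteq> carrier (grp G)"
      using subgroup.subset[OF S_subgroup] by (intro generate_incl) auto
  qed (auto simp: carrier_grp wval_generated)
  show "tp c = []" if c: "c \<in> CG" for c
  proof -
    obtain w where w: "w \<in> words (P FactorA)" "wval G w = c" using CG_word[OF c] .
    then obtain d where "d \<in> carrier K" "wval (P FactorA) w = f FactorA d"
      using wval_CG_iff[OF w(1)] c by auto
    then have "wact w nf0 = (d \<otimes>\<^bsub>K\<^esub> \<one>\<^bsub>K\<^esub>, [])"
      using wact_factor[OF w(1) nf0_normal] act.act_im[of d "\<one>\<^bsub>K\<^esub>" "[]" FactorA] nf0_normal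
      by (simp add: nf0_def)
    then show ?thesis using tp_wval[OF words_G[OF w(1)]] w(2) by (simp add: tpw_def)
  qed
  fix xs :: "(factor \<times> word set) list"
  assume xs: "\<forall>p\<in>set xs. snd p \<in> S (fst p) - CG" "successively (\<lambda>p q. fst p \<noteq> fst q) xs"
  obtain ts where ts: "xs = vals ts" "letters ts"
    using ex_vals[of xs] xs(1) by blast
  have "tpw (cat ts) = map fst ts"
    using xs ts by (intro tpw_cat) (auto simp: successively_map)
  moreover have "tp (gprod xs) = tpw (cat ts)"
    using gprod_vals[OF ts(2)] tp_wval[OF cat_words[OF ts(2)]] ts(1) by simp
  ultimately show "tp (gprod xs) = map fst xs" using ts(1) by (simp add: comp_def)
qed

end

section \<open>Certificates of non-conjugacy\<close>

lemma semi_words_over: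
  assumes "finite X" "computable f" shows "semi (\<lambda>x. f x \<in> words_over X)"
proof -
  have "semi (\<lambda>x. \<forall>l\<in>set (f x). fst l \<in> X)"
    by (intro semi_ball_list semi_mem_finite assms computable_intros)
  moreover have "w \<in> words_over X \<longleftrightarrow> (\<forall>l\<in>set w. fst l \<in> X)" for w
    by (auto simp: words_over_def)
  ultimately show ?thesis by simp
qed

text \<open>For a finite presentation this set is finite, so being an instance of a rule can be
  semidecided, and equality of words becomes the existence of a path of rule applications in either
  direction.\<close>

definition rewrite_rules :: "presentation \<Rightarrow> (word \<times> word) set" where
  "rewrite_rules P = (\<lambda>(x, b). ([(x, b), (x, \<not> b)], [])) ` (gens P \<times> UNIV) \<union> (\<lambda>r. (r, [])) ` (rels P \<inter> words P)"

definition rewrite_step :: "presentation \<Rightarrow> word \<Rightarrow> word \<Rightarrow> bool" where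
  "rewrite_step P u v \<longleftrightarrow> (\<exists>a b x y. a \<in> words P \<and> b \<in> words P \<and>
     ((x, y) \<in> rewrite_rules P \<or> (y, x) \<in> rewrite_rules P) \<and> u = a @ x @ b \<and> v = a @ y @ b)"

lemma rewrite_step_sym: "rewrite_step P u v \<Longrightarrow> rewrite_step P v u"
  unfolding rewrite_step_def by blast

lemma rewrite_rules_weq:
  "(x, y) \<in> rewrite_rules P \<Longrightarrow> a \<in> words P \<Longrightarrow> b \<in> words P \<Longrightarrow> (a @ x @ b, a @ y @ b) \<in> weq P"
  using weq.cancel[of a P b] weq.rel[of a P b] by (auto simp: rewrite_rules_def)

lemma weq_iff_rewrite_steps:
  "(u, v) \<in> weq P \<longleftrightarrow> u \<in> words P \<and> v \<in> words P \<and> (rewrite_step P)\<^sup>*\<^sup>* u v"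
proof (intro iffI conjI)
  assume "(u, v) \<in> weq P"
  then show "(rewrite_step P)\<^sup>*\<^sup>* u v"
  proof (induction rule: weq.induct)
    case (sym u v)
    then show ?case using rewrite_step_sym by (metis sympD sympI symp_rtranclp)
  next
    case (cancel u v x b)
    then have "([(x, b), (x, \<not> b)], []) \<in> rewrite_rules P" by (force simp: rewrite_rules_def)
    then have "rewrite_step P (u @ [(x, b), (x, \<not> b)] @ v) (u @ [] @ v)"
      using cancel unfolding rewrite_step_def by blast
    then show ?case by auto
  next
    case (rel u v r)
    then have "(r, []) \<in> rewrite_rules P" by (simp add: rewrite_rules_def)
    then have "rewrite_step P (u @ r @ v) (u @ [] @ v)"
      using rel unfolding rewrite_step_def by blast
    then show ?case by auto
  qed auto
next
  assume "u \<in> words P \<and> v \<in> words P \<and> (rewrite_step P)\<^sup>*\<^sup>* u v"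
  then have "(rewrite_step P)\<^sup>*\<^sup>* u v" "u \<in> words P" by auto
  then show "(u, v) \<in> weq P"
  proof (induction rule: rtranclp_induct)
    case (step y z)
    then have "(y, z) \<in> weq P" unfolding rewrite_step_def
      using rewrite_rules_weq weq.sym by blast
    then show ?case using step weq.trans by blast
  qed (rule weq.refl)
qed (auto dest: weq_words)

lemma semi_weq:
  assumes "finite (gens P)" "finite (rels P)" "computable f" "computable g"
  shows "semi (\<lambda>x. (f x, g x) \<in> weq P)"
proof -
  have "finite (rewrite_rules P)" using assms(1,2) by (simp add: rewrite_rules_def)
  then have "semi (\<lambda>p. rewrite_step P (fst p) (snd p))" unfolding rewrite_step_def
    by (intro semi_ex semi_conj semi_disj semi_words_over semi_mem_finite semi_eq assms(1)
        computable_intros)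
  then show ?thesis unfolding weq_iff_rewrite_steps
    by (intro semi_conj semi_words_over semi_rtranclp assms)
qed

text \<open>The two factors come with separate algorithms; a factor that is part of the data selects
  one of them by case distinction.\<close>

lemma semi_factor:
  fixes F :: "'a::encodable \<Rightarrow> factor"
  assumes "\<And>F. semi (Q F)" "computable F" shows "semi (\<lambda>x. Q (F x) x)"
proof -
  have "semi (\<lambda>x. (F x = FactorA \<and> Q FactorA x) \<or> (F x = FactorB \<and> Q FactorB x))"
    by (intro semi_disj semi_conj semi_eq assms computable_const)
  moreover have "(F x = FactorA \<and> Q FactorA x) \<or> (F x = FactorB \<and> Q FactorB x) \<longleftrightarrow> Q (F x) x" for x
    by (cases "F x") auto
  ultimately show ?thesis by simp
qed

text \<open>
  A row \<open>(F, h, F', a, g, h', w, k)\<close> records one step \<open>E \<mapsto> g\<^sup>-\<^sup>1 E w \<inter> C\<close> of the chain of sets: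
  \<open>h\<close> is an element of \<open>E\<close> as a word of the previous factor, \<open>h'\<close> the same element in the new factor
  \<open>F'\<close>, \<open>a\<close> is the inverse of \<open>g\<close>, and \<open>k\<close> is the element of the new set used by the next row.
\<close>

type_synonym row = "factor \<times> word \<times> factor \<times> word \<times> word \<times> word \<times> word \<times> word"

abbreviation row_F :: "row \<Rightarrow> factor" where "row_F r \<equiv> fst r"
abbreviation row_h :: "row \<Rightarrow> word" where "row_h r \<equiv> fst (snd r)"
abbreviation row_F' :: "row \<Rightarrow> factor" where "row_F' r \<equiv> fst (snd (snd r))"
abbreviation row_a :: "row \<Rightarrow> word" where "row_a r \<equiv> fst (snd (snd (snd r)))"
abbreviation row_g :: "row \<Rightarrow> word" where "row_g r \<equiv> fst (snd (snd (snd (snd r))))"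
abbreviation row_h' :: "row \<Rightarrow> word" where "row_h' r \<equiv> fst (snd (snd (snd (snd (snd r)))))"
abbreviation row_w :: "row \<Rightarrow> word" where "row_w r \<equiv> fst (snd (snd (snd (snd (snd (snd r))))))"
abbreviation row_k :: "row \<Rightarrow> word" where "row_k r \<equiv> snd (snd (snd (snd (snd (snd (snd r))))))"

locale amalgam_oracles = amalgam_presentation A B K zs \<phi> \<psi> zA zB
  for A B and K :: "('c, 'm) monoid_scheme" and zs \<phi> \<psi> zA zB +
  fixes card_oracle :: "factor \<Rightarrow> set_expr \<Rightarrow> word list option \<Rightarrow> bool"
  assumes solves_card: "solves {D. describes A B G CG F D} (\<lambda>D ans. case ans of
        None \<Rightarrow> infinite (set_val G D)
      | Some ws \<Rightarrow> set ws \<subseteq> words (P F) \<and> wval G ` set ws = set_val G D) (card_oracle F)"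
begin

lemma card_oracle:
  "describes A B G CG F D \<Longrightarrow> \<exists>ans. card_oracle F D ans"
  "describes A B G CG F D \<Longrightarrow> card_oracle F D None \<Longrightarrow> infinite (set_val G D)"
  "describes A B G CG F D \<Longrightarrow> card_oracle F D (Some ws) \<Longrightarrow>
    set ws \<subseteq> words (P F) \<and> wval G ` set ws = set_val G D"
  "semi (\<lambda>p. card_oracle F (fst p) (snd p))"
  using solvesD(1,3)[OF solves_card[of F]] solvesD(2)[OF solves_card[of F], of D None]
    solvesD(2)[OF solves_card[of F], of D "Some ws"] by simp_all

lemma wval_weq: "(u, v) \<in> weq G \<longleftrightarrow> u \<in> words G \<and> v \<in> words G \<and> wval G u = wval G v"
  using wval_eq_iff weq_words by blast

lemma semi_weq_G: "computable s \<Longrightarrow> computable t \<Longrightarrow> semi (\<lambda>x. (s x, t x) \<in> weq G)"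
proof -
  have "{a @ inv_word b | a b. (a, b) \<in> set (zip zA zB)} = (\<lambda>(a, b). a @ inv_word b) ` set (zip zA zB)"
    by auto
  then have rels: "finite (rels G)"
    using finite_A finite_B by (simp add: rels_G finite_presentation_def)
  have gens: "finite (gens G)"
    using finite_A finite_B by (simp add: gens_G finite_presentation_def)
  show "computable s \<Longrightarrow> computable t \<Longrightarrow> semi (\<lambda>x. (s x, t x) \<in> weq G)"
    by (rule semi_weq[OF gens rels])
qed

lemma semi_words_G: "computable s \<Longrightarrow> semi (\<lambda>x. s x \<in> words G)"
  using finite_A finite_B by (intro semi_words_over) (auto simp: gens_G finite_presentation_def)

lemma semi_words_P:
  assumes "computable F" "computable s" shows "semi (\<lambda>x. s x \<in> words (P (F x)))"
proof -
  have "semi (\<lambda>x. s x \<in> words (P F))" for F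
    using finite_A finite_B assms(2) by (intro semi_words_over) (cases F; simp add: finite_presentation_def)
  from semi_factor[of "\<lambda>F x. s x \<in> words (P F)", OF this assms(1)] show ?thesis .
qed

lemma computable_zz: assumes "computable F" shows "computable (\<lambda>x. zz (F x))"
proof -
  have "zz F = (if F = FactorA then zA else zB)" for F by (cases F) auto
  then show ?thesis using assms by (simp only:) (intro computable_intros)
qed

lemma semi_card_oracle:
  assumes "computable F" "computable s" "computable t"
  shows "semi (\<lambda>x. card_oracle (F x) (s x) (t x))"
  using semi_factor[of "\<lambda>F x. card_oracle F (s x) (t x)", OF _ assms(1)]
    semi_comp[OF card_oracle(4) computable_Pair[OF assms(2,3)]] by simp

text \<open>As C is the intersection of the factors, membership is witnessed by one equal word of
  each factor. The complement is certified by \<open>omits\<close> below.\<close>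

definition inC :: "word \<Rightarrow> bool" where
  "inC h \<longleftrightarrow> (\<exists>a b. a \<in> words (P FactorA) \<and> b \<in> words (P FactorB) \<and> (h, a) \<in> weq G \<and> (h, b) \<in> weq G)"

lemma S_iff: "x \<in> S F \<longleftrightarrow> (\<exists>w\<in>words (P F). x = wval G w)"
  by (auto simp: S_def factor_in_def)

lemma inC_iff: "inC h \<longleftrightarrow> h \<in> words G \<and> wval G h \<in> CG"
proof
  assume "inC h"
  then show "h \<in> words G \<and> wval G h \<in> CG"
    using C_eq_Int[of FactorA FactorB "wval G h"] unfolding inC_def wval_weq S_iff by auto
next
  assume h: "h \<in> words G \<and> wval G h \<in> CG"
  obtain a where "a \<in> words (P FactorA)" "wval G a = wval G h" using CG_word h by blast
  moreover obtain b where "b \<in> words (P FactorB)" "wval G b = wval G h" using CG_word h by blast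
  ultimately show "inC h" unfolding inC_def wval_weq using h words_G by metis
qed

section \<open>Rows and the sets that they describe\<close>

definition row_ok :: "row \<Rightarrow> bool" where
  "row_ok r \<longleftrightarrow> row_h' r \<in> words (P (row_F' r)) \<and> row_a r \<in> words (P (row_F' r)) \<and>
     row_g r \<in> words (P (row_F' r)) \<and> row_w r \<in> words (P (row_F' r)) \<and>
     (row_a r @ row_g r, []) \<in> weq G \<and> (row_h r, row_h' r) \<in> weq G"

text \<open>Demanded only of the rows before the last one: the set reached by the last row may be
  empty and then contains no \<open>row_k\<close>.\<close>

definition row_next :: "row \<Rightarrow> bool" where
  "row_next r \<longleftrightarrow> row_k r \<in> words (P (row_F' r)) \<and> inC (row_k r) \<and>
     (row_g r @ row_k r, row_h r @ row_w r) \<in> weq G"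

definition row_init :: "row \<Rightarrow> bool" where
  "row_init r \<longleftrightarrow> row_F r = FactorA \<and> row_h r \<in> words (P FactorA) \<and> inC (row_h r)"

definition row_link :: "row \<Rightarrow> row \<Rightarrow> bool" where
  "row_link r q \<longleftrightarrow> row_F q = row_F' r \<and> row_h q = row_k r"

text \<open>The set \<open>g\<^sup>-\<^sup>1 E w\<close> is written as
  \<open>a (E h\<^sup>-\<^sup>1) (h w)\<close>. The set \<open>E\<close> is described over the
  previous factor and cannot be shifted by words of the new one, but
  \<open>E h\<^sup>-\<^sup>1\<close> is a subgroup of C and hence a legal leaf over either factor.
  The shift must use words of the new factor, whence the second spelling \<open>row_h'\<close> of
  \<open>h\<close>.\<close>

definition expr_step :: "set_expr \<Rightarrow> row \<Rightarrow> set_expr" where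
  "expr_step D r = Inter (Shift (row_a r) (Transl (row_F r) D (row_h r)) (row_h' r @ row_w r))
     (Gen (zz (row_F' r)))"

text \<open>The chain starts with the whole of C; describing it over factor A is a convention,
  matched by \<open>row_init\<close>.\<close>

definition expr :: "row list \<Rightarrow> set_expr" where
  "expr rows = foldl expr_step (Gen zA) rows"

definition rows_valid :: "row list \<Rightarrow> row \<Rightarrow> bool" where
  "rows_valid rows r \<longleftrightarrow> successively row_link (rows @ [r]) \<and> (\<exists>q qs. rows @ [r] = q # qs \<and> row_init q) \<and>
     (\<forall>q\<in>set rows. row_ok q \<and> row_next q) \<and> row_ok r"

abbreviation row_pair :: "row \<Rightarrow> word set \<times> word set" where
  "row_pair r \<equiv> (wval G (row_g r), wval G (row_w r))"

lemma Gen_zz: "describes A B G CG F (Gen (zz F))" "set_val G (Gen (zz F)) = CG"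
proof -
  show "set_val G (Gen (zz F)) = CG" by (simp add: CG_eq[of F] subgrp_def)
  show "describes A B G CG F (Gen (zz F))"
    using zz(1)[of F] generate.incl[of _ "wval G ` set (zz F)" "grp G"]
    by (auto simp: CG_eq[of F] subgrp_def)
qed

text \<open>Membership in a described set \<open>D\<close> is decided by the cardinality search for \<open>D \<inter> {w}\<close>.\<close>

definition omits :: "factor \<Rightarrow> set_expr \<Rightarrow> word \<Rightarrow> bool" where
  "omits F D w \<longleftrightarrow> card_oracle F (Inter D (Shift w (Gen []) [])) (Some [])"

lemma omits_iff:
  assumes D: "describes A B G CG F D" and w: "w \<in> words (P F)"
  shows "omits F D w \<longleftrightarrow> wval G w \<notin> set_val G D"
proof -
  let ?E = "Inter D (Shift w (Gen []) [])"
  have E: "describes A B G CG F ?E" using D w by simp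
  have "set_val G (Shift w (Gen []) []) = {wval G w}"
    using wval_in_carrier[OF words_G[OF w]]
    by (simp add: generate_empty l_coset_def r_coset_def one_grp[symmetric])
  then have val: "set_val G ?E = set_val G D \<inter> {wval G w}" by simp
  obtain ans where ans: "card_oracle F ?E ans" using card_oracle(1)[OF E] by blast
  \<comment> \<open>With at most one element in the set, the oracle cannot answer
    "infinite".\<close>
  have "finite (set_val G ?E)" unfolding val by simp
  then obtain ws where ws: "ans = Some ws" using card_oracle(2)[OF E] ans by (cases ans) auto
  show ?thesis
  proof
    assume "omits F D w"
    then show "wval G w \<notin> set_val G D" using card_oracle(3)[OF E, of "[]"] val by (auto simp: omits_def)
  next
    assume "wval G w \<notin> set_val G D"
    then have "ws = []" using card_oracle(3)[OF E, of ws] ans ws val by auto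
    then show "omits F D w" using ans ws by (simp add: omits_def)
  qed
qed

lemma omits_zz: "w \<in> words (P F) \<Longrightarrow> omits F (Gen (zz F)) w \<longleftrightarrow> wval G w \<notin> CG"
  using omits_iff[OF Gen_zz(1)] unfolding Gen_zz(2) .

lemma expr_step:
  assumes D: "describes A B G CG (row_F r) D" "set_val G D = E" "E \<subseteq> CG"
    and h: "row_h r \<in> words (P (row_F r))" "wval G (row_h r) \<in> E" and ok: "row_ok r"
  shows "describes A B G CG (row_F' r) (expr_step D r)"
    "set_val G (expr_step D r) = Estep E (row_pair r)"
proof -
  let ?a = "wval G (row_a r)" and ?g = "wval G (row_g r)" and ?w = "wval G (row_w r)"
    and ?h = "wval G (row_h r)"
  show "describes A B G CG (row_F' r) (expr_step D r)"
    using assms Gen_zz(1)[of "row_F' r"] by (simp add: expr_step_def row_ok_def)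
  have w: "row_a r \<in> words G" "row_g r \<in> words G" "row_w r \<in> words G" "row_h r \<in> words G" "row_h' r \<in> words G"
    using ok h(1) words_G unfolding row_ok_def by blast+
  note car = w[THEN wval_in_carrier]
  have h': "wval G (row_h' r @ row_w r) = ?h \<cdot> ?w"
    using ok w by (simp add: row_ok_def wval_weq mult_grp[symmetric])
  have "?a \<cdot> ?g = \<one>\<^bsub>grp G\<^esub>" using ok w by (simp add: row_ok_def wval_weq mult_grp one_grp)
  then have a: "?a = ginv ?g" using car by (intro inv_equality[symmetric])
  have Ec: "x \<in> carrier (grp G)" if "x \<in> E" for x using that D(3) C_carrier by blast
  have "set_val G (expr_step D r) =
      ((?a <#\<^bsub>grp G\<^esub> (E #>\<^bsub>grp G\<^esub> ginv ?h)) #>\<^bsub>grp G\<^esub> (?h \<cdot> ?w)) \<inter> CG"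
    using D(2) Gen_zz(2)[of "row_F' r"] h' by (simp add: expr_step_def)
  also have "(?a <#\<^bsub>grp G\<^esub> (E #>\<^bsub>grp G\<^esub> ginv ?h)) #>\<^bsub>grp G\<^esub> (?h \<cdot> ?w) =
      (\<lambda>x. ?a \<cdot> (x \<cdot> ginv ?h) \<cdot> (?h \<cdot> ?w)) ` E"
    by (auto simp: l_coset_def r_coset_def)
  also have "\<dots> = (\<lambda>x. ginv ?g \<cdot> (x \<cdot> ?w)) ` E"
    unfolding a using car Ec by (intro image_cong) (simp_all add: group_simps)
  also have "\<dots> \<inter> CG = Estep E (row_pair r)"
  proof -
    have "y = ginv ?g \<cdot> (x \<cdot> ?w) \<longleftrightarrow> ?g \<cdot> y = x \<cdot> ?w"
      if "y \<in> CG" "x \<in> E" for x y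
    proof -
      have "ginv ?g \<cdot> (?g \<cdot> y) = y" "?g \<cdot> (ginv ?g \<cdot> (x \<cdot> ?w)) = x \<cdot> ?w"
        using that car Ec C_carrier[of y] by (simp_all add: cancel_left_inv cancel_inv_left)
      then show ?thesis by metis
    qed
    then show ?thesis
      unfolding Estep_def image_def set_eq_iff Int_iff mem_Collect_eq fst_conv snd_conv by blast
  qed
  finally show "set_val G (expr_step D r) = Estep E (row_pair r)" .
qed

lemma EstepI: "x \<in> CG \<Longrightarrow> g \<cdot> x = y \<cdot> w \<Longrightarrow> y \<in> E \<Longrightarrow> x \<in> Estep E (g, w)"
  by (auto simp: Estep_def)

text \<open>The invariant needed to add a row: \<open>row_h r\<close> lies in the current set, which
  is what \<open>describes\<close> demands of \<open>Transl\<close>. For the first row this comes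
  from \<open>row_init\<close>, later from \<open>row_next\<close> of the predecessor.\<close>

lemma rows_state:
  assumes "successively row_link (rows @ [r])" "row_init (hd (rows @ [r]))"
    "\<forall>q\<in>set rows. row_ok q \<and> row_next q"
  shows "describes A B G CG (row_F r) (expr rows) \<and> set_val G (expr rows) = foldl Estep CG (map row_pair rows) \<and>
    row_h r \<in> words (P (row_F r)) \<and> wval G (row_h r) \<in> foldl Estep CG (map row_pair rows)"
  using assms
proof (induction rows arbitrary: r rule: rev_induct)
  case Nil
  then show ?case using Gen_zz[of FactorA] by (auto simp: expr_def row_init_def inC_iff)
next
  case (snoc q rows)
  let ?E = "foldl Estep CG (map row_pair rows)"
  have IH: "describes A B G CG (row_F q) (expr rows)" "set_val G (expr rows) = ?E"
    "row_h q \<in> words (P (row_F q))" "wval G (row_h q) \<in> ?E"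
    using snoc.IH[of q] snoc.prems by (auto simp: successively_append_iff hd_append split: if_splits)
  have q: "row_ok q" "row_next q" and link: "row_link q r"
    using snoc.prems by (auto simp: successively_append_iff)
  have E: "?E \<subseteq> CG" by (rule foldl_Estep_subset) simp
  have w: "row_g q \<in> words G" "row_w q \<in> words G" "row_k q \<in> words G" "row_h q \<in> words G"
    using q words_G[OF IH(3)] words_G[of _ "row_F' q"] by (simp_all add: row_ok_def row_next_def)
  have "wval G (row_g q) \<cdot> wval G (row_k q) = wval G (row_h q) \<cdot> wval G (row_w q)"
    using q(2) w by (simp add: row_next_def wval_weq mult_grp)
  moreover have "wval G (row_k q) \<in> CG" using q(2) by (simp add: row_next_def inC_iff)
  ultimately have "wval G (row_k q) \<in> Estep ?E (row_pair q)"
    using IH(4) by (intro EstepI)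
  moreover have "row_k q \<in> words (P (row_F' q))" using q(2) by (simp add: row_next_def)
  moreover have "row_F r = row_F' q" "row_h r = row_k q" using link by (simp_all add: row_link_def)
  ultimately show ?case using expr_step[OF IH(1,2) E IH(3,4) q(1)] by (simp add: expr_def)
qed

lemma rows_valid_expr:
  assumes "rows_valid rows r"
  shows "describes A B G CG (row_F' r) (expr (rows @ [r]))"
    "set_val G (expr (rows @ [r])) = foldl Estep CG (map row_pair (rows @ [r]))"
proof -
  have "row_init (hd (rows @ [r]))" using assms unfolding rows_valid_def by auto
  then have "describes A B G CG (row_F r) (expr rows)"
    "set_val G (expr rows) = foldl Estep CG (map row_pair rows)"
    "row_h r \<in> words (P (row_F r))" "wval G (row_h r) \<in> foldl Estep CG (map row_pair rows)"
    using rows_state[of rows r] assms unfolding rows_valid_def by auto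
  from expr_step[OF this(1,2) _ this(3,4)] show
    "describes A B G CG (row_F' r) (expr (rows @ [r]))"
    "set_val G (expr (rows @ [r])) = foldl Estep CG (map row_pair (rows @ [r]))"
    using assms foldl_Estep_subset[of CG] by (auto simp: rows_valid_def expr_def)
qed

end

section \<open>The certificates\<close>

context amalgam_oracles
begin

text \<open>Lying outside C is stated through \<open>omits\<close> because certificates must be
  semidecidable. The shape \<open>p # m @ [q]\<close> gives length at least 2 together with the two
  end letters.\<close>

definition cyc_word :: "(factor \<times> word) list \<Rightarrow> bool" where
  "cyc_word gs \<longleftrightarrow> (\<forall>p\<in>set gs. snd p \<in> words (P (fst p)) \<and> omits (fst p) (Gen (zz (fst p))) (snd p)) \<and>
     successively (\<lambda>p q. fst p \<noteq> fst q) gs \<and> (\<exists>p m q. gs = p # m @ [q] \<and> fst p \<noteq> fst q)"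

text \<open>Here \<open>z\<close> is the inverse of \<open>c\<close>, and \<open>d\<close> is
  determined by \<open>g c = d w\<close>. The element \<open>c\<close> conjugates \<open>g\<close>
  to \<open>w\<close> iff \<open>d = c\<close>; the opposite is expressed by \<open>z d\<close> not
  lying in the trivial subgroup \<open>Gen []\<close>.\<close>

definition not_closing :: "factor \<Rightarrow> (factor \<times> word) list \<Rightarrow> (factor \<times> word) list \<Rightarrow> word \<Rightarrow> bool" where
  "not_closing F gs ws c \<longleftrightarrow> (\<exists>z d. z \<in> words (P F) \<and> d \<in> words (P F) \<and> (z @ c, []) \<in> weq G \<and>
     (cat gs @ c, d @ cat ws) \<in> weq G \<and> omits F (Gen []) (z @ d))"

text \<open>The rows cover an initial segment of the letters, and \<open>gs2\<close>,
  \<open>ws2\<close> are the rest: letters may be left over only if the set reached is empty. A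
  non-empty list of candidates requires the complete chain.\<close>

definition not_conj_C :: "(factor \<times> word) list \<Rightarrow> (factor \<times> word) list \<Rightarrow> bool" where
  "not_conj_C gs ws \<longleftrightarrow> map fst gs \<noteq> map fst ws \<or> (\<exists>rows r gs2 ws2 cs.
     gs = map (\<lambda>r. (row_F' r, row_g r)) (rows @ [r]) @ gs2 \<and>
     ws = map (\<lambda>r. (row_F' r, row_w r)) (rows @ [r]) @ ws2 \<and> rows_valid rows r \<and>
     card_oracle (row_F' r) (expr (rows @ [r])) (Some cs) \<and>
     (cs = [] \<or> gs2 = [] \<and> (\<forall>c\<in>set cs. not_closing (row_F' r) gs ws c)))"

text \<open>The outer \<open>k\<close> conjugates \<open>u\<close> to \<open>gs\<close>; the inner
  \<open>k\<close> is another word, which conjugates \<open>v\<close> to an element of a factor or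
  to \<open>vs\<close>. The splits \<open>a @ b\<close> run through all rotations of
  \<open>vs\<close>.\<close>

definition not_conj :: "word \<Rightarrow> word \<Rightarrow> bool" where
  "not_conj u v \<longleftrightarrow> (\<exists>gs k. cyc_word gs \<and> k \<in> words G \<and> (u @ k, k @ cat gs) \<in> weq G \<and>
     ((\<exists>F w k. w \<in> words (P F) \<and> (v @ k, k @ w) \<in> weq G) \<or>
      (\<exists>vs k. cyc_word vs \<and> (v @ k, k @ cat vs) \<in> weq G \<and>
        (\<forall>j<length vs. \<exists>a b. length a = j \<and> vs = a @ b \<and> not_conj_C gs (b @ a)))))"

definition conj_answer :: "word \<times> word \<Rightarrow> word option \<Rightarrow> bool" where
  "conj_answer uv ans \<longleftrightarrow>
     (\<exists>g. ans = Some g \<and> (fst uv @ g, g @ snd uv) \<in> weq G) \<or> ans = None \<and> not_conj (fst uv) (snd uv)"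

section \<open>Semidecidability of the certificates\<close>

lemma semi_omits:
  assumes "computable F" "computable D" "computable w"
  shows "semi (\<lambda>x. omits (F x) (D x) (w x))"
  unfolding omits_def by (intro semi_card_oracle assms computable_intros)

lemma semi_inC: "computable s \<Longrightarrow> semi (\<lambda>x. inC (s x))"
proof -
  have "semi inC" unfolding inC_def
    by (intro semi_ex semi_conj semi_words_P semi_weq_G computable_intros)
  then show "computable s \<Longrightarrow> semi (\<lambda>x. inC (s x))" by (rule semi_comp)
qed

lemma semi_row:
  "semi row_ok" "semi row_next" "semi row_init" "semi (\<lambda>p. row_link (fst p) (snd p))"
  unfolding row_ok_def row_next_def row_init_def row_link_def
  by (intro semi_ex semi_conj semi_words_P semi_weq_G semi_inC semi_eq computable_intros)+

text \<open>Because the expression is computed from the rows, the existential quantifiers of a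
  certificate range over rows, whose codes can be recognised, and not over expressions.\<close>

lemma computable_expr:
  assumes "computable s" shows "computable (\<lambda>x. expr (s x))"
  unfolding expr_def expr_step_def
  by (intro computable_foldl assms computable_zz computable_intros)

lemma semi_rows_valid:
  assumes "computable s" "computable t" shows "semi (\<lambda>x. rows_valid (s x) (t x))"
proof -
  have "semi (\<lambda>p. rows_valid (fst p) (snd p))" unfolding rows_valid_def
    by (intro semi_conj semi_successively semi_row semi_ball_list semi_ex semi_eq
        semi_comp[OF semi_row(1)] semi_comp[OF semi_row(2)] semi_comp[OF semi_row(3)] computable_intros)
  from semi_comp[OF this computable_Pair[OF assms]] show ?thesis by simp
qed

lemma semi_cyc_word: assumes "computable s" shows "semi (\<lambda>x. cyc_word (s x))"
proof -
  have "semi cyc_word" unfolding cyc_word_def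
    by (intro semi_conj semi_successively semi_ball_list semi_ex semi_eq semi_neq semi_words_P
        semi_omits computable_zz computable_intros)
  then show ?thesis using assms by (rule semi_comp)
qed

lemma semi_not_closing:
  assumes "computable F" "computable s" "computable t" "computable c"
  shows "semi (\<lambda>x. not_closing (F x) (s x) (t x) (c x))"
proof -
  have "semi (\<lambda>p. not_closing (fst p) (fst (snd p)) (fst (snd (snd p))) (snd (snd (snd p))))"
    unfolding not_closing_def
    by (intro semi_conj semi_ex semi_words_P semi_weq_G semi_omits computable_intros)
  from semi_comp[OF this computable_Pair[OF assms(1) computable_Pair[OF assms(2) computable_Pair[OF assms(3,4)]]]]
  show ?thesis by simp
qed

lemma semi_not_conj_C:
  assumes "computable s" "computable t" shows "semi (\<lambda>x. not_conj_C (s x) (t x))"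
proof -
  have "semi (\<lambda>p. not_conj_C (fst p) (snd p))" unfolding not_conj_C_def
    by (intro semi_conj semi_disj semi_ex semi_ball_list semi_eq semi_neq semi_rows_valid semi_card_oracle
        semi_not_closing computable_expr computable_intros)
  from semi_comp[OF this computable_Pair[OF assms]] show ?thesis by simp
qed

lemma semi_not_conj:
  assumes "computable s" "computable t" shows "semi (\<lambda>x. not_conj (s x) (t x))"
proof -
  have "semi (\<lambda>p. not_conj (fst p) (snd p))" unfolding not_conj_def
    by (intro semi_conj semi_disj semi_ex semi_all_less semi_eq semi_cyc_word semi_words_G semi_words_P
        semi_weq_G semi_not_conj_C computable_intros)
  from semi_comp[OF this computable_Pair[OF assms]] show ?thesis by simp
qed

lemma semi_conj_answer: "semi (\<lambda>p. conj_answer (fst p) (snd p))"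
  unfolding conj_answer_def
  by (intro semi_conj semi_disj semi_ex semi_eq semi_weq_G semi_not_conj computable_intros)

section \<open>Certificates against conjugation by an element of C\<close>

lemma cyc_word_iff:
  "cyc_word gs \<longleftrightarrow> letters gs \<and> cyc_reduced (vals gs)"
proof
  assume c: "cyc_word gs"
  then have w: "\<forall>p\<in>set gs. snd p \<in> words (P (fst p)) \<and> wval G (snd p) \<notin> CG"
    using omits_zz unfolding cyc_word_def by blast
  then have "reduced (vals gs)"
    using c by (auto simp: reduced_def cyc_word_def successively_map S_iff)
  moreover obtain p m q where "gs = p # m @ [q]" "fst p \<noteq> fst q"
    using c unfolding cyc_word_def by blast
  ultimately show "letters gs \<and> cyc_reduced (vals gs)"
    using w by (simp add: cyc_reduced_def)
next
  assume c: "letters gs \<and> cyc_reduced (vals gs)"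
  then have red: "reduced (vals gs)" by (simp add: cyc_reduced_def)
  have "\<forall>p\<in>set gs. wval G (snd p) \<notin> CG" using red by (auto simp: reduced_def)
  moreover have "successively (\<lambda>p q. fst p \<noteq> fst q) gs" using red by (simp add: reduced_def successively_map)
  moreover obtain p gs' where gs: "gs = p # gs'" using c by (cases gs) (auto simp: cyc_reduced_def)
  moreover obtain m q where "gs' = m @ [q]"
    using c gs by (cases gs' rule: rev_cases) (auto simp: cyc_reduced_def)
  ultimately show "cyc_word gs"
    using c omits_zz unfolding cyc_word_def by (auto simp: cyc_reduced_def)
qed

text \<open>A conjugating \<open>c\<close> lies in the last set of the chain, so no set of the chain
  is empty. Thus the rows cover all letters and \<open>c\<close> occurs among the listed candidates,
  where \<open>not_closing\<close> contradicts the equation for \<open>c\<close>.\<close>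

lemma not_conj_C_sound:
  assumes gs: "letters gs" "reduced (vals gs)"
    and ws: "letters ws" "reduced (vals ws)"
    and eq: "map fst gs = map fst ws" "c \<in> CG" "gprod (vals gs) \<cdot> c = c \<cdot> gprod (vals ws)"
  shows "\<not> not_conj_C gs ws"
proof
  assume "not_conj_C gs ws"
  then obtain rows r gs2 ws2 cs where
    g: "gs = map (\<lambda>r. (row_F' r, row_g r)) (rows @ [r]) @ gs2"
    and w: "ws = map (\<lambda>r. (row_F' r, row_w r)) (rows @ [r]) @ ws2" and v: "rows_valid rows r"
    and co: "card_oracle (row_F' r) (expr (rows @ [r])) (Some cs)"
    and cs: "cs = [] \<or> gs2 = [] \<and> (\<forall>c\<in>set cs. not_closing (row_F' r) gs ws c)"
    using eq(1) unfolding not_conj_C_def by blast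
  have mem: "c \<in> foldl Estep CG (zip (map snd (vals gs)) (map snd (vals ws)))"
    using eq by (intro mem_foldl_Estep[OF gs(2) ws(2)]) (auto simp: comp_def)
  have zip: "zip (map snd (vals gs)) (map snd (vals ws)) =
      map row_pair (rows @ [r]) @ zip (map snd (vals gs2)) (map snd (vals ws2))"
    unfolding g w by (simp add: zip_append zip_map_map comp_def) (simp add: zip_same_conv_map)
  have val: "set cs \<subseteq> words (P (row_F' r))" "wval G ` set cs = foldl Estep CG (map row_pair (rows @ [r]))"
    using card_oracle(3)[OF rows_valid_expr(1)[OF v] co] rows_valid_expr(2)[OF v] by auto
  have "foldl Estep CG (map row_pair (rows @ [r])) \<noteq> {}"
    using mem unfolding zip by (rule foldl_Estep_prefix)
  then have "cs \<noteq> []" using val by auto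
  then have "gs2 = []" and nc: "\<forall>c\<in>set cs. not_closing (row_F' r) gs ws c" using cs by auto
  then have "ws2 = []" using eq(1) unfolding g w by simp
  then have "c \<in> wval G ` set cs" using mem \<open>gs2 = []\<close> unfolding zip val(2) by simp
  then obtain cw where cw: "cw \<in> set cs" "c = wval G cw" by blast
  let ?F = "row_F' r"
  obtain z d where z: "z \<in> words (P ?F)" "d \<in> words (P ?F)" "(z @ cw, []) \<in> weq G"
    "(cat gs @ cw, d @ cat ws) \<in> weq G" "omits ?F (Gen []) (z @ d)"
    using nc cw(1) unfolding not_closing_def by blast
  have W: "z \<in> words G" "d \<in> words G" "cw \<in> words G" "cat gs \<in> words G" "cat ws \<in> words G"
    using z(1,2) cw(1) val(1) words_G[of _ ?F] cat_words gs(1) ws(1) by blast+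
  note car = W[THEN wval_in_carrier]
  have "wval G (cat gs) \<cdot> c = wval G d \<cdot> wval G (cat ws)"
    using z(4) W cw(2) by (simp add: wval_weq mult_grp)
  moreover have "wval G (cat gs) \<cdot> c = c \<cdot> wval G (cat ws)"
    using eq(3) by (simp add: gprod_vals gs(1) ws(1))
  \<comment> \<open>Both \<open>d w\<close> and \<open>c w\<close> equal \<open>g c\<close>, so
    \<open>d\<close> and \<open>c\<close> agree.\<close>
  ultimately have "wval G d = c" using car cw(2) by (metis right_cancel)
  then have "wval G (z @ d) = wval G []" using z(3) W cw(2) by (simp add: wval_weq mult_grp[symmetric])
  then show False using omits_iff[of ?F "Gen []" "z @ d"] z(1,2,5) by (simp add: generate_empty one_grp)
qed

text \<open>Rows are constructed backwards from an element \<open>x\<close> of the last set, each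
  element pointing to one of the preceding set. The final clause speaks of every row that starts
  with the reached factor and word, so that a further row can be attached.\<close>

lemma ex_rows:
  assumes "\<forall>(F, g, w)\<in>set ts. g \<in> words (P F) \<and> w \<in> words (P F)"
    and "x \<in> foldl Estep CG (map (\<lambda>(F, g, w). (wval G g, wval G w)) ts)"
  shows "\<exists>rows F h. map (\<lambda>r. (row_F' r, row_g r, row_w r)) rows = ts \<and>
    (\<forall>q\<in>set rows. row_ok q \<and> row_next q) \<and> h \<in> words (P F) \<and> wval G h = x \<and> inC h \<and>
    (\<forall>r. row_F r = F \<longrightarrow> row_h r = h \<longrightarrow> successively row_link (rows @ [r]) \<and> row_init (hd (rows @ [r])))"
  using assms
proof (induction ts arbitrary: x rule: rev_induct)
  case Nil
  then obtain h where h: "h \<in> words (P FactorA)" "wval G h = x" using CG_word[of x FactorA] by auto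
  then have "inC h" using Nil words_G[OF h(1)] by (simp add: inC_iff)
  then show ?case using h
    by (intro exI[of _ "[]"] exI[of _ FactorA] exI[of _ h]) (auto simp: row_init_def)
next
  case (snoc t ts)
  obtain F' g w where t: "t = (F', g, w)" by (cases t)
  have gw: "g \<in> words (P F')" "w \<in> words (P F')" using snoc.prems(1) t by auto
  let ?E = "foldl Estep CG (map (\<lambda>(F, g, w). (wval G g, wval G w)) ts)"
  have "x \<in> Estep ?E (wval G g, wval G w)" using snoc.prems(2) t by simp
  then obtain y where xC: "x \<in> CG" and y: "y \<in> ?E" "wval G g \<cdot> x = y \<cdot> wval G w"
    by (auto simp: Estep_def)
  obtain rows F h where rows: "map (\<lambda>r. (row_F' r, row_g r, row_w r)) rows = ts"
    "\<forall>q\<in>set rows. row_ok q \<and> row_next q" "h \<in> words (P F)" "wval G h = y" "inC h"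
    and link: "\<And>r. row_F r = F \<Longrightarrow> row_h r = h \<Longrightarrow> successively row_link (rows @ [r]) \<and> row_init (hd (rows @ [r]))"
    using snoc.IH[OF _ y(1)] snoc.prems(1) by (auto simp del: split_paired_All)
  have "y \<in> CG" using y(1) foldl_Estep_subset[of CG] by blast
  then obtain h' where h': "h' \<in> words (P F')" "wval G h' = y" using CG_word by blast
  obtain k where k: "k \<in> words (P F')" "wval G k = x" using CG_word[OF xC] by blast
  define q :: row where "q = (F, h, F', inv_word g, g, h', w, k)"
  note W = words_G[OF gw(1)] words_G[OF gw(2)] words_G[OF h'(1)] words_G[OF k(1)] words_G[OF rows(3)]
  have "row_ok q" unfolding row_ok_def q_def using gw h' W rows(4) weq_inv_word[OF W(1)]
    by (simp add: wval_weq)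
  moreover have "wval G (g @ k) = wval G (h @ w)"
    using mult_grp[OF W(1,4)] mult_grp[OF W(5,2)] y(2) k(2) rows(4) by simp
  then have "row_next q" unfolding row_next_def q_def using k W xC
    by (simp add: wval_weq inC_iff)
  moreover have "successively row_link ((rows @ [q]) @ [r]) \<and> row_init (hd ((rows @ [q]) @ [r]))"
    if "row_F r = F'" "row_h r = k" for r
  proof -
    have "row_link q r" using that by (simp add: row_link_def q_def)
    moreover have "row_F q = F" "row_h q = h" by (simp_all add: q_def)
    from link[OF this] have "successively row_link (rows @ [q])" "row_init (hd (rows @ [q]))" by auto
    ultimately show ?thesis by (simp add: successively_append_iff hd_append split: if_splits)
  qed
  moreover have "map (\<lambda>r. (row_F' r, row_g r, row_w r)) (rows @ [q]) = ts @ [t]"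
    using rows(1) by (simp add: q_def t)
  moreover have "inC k" using k W(4) xC by (simp add: inC_iff)
  ultimately show ?case using rows(2) k
    by (intro exI[of _ "rows @ [q]"] exI[of _ F'] exI[of _ k]) auto
qed

text \<open>The chain is followed up to the first empty set or to its end. The earlier sets are
  non-empty, so rows and a description exist, and the set reached is finite, so the oracle lists
  it.\<close>

lemma not_conj_C_complete:
  assumes gs: "cyc_word gs" and ws: "letters ws" "reduced (vals ws)"
    and regular: "gprod (vals gs) \<notin> Nstar (grp G) CG"
    and nc: "\<And>c. c \<in> CG \<Longrightarrow> gprod (vals gs) \<cdot> c \<noteq> c \<cdot> gprod (vals ws)"
  shows "not_conj_C gs ws"
proof (cases "map fst gs = map fst ws")
  case tags: True
  have gw: "letters gs" and red: "reduced (vals gs)" and ne: "gs \<noteq> []"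
    using gs unfolding cyc_word_iff by (auto simp: cyc_reduced_def)
  define pg where "pg = (\<lambda>t :: factor \<times> word \<times> word. (fst t, fst (snd t)))"
  define pw where "pw = (\<lambda>t :: factor \<times> word \<times> word. (fst t, snd (snd t)))"
  have "\<exists>ts. gs = map pg ts \<and> ws = map pw ts"
    using tags
  proof (induction gs arbitrary: ws)
    case (Cons p gs)
    then obtain q ws' where q: "ws = q # ws'" "fst q = fst p" "map fst gs = map fst ws'" by (cases ws) auto
    then obtain ts where "gs = map pg ts" "ws' = map pw ts" using Cons.IH by blast
    then show ?case using q
      by (intro exI[of _ "(fst p, snd p, snd q) # ts"]) (simp add: pg_def pw_def prod_eq_iff)
  qed auto
  then obtain ts where ts: "gs = map pg ts" "ws = map pw ts" by blast
  define pr where "pr = (\<lambda>(F :: factor, g, w). (wval G g, wval G w))"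
  define triple where "triple = (\<lambda>r :: row. (row_F' r, row_g r, row_w r))"
  define E where "E i = foldl Estep CG (map pr (take i ts))" for i
  define n where "n = length ts"
  have zip: "zip (map snd (vals gs)) (map snd (vals ws)) = map pr ts"
    unfolding ts by (induction ts) (auto simp: pg_def pw_def pr_def)
  have tsw: "\<forall>(F, g, w)\<in>set ts. g \<in> words (P F) \<and> w \<in> words (P F)"
    using gw ws(1) unfolding ts by (auto simp: pg_def pw_def)
  define k where "k = (LEAST k. E k = {} \<or> k = n)"
  have k: "E k = {} \<or> k = n" unfolding k_def by (rule LeastI[of _ n]) simp
  have kn: "k \<le> n" unfolding k_def by (rule Least_le) simp
  \<comment> \<open>\<open>E 0\<close> is C, which contains the identity, and \<open>n\<close> is
    positive; so at least one row is present, as \<open>rows_valid\<close> requires.\<close>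
  have "E 0 \<noteq> {}" using C_closed(3) by (auto simp: E_def)
  moreover have "n \<noteq> 0" using ne ts by (simp add: n_def)
  ultimately have "k \<noteq> 0" using k by metis
  then obtain i where i: "k = Suc i" by (cases k) auto
  have "\<not> (E i = {} \<or> i = n)" using not_less_Least[of i "\<lambda>k. E k = {} \<or> k = n"] i by (simp add: k_def)
  then obtain x where x: "x \<in> E i" by blast
  have "\<forall>(F, g, w)\<in>set (take i ts). g \<in> words (P F) \<and> w \<in> words (P F)"
    using tsw set_take_subset[of i ts] by blast
  from ex_rows[OF this, of x] x obtain rows F h where rows: "map triple rows = take i ts"
    "\<forall>q\<in>set rows. row_ok q \<and> row_next q" "h \<in> words (P F)" "wval G h = x" "inC h"
    and link: "\<And>r. row_F r = F \<Longrightarrow> row_h r = h \<Longrightarrow> successively row_link (rows @ [r]) \<and> row_init (hd (rows @ [r]))"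
    unfolding E_def pr_def triple_def by blast
  obtain F' g w where t: "ts ! i = (F', g, w)" by (cases "ts ! i")
  have "ts ! i \<in> set ts" using i kn by (simp add: n_def)
  then have gw': "g \<in> words (P F')" "w \<in> words (P F')" using tsw t by auto
  have "x \<in> CG" using x foldl_Estep_subset[of CG] unfolding E_def by blast
  then obtain h' where h': "h' \<in> words (P F')" "wval G h' = x" using CG_word by blast
  \<comment> \<open>The last row leads to no further one, so its entry \<open>row_k\<close> is
    filled with the empty word.\<close>
  define r :: row where "r = (F, h, F', inv_word g, g, h', w, [])"
  have r: "row_F r = F" "row_h r = h" "row_F' r = F'" by (simp_all add: r_def)
  note W = words_G[OF gw'(1)] words_G[OF gw'(2)] words_G[OF h'(1)] words_G[OF rows(3)]
  have "row_ok r" unfolding row_ok_def r_def using gw' h' W rows(4) weq_inv_word[OF W(1)]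
    by (simp add: wval_weq)
  moreover have "rows @ [r] = hd (rows @ [r]) # tl (rows @ [r])" by simp
  ultimately have valid: "rows_valid rows r"
    unfolding rows_valid_def using link[OF r(1,2)] rows(2) by blast
  have tk: "map triple (rows @ [r]) = take k ts"
    using rows(1) t i kn by (simp add: take_Suc_conv_app_nth n_def triple_def r_def)
  have "map row_pair (rows @ [r]) = map pr (map triple (rows @ [r]))"
    by (simp add: pr_def triple_def)
  then have val: "set_val G (expr (rows @ [r])) = E k"
    using rows_valid_expr(2)[OF valid] unfolding tk E_def by simp
  have g: "gs = map (\<lambda>r. (row_F' r, row_g r)) (rows @ [r]) @ map pg (drop k ts)"
  proof -
    have "map (\<lambda>r. (row_F' r, row_g r)) (rows @ [r]) = map pg (map triple (rows @ [r]))"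
      by (simp add: pg_def triple_def)
    then show ?thesis unfolding tk ts(1) by (simp flip: map_append)
  qed
  have w: "ws = map (\<lambda>r. (row_F' r, row_w r)) (rows @ [r]) @ map pw (drop k ts)"
  proof -
    have "map (\<lambda>r. (row_F' r, row_w r)) (rows @ [r]) = map pw (map triple (rows @ [r]))"
      by (simp add: pw_def triple_def)
    then show ?thesis unfolding tk ts(2) by (simp flip: map_append)
  qed
  have En: "E n = foldl Estep CG (zip (map snd (vals gs)) (map snd (vals ws)))"
    unfolding zip by (simp add: E_def n_def)
  have len: "length (vals gs) = length (vals ws)" using ts by simp
  \<comment> \<open>A non-empty \<open>E k\<close> is the last set of the chain; here the hypothesis
    that the element is outside \<open>Nstar\<close> leaves it a single element.\<close>
  have "finite (E k)"
  proof (cases "E k = {}")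
    case False
    then have "k = n" using k by blast
    have "d = e" if "d \<in> E n" "e \<in> E n" for d e
      using foldl_Estep_unique[OF regular red ws(2) len] that unfolding En by blast
    then show ?thesis unfolding \<open>k = n\<close> by (metis finite.simps insertCI is_singletonI' is_singleton_def)
  qed simp
  have desc: "describes A B G CG F' (expr (rows @ [r]))"
    using rows_valid_expr(1)[OF valid] r(3) by simp
  obtain ans where ans: "card_oracle F' (expr (rows @ [r])) ans" using card_oracle(1)[OF desc] by blast
  then obtain cs where cs: "ans = Some cs" using card_oracle(2)[OF desc] val \<open>finite (E k)\<close> by (cases ans) auto
  then have csv: "set cs \<subseteq> words (P F')" "wval G ` set cs = E k"
    using card_oracle(3)[OF desc] ans val by auto
  have "cs = [] \<or> map pg (drop k ts) = [] \<and> (\<forall>c\<in>set cs. not_closing F' gs ws c)"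
  proof (cases "E k = {}")
    case True
    then show ?thesis using csv by simp
  next
    case False
    then have "k = n" using k by blast
    have "not_closing F' gs ws c" if c: "c \<in> set cs" for c
    proof -
      have cw: "c \<in> words (P F')" and cE: "wval G c \<in> E n" using c csv \<open>k = n\<close> by auto
      then obtain y where y: "y \<in> CG" "gprod (vals gs) \<cdot> wval G c = y \<cdot> gprod (vals ws)"
        using foldl_Estep_closes[OF _ _ len reduced_carrier[OF red] reduced_carrier[OF ws(2)], of "wval G c" CG]
        unfolding En by blast
      have cC: "wval G c \<in> CG" using cE foldl_Estep_subset[of CG] unfolding E_def by blast
      obtain d where d: "d \<in> words (P F')" "wval G d = y" using CG_word[OF y(1)] by blast
      \<comment> \<open>If \<open>d\<close> and \<open>c\<close> agreed, \<open>c\<close> would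
        conjugate \<open>gs\<close> to \<open>ws\<close>, against \<open>nc\<close>.\<close>
      have dc: "wval G d \<noteq> wval G c" using nc[OF cC] y(2) d(2) by metis
      let ?z = "inv_word c"
      have z: "?z \<in> words (P F')" using cw by simp
      have W: "c \<in> words G" "d \<in> words G" "?z \<in> words G" "cat gs \<in> words G" "cat ws \<in> words G"
        using words_G[OF cw] words_G[OF d(1)] words_G[OF z] cat_words gw ws(1) by auto
      have "wval G (?z @ d) \<noteq> \<one>\<^bsub>grp G\<^esub>"
      proof
        assume "wval G (?z @ d) = \<one>\<^bsub>grp G\<^esub>"
        then have "ginv (wval G c) \<cdot> wval G d = \<one>\<^bsub>grp G\<^esub>"
          using W by (simp add: inv_wval mult_grp)
        then have "wval G d = wval G c"
          using W wval_in_carrier inv_equality[of "ginv (wval G c)" "wval G d"]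
          by (metis inv_closed inv_inv inv_comm)
        then show False using dc by simp
      qed
      then have "omits F' (Gen []) (?z @ d)"
        using omits_iff[of F' "Gen []" "?z @ d"] z d(1) by (simp add: generate_empty)
      moreover have "(cat gs @ c, d @ cat ws) \<in> weq G"
        using y(2) d(2) W mult_grp[OF W(4,1)] mult_grp[OF W(2,5)]
        by (simp add: wval_weq gprod_vals gw ws(1))
      moreover have "(?z @ c, []) \<in> weq G" by (rule weq_inv_word[OF W(1)])
      ultimately show ?thesis unfolding not_closing_def using z d(1) by blast
    qed
    then show ?thesis using \<open>k = n\<close> by (simp add: n_def)
  qed
  then show ?thesis unfolding not_conj_C_def
    using g w valid ans cs r(3) by blast
qed (simp add: not_conj_C_def)

section \<open>Certificates against conjugation in the whole group\<close>

lemma vals_rotate: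
  assumes "vs = a @ b" shows "vals (b @ a) = rotate (length a) (vals vs)"
  unfolding assms using rotate_append[of "vals a" "vals b"] by simp

lemma not_conj_sound:
  assumes uv: "u \<in> words G" "v \<in> words G" and nc: "not_conj u v"
  shows "\<not> conjugate (grp G) (wval G u) (wval G v)"
proof
  assume "conjugate (grp G) (wval G u) (wval G v)"
  then obtain x where x: "x \<in> carrier (grp G)" "ginv x \<cdot> wval G u \<cdot> x = wval G v"
    by (auto simp: conjugate_def conj_by_def)
  obtain gs k where gs: "cyc_word gs" "k \<in> words G" "(u @ k, k @ cat gs) \<in> weq G"
    and alt: "(\<exists>F w k. w \<in> words (P F) \<and> (v @ k, k @ w) \<in> weq G) \<or>
      (\<exists>vs k. cyc_word vs \<and> (v @ k, k @ cat vs) \<in> weq G \<and>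
        (\<forall>j<length vs. \<exists>a b. length a = j \<and> vs = a @ b \<and> not_conj_C gs (b @ a)))"
    using nc unfolding not_conj_def by blast
  have gw: "letters gs" and cyc: "cyc_reduced (vals gs)"
    using gs(1) unfolding cyc_word_iff by auto
  define \<gamma> where "\<gamma> = gprod (vals gs)"
  have \<gamma>: "\<gamma> = wval G (cat gs)" unfolding \<gamma>_def by (rule gprod_vals[OF gw])
  let ?u = "wval G u" and ?v = "wval G v" and ?k = "wval G k"
  have car: "?u \<in> carrier (grp G)" "?v \<in> carrier (grp G)" "?k \<in> carrier (grp G)" "\<gamma> \<in> carrier (grp G)"
    using uv gs(2) cat_words[OF gw] unfolding \<gamma> by (auto intro: wval_in_carrier)
  have uk: "?u \<cdot> ?k = ?k \<cdot> \<gamma>"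
    using gs(2,3) uv cat_words[OF gw] unfolding \<gamma> by (simp add: wval_weq mult_grp)
  have ux: "?u \<cdot> x = x \<cdot> ?v"
    unfolding x(2)[symmetric] using car x(1) by (simp add: group_simps)
  have \<gamma>_eq: "\<gamma> = ginv ?k \<cdot> (?u \<cdot> ?k)"
    unfolding uk using car by (simp add: cancel_inv_left)
  \<comment> \<open>A conjugator \<open>x\<close> from \<open>u\<close> to \<open>v\<close> is
    carried over to one from \<gamma> to any given conjugate \<open>y\<close> of
    \<open>v\<close>.\<close>
  have conj: "\<gamma> \<cdot> (ginv ?k \<cdot> (x \<cdot> l)) = (ginv ?k \<cdot> (x \<cdot> l)) \<cdot> y"
    if l: "l \<in> carrier (grp G)" "y \<in> carrier (grp G)" "?v \<cdot> l = l \<cdot> y" for l y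
  proof -
    have "\<gamma> \<cdot> (ginv ?k \<cdot> (x \<cdot> l)) = ginv ?k \<cdot> ((?u \<cdot> x) \<cdot> l)"
      unfolding \<gamma>_eq using car x(1) l by (simp add: group_simps)
    also have "\<dots> = ginv ?k \<cdot> (x \<cdot> (?v \<cdot> l))"
      unfolding ux using car x(1) l by (simp add: m_assoc)
    finally show ?thesis unfolding l(3) using car x(1) l by (simp add: m_assoc)
  qed
  from alt show False
  proof (elim disjE exE conjE)
    fix F w l assume w: "w \<in> words (P F)" "(v @ l, l @ w) \<in> weq G"
    then have l: "l \<in> words G" "w \<in> words G" "?v \<cdot> wval G l = wval G l \<cdot> wval G w"
      using uv by (auto simp: wval_weq mult_grp)
    note c = wval_in_carrier[OF l(1)] wval_in_carrier[OF l(2)]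
    have "wval G w \<in> S F" using w(1) by (auto simp: S_iff)
    with cyc show False
      using conj[OF c l(3)] car x(1) c unfolding \<gamma>_def
      by (intro cyc_reduced_not_conj_factor[where gs = "vals gs" and x = "wval G w" and F = F and
        k = "ginv ?k \<cdot> (x \<cdot> wval G l)"]) auto
  next
    fix vs l assume vs: "cyc_word vs" "(v @ l, l @ cat vs) \<in> weq G"
      and rot: "\<forall>j<length vs. \<exists>a b. length a = j \<and> vs = a @ b \<and> not_conj_C gs (b @ a)"
    have vw: "letters vs" and vcyc: "cyc_reduced (vals vs)"
      using vs(1) unfolding cyc_word_iff by auto
    define \<delta> where "\<delta> = gprod (vals vs)"
    have \<delta>: "\<delta> = wval G (cat vs)" unfolding \<delta>_def by (rule gprod_vals[OF vw])
    have l: "l \<in> words G" "cat vs \<in> words G" "?v \<cdot> wval G l = wval G l \<cdot> \<delta>"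
      using uv vs(2) unfolding \<delta> by (auto simp: wval_weq mult_grp)
    have c: "wval G l \<in> carrier (grp G)" "\<delta> \<in> carrier (grp G)"
      using l wval_in_carrier unfolding \<delta> by auto
    define m where "m = ginv ?k \<cdot> (x \<cdot> wval G l)"
    have m: "m \<in> carrier (grp G)" "\<gamma> \<cdot> m = m \<cdot> \<delta>"
      unfolding m_def using conj[OF c l(3)] car x(1) c by auto
    have "\<delta> = ginv m \<cdot> (\<gamma> \<cdot> m)" unfolding m(2) using m(1) c by (simp add: cancel_inv_left)
    \<comment> \<open>The direction is reversed so that \<open>vs\<close> gets rotated and
      \<open>gs\<close> stays as it is.\<close>
    then have "\<delta> \<cdot> ginv m = ginv m \<cdot> \<gamma>"
      using m(1) car by (simp add: group_simps)
    then obtain j d where j: "j < length (vals vs)" "d \<in> CG" "map fst (vals gs) = map fst (rotate j (vals vs))"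
      "gprod (vals gs) \<cdot> d = d \<cdot> gprod (rotate j (vals vs))"
      using conj_cyc_reduced_rotate[OF cyc vcyc, of "ginv m"] m(1) unfolding \<gamma>_def \<delta>_def by auto
    then obtain a b where ab: "length a = j" "vs = a @ b" "not_conj_C gs (b @ a)" using rot by auto
    have rv: "rotate j (vals vs) = vals (b @ a)" using vals_rotate[OF ab(2)] ab(1) by simp
    have "reduced (vals (b @ a))"
      using cyc_reduced_reduced[OF cyc_reduced_rotate[OF vcyc, of j]] unfolding rv .
    moreover have "letters (b @ a)" using vw ab(2) by auto
    moreover have "map fst gs = map fst (b @ a)" using j(3) unfolding rv by (simp add: comp_def)
    ultimately have "\<not> not_conj_C gs (b @ a)"
      using j(2,4) unfolding rv by (intro not_conj_C_sound[OF gw cyc_reduced_reduced[OF cyc]])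
    then show False using ab(3) by simp
  qed
qed

lemma conj_answer_sound:
  assumes "u \<in> words G" "v \<in> words G" "conj_answer (u, v) ans"
  shows "case ans of None \<Rightarrow> \<not> conjugate (grp G) (wval G u) (wval G v)
    | Some g \<Rightarrow> g \<in> words G \<and> conj_by (grp G) (wval G u) (wval G g) = wval G v"
proof (cases ans)
  case None
  then show ?thesis using assms not_conj_sound by (simp add: conj_answer_def)
next
  case (Some g)
  then have "(u @ g, g @ v) \<in> weq G" using assms by (simp add: conj_answer_def)
  then have g: "g \<in> words G" "wval G u \<cdot> wval G g = wval G g \<cdot> wval G v"
    using assms by (auto simp: wval_weq mult_grp)
  note car = wval_in_carrier[OF assms(1)] wval_in_carrier[OF assms(2)] wval_in_carrier[OF g(1)]
  have "conj_by (grp G) (wval G u) (wval G g) = ginv (wval G g) \<cdot> (wval G u \<cdot> wval G g)"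
    using car by (simp add: conj_by_def m_assoc)
  also have "\<dots> = wval G v" unfolding g(2) using car by (simp add: cancel_inv_left)
  finally show ?thesis using Some g(1) by simp
qed

lemma ex_cyc_word:
  assumes "cyc_reduced xs"
  obtains gs where "cyc_word gs" "gprod xs = wval G (cat gs)" "xs = vals gs"
proof -
  have "\<forall>p\<in>set xs. snd p \<in> S (fst p)" using assms by (auto simp: cyc_reduced_def reduced_def)
  then obtain gs where gs: "xs = vals gs" "letters gs" using ex_vals by blast
  then show thesis using that[of gs] assms gprod_vals[OF gs(2)] by (simp add: cyc_word_iff)
qed

lemma carrier_word: "x \<in> carrier (grp G) \<Longrightarrow> \<exists>w\<in>words G. x = wval G w"
  by (auto simp: carrier_grp)

lemma not_conj_complete:
  assumes uv: "u \<in> words G" "v \<in> words G"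
    and cr: "wval G u \<in> CR_gt1 (grp G) (S FactorA) (S FactorB) CG"
    and nc: "\<not> conjugate (grp G) (wval G u) (wval G v)"
  shows "not_conj u v"
proof -
  let ?u = "wval G u" and ?v = "wval G v"
  have uvc: "?u \<in> carrier (grp G)" "?v \<in> carrier (grp G)" using uv by (auto intro: wval_in_carrier)
  obtain \<gamma> where \<gamma>: "conjugate (grp G) ?u \<gamma>" "cyclically_reduced (grp G) (S FactorA) (S FactorB) CG \<gamma>"
    "regular (grp G) CG \<gamma>" "form_length (grp G) (S FactorA) (S FactorB) CG \<gamma> > 1"
    using cr unfolding CR_gt1_def by blast
  obtain xs where xs: "cyc_reduced xs" "gprod xs = \<gamma>" using cyclically_reduced_tags[OF \<gamma>(2,4)] .
  obtain gs where gs: "cyc_word gs" "gprod xs = wval G (cat gs)" "xs = vals gs" using ex_cyc_word[OF xs(1)] .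
  have gw: "letters gs" using gs(1) unfolding cyc_word_iff by blast
  have \<gamma>c: "\<gamma> \<in> carrier (grp G)" using \<gamma>(3) by (simp add: regular_def)
  \<comment> \<open>Regularity excludes only the part of \<open>Nstar\<close> outside C; the length
    is what puts \<gamma> outside C, hence outside \<open>Nstar\<close>.\<close>
  have "tp \<gamma> \<noteq> []" using tp_gprod_reduced[OF cyc_reduced_reduced[OF xs(1)]] xs by (auto simp: cyc_reduced_def)
  then have "\<gamma> \<notin> CG" using tp_C by blast
  then have regular: "\<gamma> \<notin> Nstar (grp G) CG" using \<gamma>(3) by (simp add: regular_def BH_def)
  obtain y where y: "y \<in> carrier (grp G)" "ginv y \<cdot> ?u \<cdot> y = \<gamma>"
    using \<gamma>(1) by (auto simp: conjugate_def conj_by_def)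
  obtain k where k: "k \<in> words G" "y = wval G k" using carrier_word[OF y(1)] by blast
  have uk: "?u \<cdot> y = y \<cdot> \<gamma>"
    unfolding y(2)[symmetric] using y(1) uvc by (simp add: group_simps)
  then have 1: "(u @ k, k @ cat gs) \<in> weq G"
    using uv k cat_words[OF gw] gs(2) xs(2) by (simp add: wval_weq mult_grp)
  from ex_cyc_form[OF uvc(2)] show ?thesis
  proof
    assume "\<exists>l\<in>carrier (grp G). \<exists>F. \<exists>x\<in>S F. ?v \<cdot> l = l \<cdot> x"
    then obtain l F x where l: "l \<in> carrier (grp G)" "x \<in> S F" "?v \<cdot> l = l \<cdot> x" by blast
    obtain lw where lw: "lw \<in> words G" "l = wval G lw" using carrier_word[OF l(1)] by blast
    obtain w where w: "w \<in> words (P F)" "x = wval G w" using l(2) unfolding S_iff by blast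
    have "(v @ lw, lw @ w) \<in> weq G"
      using uv lw w words_G[OF w(1)] l(3) by (simp add: wval_weq mult_grp)
    then show ?thesis unfolding not_conj_def using gs(1) k(1) 1 w(1) by blast
  next
    assume "\<exists>l\<in>carrier (grp G). \<exists>zs. cyc_reduced zs \<and> ?v \<cdot> l = l \<cdot> gprod zs"
    then obtain l ys where l: "l \<in> carrier (grp G)" "cyc_reduced ys" "?v \<cdot> l = l \<cdot> gprod ys" by blast
    obtain lw where lw: "lw \<in> words G" "l = wval G lw" using carrier_word[OF l(1)] by blast
    obtain vs where vs: "cyc_word vs" "gprod ys = wval G (cat vs)" "ys = vals vs" using ex_cyc_word[OF l(2)] .
    have vw: "letters vs" using vs(1) unfolding cyc_word_iff by blast
    have 2: "(v @ lw, lw @ cat vs) \<in> weq G"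
      using uv lw cat_words[OF vw] l(3) vs(2) by (simp add: wval_weq mult_grp)
    have "\<exists>a b. length a = j \<and> vs = a @ b \<and> not_conj_C gs (b @ a)" if j: "j < length vs" for j
    proof (intro exI conjI)
      let ?a = "take j vs" and ?b = "drop j vs"
      show "length ?a = j" "vs = ?a @ ?b" using j by auto
      have "reduced (vals (?b @ ?a))"
        using vals_rotate[of vs ?a ?b] cyc_reduced_reduced[OF cyc_reduced_rotate[OF l(2), of j]] j vs(3) by simp
      moreover have baw: "letters (?b @ ?a)"
        using vw by (auto dest: in_set_takeD in_set_dropD)
      moreover have "gprod (vals gs) \<cdot> c \<noteq> c \<cdot> gprod (vals (?b @ ?a))" if c: "c \<in> CG" for c
      proof
        assume "gprod (vals gs) \<cdot> c = c \<cdot> gprod (vals (?b @ ?a))"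
        then have eq: "\<gamma> \<cdot> c = c \<cdot> wval G (cat (?b @ ?a))"
          using gprod_vals[OF baw] gs(3) xs(2) by simp
        define \<alpha> where "\<alpha> = wval G (cat ?a)"
        define \<beta> where "\<beta> = wval G (cat ?b)"
        have aw: "cat ?a \<in> words G" "cat ?b \<in> words G" using cat_words[of ?a] cat_words[of ?b] baw by auto
        have ac: "\<alpha> \<in> carrier (grp G)" "\<beta> \<in> carrier (grp G)" "c \<in> carrier (grp G)"
          unfolding \<alpha>_def \<beta>_def using aw wval_in_carrier C_carrier[OF c] by auto
        have ba: "wval G (cat (?b @ ?a)) = \<beta> \<cdot> \<alpha>" unfolding \<alpha>_def \<beta>_def using aw by (simp add: mult_grp)
        have "cat vs = cat ?a @ cat ?b" by (metis append_take_drop_id concat_append map_append)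
        then have ab: "gprod ys = \<alpha> \<cdot> \<beta>" unfolding \<alpha>_def \<beta>_def vs(2) using aw by (simp add: mult_grp)
        \<comment> \<open>The conjugator is composed of four steps: \<open>y\<close> takes
          \<open>u\<close> to \<gamma>, \<open>c\<close> takes \<gamma> to \<beta>\<alpha>, the
          inverse of \<alpha> takes this to \<alpha>\<beta>, and the inverse of \<open>l\<close>
          takes that to \<open>v\<close>.\<close>
        define m where "m = y \<cdot> (c \<cdot> (ginv \<alpha> \<cdot> ginv l))"
        have mc: "m \<in> carrier (grp G)" unfolding m_def using ac y(1) l(1) by simp
        have v_eq: "?v = l \<cdot> (\<alpha> \<cdot> (\<beta> \<cdot> ginv l))"
        proof -
          have "?v = (?v \<cdot> l) \<cdot> ginv l" using uvc l(1) by (simp add: m_assoc)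
          then show ?thesis unfolding l(3) ab using ac l(1) by (simp add: m_assoc)
        qed
        have "?u \<cdot> m = (?u \<cdot> y) \<cdot> (c \<cdot> (ginv \<alpha> \<cdot> ginv l))"
          unfolding m_def using ac y(1) l(1) uvc by (simp add: m_assoc)
        also have "\<dots> = y \<cdot> ((\<gamma> \<cdot> c) \<cdot> (ginv \<alpha> \<cdot> ginv l))"
          unfolding uk using ac y(1) l(1) \<gamma>c by (simp add: m_assoc)
        also have "\<dots> = m \<cdot> ?v"
          unfolding eq ba v_eq m_def using ac y(1) l(1) by (simp add: group_simps)
        finally have "conj_by (grp G) ?u m = ?v"
          using mc uvc unfolding conj_by_def by (simp add: m_assoc cancel_inv_left)
        then show False using nc mc unfolding conjugate_def by blast
      qed
      ultimately show "not_conj_C gs (?b @ ?a)"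
        using not_conj_C_complete[OF gs(1)] regular gs(3) xs(2) by blast
    qed
    then show ?thesis unfolding not_conj_def using gs(1) k(1) 1 vs(1) 2 by blast
  qed
qed

lemma conj_answer_complete:
  assumes uv: "u \<in> words G" "v \<in> words G"
    and cr: "wval G u \<in> CR_gt1 (grp G) (S FactorA) (S FactorB) CG"
  shows "\<exists>ans. conj_answer (u, v) ans"
proof (cases "conjugate (grp G) (wval G u) (wval G v)")
  case True
  then obtain x where x: "x \<in> carrier (grp G)" "ginv x \<cdot> wval G u \<cdot> x = wval G v"
    by (auto simp: conjugate_def conj_by_def)
  obtain g where g: "g \<in> words G" "x = wval G g" using carrier_word[OF x(1)] by blast
  have "wval G u \<cdot> x = x \<cdot> wval G v"
    unfolding x(2)[symmetric] using x(1) wval_in_carrier[OF uv(1)] by (simp add: group_simps)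
  then have "(u @ g, g @ v) \<in> weq G" using uv g by (simp add: wval_weq mult_grp)
  then show ?thesis by (auto simp: conj_answer_def)
next
  case False
  then show ?thesis using not_conj_complete[OF uv cr] by (auto simp: conj_answer_def)
qed

theorem conjugacy_search:
  "conjugacy_search_problem_on
    {(u, v). u \<in> words G \<and> v \<in> words G \<and> wval G u \<in> CR_gt1 (grp G) (S FactorA) (S FactorB) CG} G"
  unfolding conjugacy_search_problem_on_def
  by (rule decidable_onI[OF semi_conj_answer])
    (use conj_answer_complete in blast, use conj_answer_sound in \<open>auto split: prod.splits\<close>)

end

theorem theorem4p15:
  fixes A B :: presentation
    and C :: "('c, 'm) monoid_scheme"
    and zs :: "'c list"
    and \<phi> \<psi> :: "'c \<Rightarrow> word set"
    and zA zB :: "word list"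
  defines "G \<equiv> amalgam A B zA zB"
  assumes "finite_presentation A" and "finite_presentation B"
    and "gens A \<inter> gens B = {}"
    and "group C"
    and "set zs \<subseteq> carrier C" and "generate C (set zs) = carrier C"
    and "\<phi> \<in> hom C (grp A)" and "inj_on \<phi> (carrier C)"
    and "\<psi> \<in> hom C (grp B)" and "inj_on \<psi> (carrier C)"
    and "set zA \<subseteq> words A" and "map (wval A) zA = map \<phi> zs"
    and "set zB \<subseteq> words B" and "map (wval B) zB = map \<psi> zs"
    and "word_problem A" and "word_problem B"
    and "membership_search_problem A zA" and "membership_search_problem B zB"
    and "coset_representative_search_problem A zA"
    and "coset_representative_search_problem B zB"
    and "cardinality_search_problem A B zA zB FactorA"
    and "cardinality_search_problem A B zA zB FactorB"
  shows "conjugacy_search_problem_on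
    {(u, v). u \<in> words G \<and> v \<in> words G \<and>
       wval G u \<in> CR_gt1 (grp G) (factor_in G A) (factor_in G B) (subgrp G zA)}
    G"
proof -
  interpret ap: amalgam_presentation A B C zs \<phi> \<psi> zA zB
    by (intro amalgam_presentation.intro) (fact assms)+
  have G: "ap.G = G" by (simp add: ap.G_def assms(1))
  have CG: "ap.CG = subgrp G zA" by (simp add: ap.CG_def G)
  let ?N = "\<lambda>F D ans. case ans of
      None \<Rightarrow> infinite (set_val ap.G D)
    | Some ws \<Rightarrow> set ws \<subseteq> words (ap.P F) \<and> wval ap.G ` set ws = set_val ap.G D"
  have "cardinality_search_problem A B zA zB F" for F using assms by (cases F) simp_all
  then have "\<forall>F. \<exists>Q. solves {D. describes A B ap.G ap.CG F D} (?N F) Q"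
    unfolding cardinality_search_problem_def Let_def ap.G_def ap.CG_def by (intro allI ex_solves)
  from choice[OF this] obtain N where N: "\<forall>F. solves {D. describes A B ap.G ap.CG F D} (?N F) (N F)" ..
  interpret amalgam_oracles A B C zs \<phi> \<psi> zA zB N
    by (intro amalgam_oracles.intro ap.amalgam_presentation_axioms amalgam_oracles_axioms.intro N[rule_format])
  show ?thesis using conjugacy_search by (simp add: G CG ap.S_def)
qed

end
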